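(* Let $D>1$, $c>5/2+\log D$, and let $p_{lk}=n^{-c}$ for all nodes in the Bayesian CART prior. Suppose $f_0$ satisfies Assumption (F)(b) (stated in the context) with $|\mathcal T^*_{int}|\lesssim\log^2 n$ and with the constant $A>0$ (independent of $n$) sufficiently large. Then, with probability at least $1-4/n$, the $\epsilon$-mixing time of the Twiggy Bayesian CART Markov chain with parameter $D$ satisfies $$\tau_\epsilon\le\frac{D^L-1}{D-1}\times2^{2L+3}\left\{n\left[\left(c+\frac12\right)\log(1+n)+|\mathcal T^*_{int}|\,C_{f_0}^2+1\right]+4\,|\mathcal T^*_{int}|\log n+\log\left(\frac2\epsilon\right)\right\}.$$
   Context: Model: $n=2^{L_{\max}+1}$, $x_i=i/n$, and $Y_i=f_0(x_i)+\varepsilon_i$ for $i=1,\dots,n$ with $\varepsilon_i$ i.i.d. $\mathcal N(0,1)$; probability refers to the law of $Y=(Y_1,\dots,Y_n)'$. Haar basis: $\psi_{-10}=I_{[0,1]}$ and $\psi_{lk}(x)=2^{l/2}\psi(2^lx-k)$ for $l\ge 0$, $0\le k<2^l$, with $\psi=I_{(0,1/2]}-I_{(1/2,1]}$. $\bm X$ is the $n\times p$ matrix, $p=2^{L_{\max}}=n/2$, whose columns are $(\psi_{lk}(x_i))_{i\le n}$ for $(l,k)=(-1,0)$ and $0\le l<L_{\max}$, $0\le k<2^l$ (so $\bm X'\bm X=nI_p$). $a_n\lesssim b_n$ means $a_n\le Cb_n$ for a constant $C>0$ not depending on $n$. Trees: fix $L\le L_{\max}$. A tree $\mathcal T$ of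 depth at most $L$ is determined by its set of internal nodes $\mathcal T_{int}$, consisting of $(-1,0)$ together with a (possibly empty) set of nodes $(l,k)$, $0\le l<L$, $0\le k<2^l$, that contains with each $(l,k)$, $l\ge1$, its parent $(l-1,\lfloor k/2\rfloor)$. The children of $(l,k)$ ($l\ge 0$) are $(l+1,2k),(l+1,2k+1)$; the only child of $(-1,0)$ is $(0,0)$. The external nodes $\mathcal T_{ext}$ are the nodes not in $\mathcal T_{int}$ that are children of nodes in $\mathcal T_{int}$. $\mathbb T_L$ is the set of all such trees; $\mathcal T_{null}$ has internal node set $\{(-1,0)\}$; $\mathcal T^L_{full}$ has all nodes with $l<L$ internal. Bayesian CART prior and posterior: $\Pi(\mathcal T)\propto\prod_{(l,k)\in\mathcal T_{int}}p_{lk}\prod_{(l,k)\in\mathcal T_{ext}}(1-p_{lk})$ on $\mathbb T_L$; given $\mathcal T$, the coefficients $\beta_{lk}$, $(l,k)\in\mathcal T_{int}$, are i.i.d. $\mathcal N(0,1)$ and all others are $0$; the likelihood is $Y\mid\beta\sim\mathcal N(\bm X\beta,I_n)$. Equivalently $\Pi(\mathcal T\mid Y)\propto\Pi(\mathcal T)N_Y(\mathcal T)$ with $N_Y(\mathcal T)=(2\pi)^{-n/2}(1+n)^{-|\mathcal T_{ext}|/2}\exp\{-\frac12Y'[I-\bm X_{\mathcal T}\Sigma_{\mathcal T}\bm X_{\mathcal T}']Y\}$, $\Sigma_{\mathcal T}=\frac n{n+1}(\bm X_{\mathcal T}'\bm X_{\mathcal T})^{-1}$, $\bm X_{\mathcal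 T}$ being the columns of $\bm X$ indexed by $\mathcal T_{int}$. Assumption (F): $f_0=\sum_{(l,k)\in\mathcal B}\beta^*_{lk}\psi_{lk}$ for some $\mathcal B\subseteq\{(l,k):l<L\}$ with $A\log n/\sqrt n<|\beta^*_{lk}|<C_{f_0}$ for all $(l,k)\in\mathcal B$, for constants $A>0$, $C_{f_0}>0$. $\mathcal T^*\in\mathbb T_L$ denotes the smallest tree with $\mathcal B\subseteq\mathcal T^*_{int}$. (b): $\mathcal B$ is not the internal node set of a tree in $\mathbb T_L$. Twigs: for $(l,k)$ equal to or an ancestor of $(l',k')$, $0\le l\le l'<L$, the twig $[(l,k)\leftrightarrow(l',k')]$ is the set of nodes on the path from $(l,k)$ to $(l',k')$ (both included). For $(l,k)\in\mathcal T_{int}$, $D_{lk}(\mathcal T)$ is the set of internal nodes of $\mathcal T$ that equal $(l,k)$ or descend from it. Twiggy Bayesian CART chain (Metropolis--Hastings on $\mathbb T_L$): with probability $1/2$ each, propose GROW or PRUNE (always GROW at $\mathcal T_{null}$, always PRUNE at $\mathcal T^L_{full}$). GROW: pick a layer $l^*$ from $E=\{0\le l<L:\exists k,\ (l,k)\notin\mathcal T_{int}\}$ with probability $d_{l^*}=D^{-l^*}/\sum_{l\in E}D^{-l}$, then $k^*$ uniformly from $\mathcal K_{l^*}=\{k:(l^*,k)\notin\mathcal T_{int}\}$, and set $\widetilde{\mathcal T}_{int}=\mathcal T_{int}\cup[(\tilde l,\tilde k)\leftrightarrow(l^*,k^* )]$, where $(\tilde l,\tilde k)\in\mathcal T_{ext}$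 is the external node closest to $(l^*,k^* )$ (the one that equals or is an ancestor of it); $S_{GROW}(\mathcal T\to\widetilde{\mathcal T})=d_{l^*}/|\mathcal K_{l^*}|$. PRUNE: pick uniformly a node $(\tilde l,\tilde k)\in\mathcal T_{int}$, $\tilde l\ge0$, among those for which $D_{\tilde l\tilde k}(\mathcal T)$ is a twig $[(\tilde l,\tilde k)\leftrightarrow(l^*,k^* )]$, and set $\widetilde{\mathcal T}_{int}=\mathcal T_{int}\setminus D_{\tilde l\tilde k}(\mathcal T)$. With $S(\mathcal T\to\widetilde{\mathcal T})$ the overall proposal probability (including the GROW/PRUNE choice), accept with probability $\min\{1,\frac{\Pi(\widetilde{\mathcal T}\mid Y)S(\widetilde{\mathcal T}\to\mathcal T)}{\Pi(\mathcal T\mid Y)S(\mathcal T\to\widetilde{\mathcal T})}\}$, otherwise stay. With $\widetilde P$ the resulting transition matrix, the chain analysed is the lazy chain $P=\widetilde P/2+I/2$. Mixing time: $\tau_\epsilon=\max_{\mathcal T\in\mathbb T_L}\min\{t\in\mathbb N:\|P^{t'}(\mathcal T,\cdot)-\Pi(\cdot\mid Y)\|_{TV}\le\epsilon\text{ for all }t'\ge t\}$, $\epsilon\in(0,1)$. *)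

theory Defs
  imports "HOL-Probability.Probability" "HOL-Library.Extended_Nat"
begin

section \<open>Haar basis and data\<close>

text \<open>A node is a pair (level, position); the level of the root \<open>(-1, 0)\<close> makes it an integer.\<close>

type_synonym node = "int \<times> nat"

definition haar_mother :: "real \<Rightarrow> real" where
  "haar_mother x = indicator {0<..1/2} x - indicator {1/2<..1} x"

fun haar :: "node \<Rightarrow> real \<Rightarrow> real" where
  "haar (l, k) x =
     (if l = -1 then indicator {0..1} x
      else 2 powr (real_of_int l / 2) * haar_mother (2 ^ nat l * x - real k))"

definition std_normal :: "real measure" where
  "std_normal = density lborel std_normal_density"

definition data_law :: "nat \<Rightarrow> (real \<Rightarrow> real) \<Rightarrow> (nat \<Rightarrow> real) measure" where
  "data_law n f = distr (Pi\<^sub>M {1..n} (\<lambda>_. std_normal)) (Pi\<^sub>M {1..n} (\<lambda>_. borel))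
     (\<lambda>e. \<lambda>i\<in>{1..n}. f (real i / real n) + e i)"

section \<open>Trees\<close>

definition nodes :: "nat \<Rightarrow> node set" where
  "nodes L = insert (-1, 0) {(l, k). 0 \<le> l \<and> l < int L \<and> k < 2 ^ nat l}"

text \<open>The parent of \<open>(0, 0)\<close> comes out as the root \<open>(-1, 0)\<close>.\<close>

fun parent :: "node \<Rightarrow> node" where
  "parent (l, k) = (l - 1, k div 2)"

fun children :: "node \<Rightarrow> node set" where
  "children (l, k) = (if l = -1 then {(0, 0)} else {(l + 1, 2 * k), (l + 1, 2 * k + 1)})"

text \<open>A tree is represented by its set of internal nodes.\<close>

definition trees :: "nat \<Rightarrow> node set set" where
  "trees L = {T. T \<subseteq> nodes L \<and> (-1, 0) \<in> T \<and> (\<forall>v\<in>T. fst v \<ge> 1 \<longrightarrow> parent v \<in> T)}"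

definition ext_nodes :: "node set \<Rightarrow> node set" where
  "ext_nodes T = (\<Union>v\<in>T. children v) - T"

definition null_tree :: "node set" where
  "null_tree = {(-1, 0)}"

definition least_tree :: "nat \<Rightarrow> node set \<Rightarrow> node set" where
  "least_tree L B = (LEAST T. T \<in> trees L \<and> B \<subseteq> T)"

section \<open>Bayesian CART prior and posterior\<close>

definition prior_weight :: "(node \<Rightarrow> real) \<Rightarrow> node set \<Rightarrow> real" where
  "prior_weight p T = (\<Prod>v\<in>T. p v) * (\<Prod>v\<in>ext_nodes T. 1 - p v)"

definition tree_prior :: "(node \<Rightarrow> real) \<Rightarrow> nat \<Rightarrow> node set \<Rightarrow> real" where
  "tree_prior p L T = prior_weight p T / (\<Sum>T'\<in>trees L. prior_weight p T')"

text \<open>The likelihood of \<open>Y\<close> given \<open>T\<close>: the \<open>N(X \<beta>, I)\<close> density integrated over the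
  standard normal coefficients of the internal nodes; all other coefficients are zero.\<close>

definition marginal_likelihood :: "nat \<Rightarrow> (nat \<Rightarrow> real) \<Rightarrow> node set \<Rightarrow> real" where
  "marginal_likelihood n Y T =
     (\<integral>\<beta>. (\<Prod>i=1..n. normal_density (\<Sum>v\<in>T. haar v (real i / real n) * \<beta> v) 1 (Y i))
        \<partial>(Pi\<^sub>M T (\<lambda>_. std_normal)))"

definition posterior ::
  "(node \<Rightarrow> real) \<Rightarrow> nat \<Rightarrow> nat \<Rightarrow> (nat \<Rightarrow> real) \<Rightarrow> node set \<Rightarrow> real" where
  "posterior p L n Y T =
     tree_prior p L T * marginal_likelihood n Y T /
     (\<Sum>T'\<in>trees L. tree_prior p L T' * marginal_likelihood n Y T')"

section \<open>Twigs and the Twiggy proposal\<close>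

definition anc_eq :: "node \<Rightarrow> node \<Rightarrow> bool" where
  "anc_eq u v \<longleftrightarrow> (\<exists>j. u = (parent ^^ j) v)"

definition twig :: "node \<Rightarrow> node \<Rightarrow> node set" where
  "twig u v = {w. anc_eq u w \<and> anc_eq w v}"

definition descendants :: "node set \<Rightarrow> node \<Rightarrow> node set" where
  "descendants T u = {w \<in> T. anc_eq u w}"

definition open_layers :: "nat \<Rightarrow> node set \<Rightarrow> int set" where
  "open_layers L T = {l. 0 \<le> l \<and> l < int L \<and> (\<exists>k < 2 ^ nat l. (l, k) \<notin> T)}"

definition open_positions :: "node set \<Rightarrow> int \<Rightarrow> nat set" where
  "open_positions T l = {k. k < 2 ^ nat l \<and> (l, k) \<notin> T}"

definition layer_prob :: "real \<Rightarrow> nat \<Rightarrow> node set \<Rightarrow> int \<Rightarrow> real" where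
  "layer_prob D L T l = D powi (- l) / (\<Sum>l'\<in>open_layers L T. D powi (- l'))"

definition grow :: "node set \<Rightarrow> node \<Rightarrow> node set" where
  "grow T v = T \<union> twig (THE u. u \<in> ext_nodes T \<and> anc_eq u v) v"

definition grow_prob :: "real \<Rightarrow> nat \<Rightarrow> node set \<Rightarrow> node set \<Rightarrow> real" where
  "grow_prob D L T T' =
     (\<Sum>l\<in>open_layers L T. \<Sum>k\<in>open_positions T l.
        if grow T (l, k) = T' then layer_prob D L T l / real (card (open_positions T l)) else 0)"

definition prunable :: "node set \<Rightarrow> node set" where
  "prunable T = {u \<in> T. fst u \<ge> 0 \<and> (\<exists>v. anc_eq u v \<and> descendants T u = twig u v)}"

definition prune_prob :: "node set \<Rightarrow> node set \<Rightarrow> real" where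
  "prune_prob T T' =
     (\<Sum>u\<in>prunable T. if T - descendants T u = T' then 1 / real (card (prunable T)) else 0)"

definition proposal :: "real \<Rightarrow> nat \<Rightarrow> node set \<Rightarrow> node set \<Rightarrow> real" where
  "proposal D L T T' =
     (if T = null_tree then grow_prob D L T T'
      else if T = nodes L then prune_prob T T'
      else grow_prob D L T T' / 2 + prune_prob T T' / 2)"

section \<open>Finite Markov chains\<close>

text \<open>Metropolis--Hastings kernel on the finite set \<open>S\<close> with proposal \<open>Q\<close> and target \<open>\<pi>\<close>.
  If \<open>Q x y = 0\<close>, the quotient is zero by convention, but its value does not matter.\<close>

definition mh_kernel ::
  "'s set \<Rightarrow> ('s \<Rightarrow> 's \<Rightarrow> real) \<Rightarrow> ('s \<Rightarrow> real) \<Rightarrow> 's \<Rightarrow> 's \<Rightarrow> real" where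
  "mh_kernel S Q \<pi> x y =
     (let move = (\<lambda>z. Q x z * min 1 (\<pi> z * Q z x / (\<pi> x * Q x z)))
      in if y = x then 1 - (\<Sum>z\<in>S - {x}. move z) else move y)"

definition lazy :: "('s \<Rightarrow> 's \<Rightarrow> real) \<Rightarrow> 's \<Rightarrow> 's \<Rightarrow> real" where
  "lazy P x y = P x y / 2 + of_bool (x = y) / 2"

fun kernel_power :: "'s set \<Rightarrow> ('s \<Rightarrow> 's \<Rightarrow> real) \<Rightarrow> nat \<Rightarrow> 's \<Rightarrow> 's \<Rightarrow> real" where
  "kernel_power S P 0 x y = of_bool (x = y)"
| "kernel_power S P (Suc t) x y = (\<Sum>z\<in>S. kernel_power S P t x z * P z y)"

definition tv_dist :: "'s set \<Rightarrow> ('s \<Rightarrow> real) \<Rightarrow> ('s \<Rightarrow> real) \<Rightarrow> real" where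
  "tv_dist S \<mu> \<nu> = Max ((\<lambda>A. \<bar>sum \<mu> A - sum \<nu> A\<bar>) ` Pow S)"

text \<open>Extended naturals: the infimum of the empty set is \<open>\<infinity>\<close>, so a finite bound on the
  mixing time includes the claim that the chain does get (and stay) \<open>\<epsilon>\<close>-close.\<close>

definition mixing_time ::
  "'s set \<Rightarrow> ('s \<Rightarrow> 's \<Rightarrow> real) \<Rightarrow> ('s \<Rightarrow> real) \<Rightarrow> real \<Rightarrow> enat" where
  "mixing_time S P \<pi> \<epsilon> =
     Max ((\<lambda>x. INF t\<in>{t. \<forall>t'\<ge>t. tv_dist S (kernel_power S P t' x) \<pi> \<le> \<epsilon>}. enat t) ` S)"

definition twiggy_chain ::
  "real \<Rightarrow> (node \<Rightarrow> real) \<Rightarrow> nat \<Rightarrow> nat \<Rightarrow> (nat \<Rightarrow> real) \<Rightarrow> node set \<Rightarrow> node set \<Rightarrow> real" where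
  "twiggy_chain D p L n Y = lazy (mh_kernel (trees L) (proposal D L) (posterior p L n Y))"

definition twiggy_mixing_time ::
  "real \<Rightarrow> (node \<Rightarrow> real) \<Rightarrow> nat \<Rightarrow> nat \<Rightarrow> (nat \<Rightarrow> real) \<Rightarrow> real \<Rightarrow> enat" where
  "twiggy_mixing_time D p L n Y \<epsilon> =
     mixing_time (trees L) (twiggy_chain D p L n Y) (posterior p L n Y) \<epsilon>"

section \<open>Assumptions on the regression function\<close>

definition assumption_F ::
  "real \<Rightarrow> real \<Rightarrow> nat \<Rightarrow> nat \<Rightarrow> (real \<Rightarrow> real) \<Rightarrow> node set \<Rightarrow> (node \<Rightarrow> real) \<Rightarrow> bool" where
  "assumption_F A C L n f B \<beta> \<longleftrightarrow>
     B \<subseteq> nodes L \<and>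
     (\<forall>x\<in>{0..1}. f x = (\<Sum>v\<in>B. \<beta> v * haar v x)) \<and>
     (\<forall>v\<in>B. A * ln (real n) / sqrt (real n) < \<bar>\<beta> v\<bar> \<and> \<bar>\<beta> v\<bar> < C)"

definition assumption_Fb ::
  "real \<Rightarrow> real \<Rightarrow> nat \<Rightarrow> nat \<Rightarrow> (real \<Rightarrow> real) \<Rightarrow> node set \<Rightarrow> (node \<Rightarrow> real) \<Rightarrow> bool" where
  "assumption_Fb A C L n f B \<beta> \<longleftrightarrow> assumption_F A C L n f B \<beta> \<and> B \<notin> trees L"

end

theory Submission
  imports Defs
begin

text \<open>The columns of the design matrix are orthogonal, so the marginal likelihood of a tree is a product
over its internal nodes. A tree has as many external as internal nodes, so the prior is such a
product as well, and the posterior mass of \<open>T\<close> is proportional to a product of node weights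
\<open>w v\<close> over \<open>v \<in> T\<close>. The whole analysis rests on the size of these weights. The noise parts of the
normalised empirical Haar coefficients are standard normal; outside an event of probability \<open>1 / n\<close>
(\<open>typical_prob\<close>) they are all at most \<open>2 * sqrt (ln n)\<close>. Then \<open>w v \<le> 1 / n\<close> at every node without
signal, because \<open>c > 5 / 2\<close>; \<open>w v\<close> is at least a fixed power of \<open>1 / n\<close> at every node; and
\<open>w v\<close> is at least \<open>exp (a * (ln n)\<^sup>2)\<close> at every node of \<open>B\<close>, where \<open>a\<close> grows like \<open>A\<^sup>2 / 4\<close>.

A twig has at most about \<open>log\<^sub>2 n\<close> nodes, so for large \<open>A\<close> a single signal node pays for all
the nodes on the twig that ends in it. This is where twigs help: adding the nodes of such a
twig one at a time would lead through trees of small posterior mass. From any tree one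
therefore reaches the smallest tree \<open>R\<close> containing \<open>B\<close> along a path on which the posterior
mass never decreases: grow twigs to the missing signal nodes, then remove one by one the leaves
outside \<open>R\<close> (\<open>canonical_step\<close>). The path has fewer than \<open>2 ^ L\<close> moves, and each move has a
proposal probability of at least \<open>min_rate D L\<close> in both directions.

The posterior mass of all trees whose path runs through a given tree \<open>z\<close> is at most twice the mass
of \<open>z\<close> (\<open>upstream_mass\<close>). There are two ways to lie behind \<open>z\<close>. Additional nodes outside \<open>R\<close>
contribute a factor of at most \<open>exp (\<Sum> w v) \<le> exp (1 / 2)\<close>. Missing nodes of \<open>R\<close> cost at least one
twig, and there are at most \<open>2 ^ card R \<le> exp (K * (ln n)\<^sup>2)\<close> choices for them; the gain of one twig
exceeds this number, again because \<open>A\<close> is large. This is the place where the bound on the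
size of \<open>R\<close> enters.

The method of canonical paths (\<open>canonical_path_poincare\<close>) turns these facts into a Poincare
inequality whose constant is a quarter of the factor \<open>(D ^ L - 1) / (D - 1) * 2 ^ (2 * L + 3)\<close>
of the claim. Laziness makes the variance of \<open>P\<^sup>t f\<close> contract geometrically, and the
variance controls the total variation distance up to \<open>1 / sqrt (\<pi> x)\<close>. The bracket in the
claim is a bound for the logarithm of \<open>1 / \<pi> x\<close>, up to an additive constant, plus the term in
\<open>\<epsilon>\<close>: the summand \<open>n * ((c + 1 / 2) * ln (1 + n) + 1)\<close> bounds the smallest tree weight from
below, and \<open>card R * (n * C\<^sup>2 + 4 * ln n)\<close> bounds the weight of \<open>R\<close> from above.\<close>

section \<open>Canonical paths and mixing of reversible chains\<close>

text \<open>The parameter \<open>P\<close> is the kernel before it is made lazy; the chain that mixes is \<open>lazy P\<close>.\<close>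

locale reversible_chain =
  fixes S :: "'s set" and P :: "'s \<Rightarrow> 's \<Rightarrow> real" and \<pi> :: "'s \<Rightarrow> real"
  assumes finite_states: "finite S"
    and P_nonneg: "\<And>x y. x \<in> S \<Longrightarrow> y \<in> S \<Longrightarrow> 0 \<le> P x y"
    and P_row_sum: "\<And>x. x \<in> S \<Longrightarrow> (\<Sum>y\<in>S. P x y) = 1"
    and \<pi>_pos: "\<And>x. x \<in> S \<Longrightarrow> 0 < \<pi> x"
    and \<pi>_sum: "(\<Sum>x\<in>S. \<pi> x) = 1"
    and balance: "\<And>x y. x \<in> S \<Longrightarrow> y \<in> S \<Longrightarrow> \<pi> x * P x y = \<pi> y * P y x"
begin

definition mean :: "('s \<Rightarrow> real) \<Rightarrow> real" where
  "mean f = (\<Sum>x\<in>S. \<pi> x * f x)"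

definition var :: "('s \<Rightarrow> real) \<Rightarrow> real" where
  "var f = (\<Sum>x\<in>S. \<pi> x * (f x - mean f)\<^sup>2)"

definition dirichlet :: "('s \<Rightarrow> real) \<Rightarrow> real" where
  "dirichlet f = (\<Sum>x\<in>S. \<Sum>y\<in>S. \<pi> x * P x y * (f x - f y)\<^sup>2) / 2"

definition step :: "('s \<Rightarrow> real) \<Rightarrow> 's \<Rightarrow> real" where
  "step f x = (\<Sum>y\<in>S. P x y * f y)"

definition lazy_step :: "('s \<Rightarrow> real) \<Rightarrow> 's \<Rightarrow> real" where
  "lazy_step f x = (f x + step f x) / 2"

lemma stationary: "y \<in> S \<Longrightarrow> (\<Sum>x\<in>S. \<pi> x * P x y) = \<pi> y"
proof -
  assume y: "y \<in> S"
  have "(\<Sum>x\<in>S. \<pi> x * P x y) = (\<Sum>x\<in>S. \<pi> y * P y x)"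
    by (rule sum.cong) (auto simp: balance y)
  also have "\<dots> = \<pi> y"
    by (simp add: sum_distrib_left[symmetric] P_row_sum y)
  finally show ?thesis .
qed

lemma mean_step: "mean (step f) = mean f"
proof -
  have "mean (step f) = (\<Sum>x\<in>S. \<Sum>y\<in>S. \<pi> x * P x y * f y)"
    by (simp add: mean_def step_def sum_distrib_left mult.assoc)
  also have "\<dots> = (\<Sum>y\<in>S. (\<Sum>x\<in>S. \<pi> x * P x y) * f y)"
    by (subst sum.swap) (simp add: sum_distrib_right)
  also have "\<dots> = mean f"
    unfolding mean_def by (rule sum.cong) (auto simp: stationary)
  finally show ?thesis .
qed

lemma mean_lazy_step: "mean (lazy_step f) = mean f"
proof -
  have "mean (lazy_step f) = (mean f + mean (step f)) / 2"
    by (simp add: mean_def lazy_step_def sum.distrib[symmetric] sum_divide_distrib algebra_simps add_divide_distrib)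
  then show ?thesis by (simp add: mean_step)
qed

lemma step_square_le: "x \<in> S \<Longrightarrow> (step f x)\<^sup>2 \<le> step (\<lambda>y. (f y)\<^sup>2) x"
proof -
  assume x: "x \<in> S"
  have "0 \<le> (\<Sum>y\<in>S. P x y * (f y - step f x)\<^sup>2)"
    by (intro sum_nonneg mult_nonneg_nonneg P_nonneg x) auto
  also have "\<dots> = (\<Sum>y\<in>S. P x y * (f y)\<^sup>2 - 2 * step f x * (P x y * f y) + (step f x)\<^sup>2 * P x y)"
    by (rule sum.cong) (auto simp: power2_eq_square algebra_simps)
  also have "\<dots> = step (\<lambda>y. (f y)\<^sup>2) x - 2 * step f x * step f x + (step f x)\<^sup>2"
    by (simp add: sum.distrib sum_subtractf sum_distrib_left[symmetric] step_def[symmetric] P_row_sum x)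
  finally show ?thesis by (simp add: power2_eq_square)
qed

lemma dirichlet_eq:
  "dirichlet f = (\<Sum>x\<in>S. \<pi> x * (f x)\<^sup>2) - (\<Sum>x\<in>S. \<pi> x * f x * step f x)"
proof -
  have a: "(\<Sum>x\<in>S. \<Sum>y\<in>S. \<pi> x * P x y * (f x)\<^sup>2) = mean (\<lambda>x. (f x)\<^sup>2)"
    unfolding mean_def
    by (rule sum.cong) (auto simp: sum_distrib_left[symmetric] sum_distrib_right[symmetric] P_row_sum)
  have b: "(\<Sum>x\<in>S. \<Sum>y\<in>S. \<pi> x * P x y * (f y)\<^sup>2) = mean (\<lambda>x. (f x)\<^sup>2)"
    unfolding mean_step[of "\<lambda>x. (f x)\<^sup>2", symmetric]
    by (simp add: mean_def step_def sum_distrib_left mult.assoc)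
  have c: "(\<Sum>x\<in>S. \<Sum>y\<in>S. \<pi> x * P x y * (f x * f y)) = (\<Sum>x\<in>S. \<pi> x * f x * step f x)"
    by (simp add: step_def sum_distrib_left algebra_simps)
  have "(\<Sum>x\<in>S. \<Sum>y\<in>S. \<pi> x * P x y * (f x - f y)\<^sup>2) =
      (\<Sum>x\<in>S. \<Sum>y\<in>S. \<pi> x * P x y * (f x)\<^sup>2 + \<pi> x * P x y * (f y)\<^sup>2 - 2 * (\<pi> x * P x y * (f x * f y)))"
    by (intro sum.cong) (auto simp: power2_eq_square algebra_simps)
  also have "\<dots> = 2 * mean (\<lambda>x. (f x)\<^sup>2) - 2 * (\<Sum>x\<in>S. \<pi> x * f x * step f x)"
    by (simp add: sum.distrib sum_subtractf a b c sum_distrib_left[symmetric])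
  finally show ?thesis by (simp add: dirichlet_def mean_def)
qed

text \<open>For centred \<open>g\<close> the square norm of \<open>(g + P g) / 2\<close> has a cross term, which is the Dirichlet form,
and the square norm of \<open>P g\<close>, which Jensen's inequality bounds by that of \<open>g\<close>. Without the lazy
half the negative part of the spectrum would have to be bounded separately.\<close>

lemma var_lazy_step_le: "var (lazy_step f) \<le> var f - dirichlet f / 2"
proof -
  define g where "g = (\<lambda>x. f x - mean f)"
  have step_g: "step g x = step f x - mean f" if "x \<in> S" for x
    using that by (simp add: g_def step_def right_diff_distrib sum_subtractf sum_distrib_right[symmetric] P_row_sum)
  have vf: "var f = (\<Sum>x\<in>S. \<pi> x * (g x)\<^sup>2)"
    by (simp add: var_def g_def)
  have vl: "var (lazy_step f) = (\<Sum>x\<in>S. \<pi> x * (lazy_step g x)\<^sup>2)"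
    unfolding var_def mean_lazy_step
  proof (rule sum.cong[OF refl])
    fix x assume x: "x \<in> S"
    have "lazy_step g x = lazy_step f x - mean f"
      using step_g[OF x] by (simp add: lazy_step_def g_def field_simps)
    then show "\<pi> x * (lazy_step f x - mean f)\<^sup>2 = \<pi> x * (lazy_step g x)\<^sup>2" by simp
  qed
  have dg: "dirichlet g = dirichlet f"
    by (simp add: dirichlet_def g_def)
  have sq: "(\<Sum>x\<in>S. \<pi> x * (step g x)\<^sup>2) \<le> (\<Sum>x\<in>S. \<pi> x * (g x)\<^sup>2)"
  proof -
    have "(\<Sum>x\<in>S. \<pi> x * (step g x)\<^sup>2) \<le> (\<Sum>x\<in>S. \<pi> x * step (\<lambda>y. (g y)\<^sup>2) x)"
      by (intro sum_mono mult_left_mono step_square_le) (auto intro: less_imp_le \<pi>_pos)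
    also have "\<dots> = (\<Sum>x\<in>S. \<pi> x * (g x)\<^sup>2)"
      using mean_step[of "\<lambda>y. (g y)\<^sup>2"] by (simp add: mean_def)
    finally show ?thesis .
  qed
  have "var (lazy_step f) = (\<Sum>x\<in>S. (\<pi> x * (g x)\<^sup>2 + 2 * (\<pi> x * g x * step g x) + \<pi> x * (step g x)\<^sup>2) / 4)"
    unfolding vl by (rule sum.cong) (auto simp: lazy_step_def power2_eq_square algebra_simps add_divide_distrib)
  also have "\<dots> = (var f + 2 * (\<Sum>x\<in>S. \<pi> x * g x * step g x) + (\<Sum>x\<in>S. \<pi> x * (step g x)\<^sup>2)) / 4"
    by (simp add: sum_divide_distrib[symmetric] sum.distrib vf sum_distrib_left[symmetric])
  also have "\<dots> \<le> (2 * var f + 2 * (\<Sum>x\<in>S. \<pi> x * g x * step g x)) / 4"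
    using sq vf by simp
  also have "\<dots> = var f - dirichlet f / 2"
    using dirichlet_eq[of g] vf dg by (simp add: field_simps)
  finally show ?thesis .
qed

lemma lazy_eq_lazy_step:
  assumes "x \<in> S" shows "(\<Sum>y\<in>S. lazy P x y * f y) = lazy_step f x"
proof -
  have "(\<Sum>y\<in>S. lazy P x y * f y) = (\<Sum>y\<in>S. P x y * f y / 2 + (if x = y then f y / 2 else 0))"
    by (rule sum.cong) (auto simp: lazy_def algebra_simps)
  also have "\<dots> = lazy_step f x"
    using assms finite_states
    by (simp add: sum.distrib sum_divide_distrib[symmetric] lazy_step_def step_def sum.delta' add_divide_distrib)
  finally show ?thesis .
qed

lemma kernel_power_eq_lazy_step:
  assumes "x \<in> S"
  shows "(\<Sum>y\<in>S. kernel_power S (lazy P) t x y * f y) = (lazy_step ^^ t) f x"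
proof (induction t arbitrary: f)
  case 0
  have "(\<Sum>y\<in>S. of_bool (x = y) * f y) = (\<Sum>y\<in>S. if x = y then f y else 0)"
    by (rule sum.cong) auto
  then show ?case using assms finite_states by (simp add: sum.delta')
next
  case (Suc t)
  have "(\<Sum>y\<in>S. kernel_power S (lazy P) (Suc t) x y * f y) =
      (\<Sum>y\<in>S. \<Sum>z\<in>S. kernel_power S (lazy P) t x z * (lazy P z y * f y))"
    by (simp add: sum_distrib_right mult.assoc)
  also have "\<dots> = (\<Sum>z\<in>S. kernel_power S (lazy P) t x z * (\<Sum>y\<in>S. lazy P z y * f y))"
    by (subst sum.swap) (simp add: sum_distrib_left)
  also have "\<dots> = (\<Sum>z\<in>S. kernel_power S (lazy P) t x z * lazy_step f z)"
    by (rule sum.cong) (auto simp: lazy_eq_lazy_step)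
  also have "\<dots> = (lazy_step ^^ t) (lazy_step f) x"
    by (rule Suc.IH)
  finally show ?case by (simp add: funpow_swap1)
qed

lemma mean_lazy_power: "mean ((lazy_step ^^ t) f) = mean f"
  by (induction t) (auto simp: mean_lazy_step)

lemma var_lazy_power_le:
  assumes poincare: "\<And>f. var f \<le> \<kappa> * dirichlet f" and \<kappa>: "\<kappa> \<ge> 1 / 2"
  shows "var ((lazy_step ^^ t) f) \<le> (1 - 1 / (2 * \<kappa>)) ^ t * var f"
proof (induction t)
  case (Suc t)
  let ?g = "(lazy_step ^^ t) f"
  have "var (lazy_step ?g) \<le> var ?g - dirichlet ?g / 2"
    by (rule var_lazy_step_le)
  also have "\<dots> \<le> (1 - 1 / (2 * \<kappa>)) * var ?g"
    using poincare[of ?g] \<kappa> by (simp add: field_simps)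
  also have "\<dots> \<le> (1 - 1 / (2 * \<kappa>)) * ((1 - 1 / (2 * \<kappa>)) ^ t * var f)"
    by (intro mult_left_mono Suc.IH) (use \<kappa> in \<open>simp add: field_simps\<close>)
  finally show ?case by (simp add: mult.assoc)
qed auto

text \<open>The deviation \<open>P\<^sup>t(x, A) - \<pi> A\<close> is the value at \<open>x\<close> of the centred function \<open>P\<^sup>t 1\<^sub>A\<close>, and one term of
a variance is at most the variance.\<close>

lemma tv_dist_lazy_power_le:
  assumes poincare: "\<And>f. var f \<le> \<kappa> * dirichlet f" and \<kappa>: "\<kappa> \<ge> 1 / 2" and x: "x \<in> S"
  shows "tv_dist S (kernel_power S (lazy P) t x) \<pi> \<le> exp (- real t / (4 * \<kappa>)) / sqrt (\<pi> x)"
proof -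
  have "\<bar>sum (kernel_power S (lazy P) t x) A - sum \<pi> A\<bar> \<le> exp (- real t / (4 * \<kappa>)) / sqrt (\<pi> x)"
    if A: "A \<subseteq> S" for A
  proof -
    let ?f = "\<lambda>y. of_bool (y \<in> A) :: real"
    let ?g = "(lazy_step ^^ t) ?f"
    have restrict: "(\<Sum>y\<in>S. h y * ?f y) = sum h A" for h :: "'s \<Rightarrow> real"
      using A finite_states by (simp add: sum.inter_restrict[symmetric] Int_absorb1 of_bool_def if_distrib cong: if_cong)
    have m: "mean ?f = sum \<pi> A"
      by (simp only: mean_def restrict)
    have mA: "0 \<le> sum \<pi> A" "sum \<pi> A \<le> 1"
      using A \<pi>_sum sum_mono2[OF finite_states A, of \<pi>]
      by (auto intro!: sum_nonneg intro: less_imp_le[OF \<pi>_pos])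
    have sq: "(?f y - mean ?f)\<^sup>2 \<le> 1" for y
      using mA by (auto simp: m abs_square_le_1)
    have "var ?f \<le> (\<Sum>x\<in>S. \<pi> x * 1)"
      unfolding var_def using \<pi>_pos by (intro sum_mono mult_left_mono sq) (auto intro: less_imp_le)
    then have v1: "var ?f \<le> 1" by (simp add: \<pi>_sum)
    have base: "0 \<le> 1 - 1 / (2 * \<kappa>)" using \<kappa> by (simp add: field_simps)
    have "\<pi> x * (?g x - mean ?f)\<^sup>2 \<le> var ?g"
      unfolding var_def mean_lazy_power
      using finite_states x \<pi>_pos
      by (intro member_le_sum[where f = "\<lambda>x. \<pi> x * (?g x - mean ?f)\<^sup>2"] mult_nonneg_nonneg)
        (auto intro: less_imp_le)
    also have "\<dots> \<le> (1 - 1 / (2 * \<kappa>)) ^ t * var ?f"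
      by (rule var_lazy_power_le[OF poincare \<kappa>])
    also have "\<dots> \<le> (1 - 1 / (2 * \<kappa>)) ^ t * 1"
      by (intro mult_left_mono v1 zero_le_power base)
    also have "\<dots> \<le> exp (- (1 / (2 * \<kappa>))) ^ t"
      using exp_ge_add_one_self[of "- (1 / (2 * \<kappa>))"] base by (auto intro!: power_mono)
    also have "\<dots> = exp (- real t / (2 * \<kappa>))"
      by (simp add: exp_of_nat_mult[symmetric])
    finally have "(?g x - mean ?f)\<^sup>2 \<le> exp (- real t / (2 * \<kappa>)) / \<pi> x"
      using \<pi>_pos[OF x] by (simp add: field_simps)
    also have "\<dots> = (exp (- real t / (4 * \<kappa>)) / sqrt (\<pi> x))\<^sup>2"
      using \<pi>_pos[OF x] by (simp add: power_divide exp_double[symmetric])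
    finally have "\<bar>?g x - mean ?f\<bar> \<le> exp (- real t / (4 * \<kappa>)) / sqrt (\<pi> x)"
      using \<pi>_pos[OF x] by (intro power2_le_imp_le[of "\<bar>_\<bar>"]) (auto intro!: divide_nonneg_pos)
    moreover have "?g x = sum (kernel_power S (lazy P) t x) A"
      using kernel_power_eq_lazy_step[OF x, of t ?f] by (simp only: restrict)
    ultimately show ?thesis by (simp only: m)
  qed
  then show ?thesis
    unfolding tv_dist_def using finite_states by (subst Max_le_iff) auto
qed

end

lemma mixing_time_le:
  assumes "finite S" "S \<noteq> {}"
    and "\<And>x t. x \<in> S \<Longrightarrow> t \<ge> t0 \<Longrightarrow> tv_dist S (kernel_power S P t x) \<pi> \<le> \<epsilon>"
  shows "mixing_time S P \<pi> \<epsilon> \<le> enat t0"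
  unfolding mixing_time_def using assms
  by (subst Max_le_iff) (auto intro!: INF_lower)

context reversible_chain
begin

lemma var_le_second_moment: "var f \<le> (\<Sum>x\<in>S. \<pi> x * (f x - a)\<^sup>2)"
proof -
  have "(\<Sum>x\<in>S. \<pi> x * (f x - a)\<^sup>2) =
      (\<Sum>x\<in>S. \<pi> x * (f x - mean f)\<^sup>2 + 2 * (mean f - a) * (\<pi> x * f x) + ((mean f - a)\<^sup>2 - 2 * (mean f - a) * mean f) * \<pi> x)"
    by (rule sum.cong) (auto simp: power2_eq_square algebra_simps)
  also have "\<dots> = var f + 2 * (mean f - a) * mean f + ((mean f - a)\<^sup>2 - 2 * (mean f - a) * mean f)"
    by (simp add: sum.distrib sum_distrib_left[symmetric] \<pi>_sum var_def mean_def)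
  also have "\<dots> = var f + (mean f - a)\<^sup>2"
    by (simp add: algebra_simps)
  finally show ?thesis by simp
qed

text \<open>The pairs \<open>(z, G z)\<close> and \<open>(G z, z)\<close> are all distinct, since \<open>N\<close> strictly decreases along \<open>G\<close>.
So every edge of the path graph occurs twice in the Dirichlet form, which cancels the factor \<open>1 / 2\<close>.\<close>

lemma dirichlet_ge_path_sum:
  assumes G: "\<And>x. x \<in> S \<Longrightarrow> x \<noteq> r \<Longrightarrow> G x \<in> S"
    and N: "\<And>x. x \<in> S \<Longrightarrow> x \<noteq> r \<Longrightarrow> N (G x) < (N x :: nat)"
  shows "(\<Sum>z\<in>S - {r}. \<pi> z * P z (G z) * (f z - f (G z))\<^sup>2) \<le> dirichlet f"
proof -
  let ?h = "\<lambda>(x, y). \<pi> x * P x y * (f x - f y)\<^sup>2"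
  let ?A = "(\<lambda>z. (z, G z)) ` (S - {r})" and ?B = "(\<lambda>z. (G z, z)) ` (S - {r})"
  have A: "sum ?h ?A = (\<Sum>z\<in>S - {r}. \<pi> z * P z (G z) * (f z - f (G z))\<^sup>2)"
    by (subst sum.reindex) (auto simp: inj_on_def)
  have "sum ?h ?B = (\<Sum>z\<in>S - {r}. \<pi> (G z) * P (G z) z * (f (G z) - f z)\<^sup>2)"
    by (subst sum.reindex) (auto simp: inj_on_def)
  also have "\<dots> = sum ?h ?A"
    unfolding A by (rule sum.cong) (use G balance in \<open>auto simp: power2_commute\<close>)
  finally have B: "sum ?h ?B = sum ?h ?A" .
  have disj: "?A \<inter> ?B = {}"
    using N by (auto dest!: N)
  have "2 * sum ?h ?A = sum ?h (?A \<union> ?B)"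
    using finite_states by (subst sum.union_disjoint[OF _ _ disj]) (auto simp: B)
  also have "\<dots> \<le> sum ?h (S \<times> S)"
    using finite_states G P_nonneg \<pi>_pos
    by (intro sum_mono2) (auto intro!: mult_nonneg_nonneg intro: less_imp_le)
  also have "\<dots> = 2 * dirichlet f"
    by (simp add: dirichlet_def sum.cartesian_product)
  finally show ?thesis using A by simp
qed

text \<open>The path from \<open>x\<close> to the root \<open>r\<close> iterates \<open>G\<close>. Any family \<open>D\<close> with \<open>z \<in> D z\<close> that is closed under
preimages of \<open>G\<close> satisfies \<open>x \<in> D z\<close> for all \<open>z\<close> on the path of \<open>x\<close>, so that a concrete superset
of the trees behind \<open>z\<close> can take the place of the iterates. The square is bounded by Cauchy-Schwarz.\<close>

lemma path_telescope:
  assumes r: "r \<in> S"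
    and G: "\<And>x. x \<in> S \<Longrightarrow> x \<noteq> r \<Longrightarrow> G x \<in> S"
    and N: "\<And>x. x \<in> S \<Longrightarrow> x \<noteq> r \<Longrightarrow> N (G x) < (N x :: nat)"
    and D_refl: "\<And>z. z \<in> S \<Longrightarrow> z \<in> D z"
    and D_back: "\<And>x z. x \<in> S \<Longrightarrow> x \<noteq> r \<Longrightarrow> z \<in> S \<Longrightarrow> z \<noteq> r \<Longrightarrow> G x \<in> D z \<Longrightarrow> x \<in> D z"
  shows "x \<in> S \<Longrightarrow> (f x - f r)\<^sup>2 \<le> real (N x) * (\<Sum>z | z \<in> S - {r} \<and> x \<in> D z. (f z - f (G z))\<^sup>2)"
proof -
  let ?d = "\<lambda>z. \<bar>f z - f (G z)\<bar>"
  have "x \<in> S \<Longrightarrow> \<exists>p. finite p \<and> p \<subseteq> S - {r} \<and> card p \<le> N x \<and> (\<forall>z\<in>p. x \<in> D z \<and> N z \<le> N x)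
      \<and> \<bar>f x - f r\<bar> \<le> sum ?d p"
  proof (induction "N x" arbitrary: x rule: less_induct)
    case less
    show ?case
    proof (cases "x = r")
      case True
      then show ?thesis by (intro exI[of _ "{}"]) auto
    next
      case False
      note x = \<open>x \<in> S\<close> False
      obtain p where p: "finite p" "p \<subseteq> S - {r}" "card p \<le> N (G x)"
        "\<forall>z\<in>p. G x \<in> D z \<and> N z \<le> N (G x)" "\<bar>f (G x) - f r\<bar> \<le> sum ?d p"
        using less.hyps[OF N[OF x] G[OF x]] by auto
      have nx: "x \<notin> p" using p(4) N[OF x] by auto
      show ?thesis
      proof (intro exI[of _ "insert x p"] conjI)
        show "card (insert x p) \<le> N x" using p(1,3) nx N[OF x] by simp
        show "\<forall>z\<in>insert x p. x \<in> D z \<and> N z \<le> N x"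
          using p(2,4) N[OF x] x D_refl D_back by fastforce
        show "\<bar>f x - f r\<bar> \<le> sum ?d (insert x p)"
          using p(1,5) nx by simp
      qed (use p x in auto)
    qed
  qed
  moreover assume x: "x \<in> S"
  ultimately obtain p where p: "finite p" "p \<subseteq> S - {r}" "card p \<le> N x" "\<forall>z\<in>p. x \<in> D z"
    "\<bar>f x - f r\<bar> \<le> sum ?d p" by auto
  have "(f x - f r)\<^sup>2 \<le> (sum ?d p)\<^sup>2"
    using p(5) by (simp add: abs_le_square_iff[symmetric] sum_nonneg)
  also have "\<dots> \<le> real (card p) * (\<Sum>z\<in>p. (?d z)\<^sup>2)"
    using sum_squared_le_sum_of_squares[of ?d p] by (simp add: mult.commute)
  also have "\<dots> \<le> real (N x) * (\<Sum>z\<in>p. (?d z)\<^sup>2)"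
    using p(3) by (intro mult_right_mono sum_nonneg) auto
  also have "\<dots> \<le> real (N x) * (\<Sum>z | z \<in> S - {r} \<and> x \<in> D z. (f z - f (G z))\<^sup>2)"
    using p finite_states by (intro mult_left_mono) (auto intro!: sum_mono2)
  finally show ?thesis .
qed

text \<open>A tree-shaped form of the canonical path method: all paths lead to one state \<open>r\<close>, and the variance
is at most the second moment around \<open>f r\<close>. Exchanging the sums over starting points and edges
leaves the mass \<open>M * \<pi> z\<close> behind each edge.\<close>

lemma canonical_path_poincare:
  assumes r: "r \<in> S"
    and G: "\<And>x. x \<in> S \<Longrightarrow> x \<noteq> r \<Longrightarrow> G x \<in> S"
    and N: "\<And>x. x \<in> S \<Longrightarrow> x \<noteq> r \<Longrightarrow> N (G x) < (N x :: nat)"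
    and N_le: "\<And>x. x \<in> S \<Longrightarrow> N x \<le> m"
    and D_refl: "\<And>z. z \<in> S \<Longrightarrow> z \<in> D z"
    and D_back: "\<And>x z. x \<in> S \<Longrightarrow> x \<noteq> r \<Longrightarrow> z \<in> S \<Longrightarrow> z \<noteq> r \<Longrightarrow> G x \<in> D z \<Longrightarrow> x \<in> D z"
    and D_mass: "\<And>z. z \<in> S \<Longrightarrow> z \<noteq> r \<Longrightarrow> sum \<pi> (S \<inter> D z) \<le> M * \<pi> z"
    and s: "s > 0" and rate: "\<And>x. x \<in> S \<Longrightarrow> x \<noteq> r \<Longrightarrow> s \<le> P x (G x)"
    and M: "M \<ge> 0"
  shows "var f \<le> real m * M / s * dirichlet f"
proof -
  let ?g = "\<lambda>z. (f z - f (G z))\<^sup>2"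
  have "var f \<le> (\<Sum>x\<in>S. \<pi> x * (f x - f r)\<^sup>2)" by (rule var_le_second_moment)
  also have "\<dots> \<le> (\<Sum>x\<in>S. \<pi> x * (real m * (\<Sum>z | z \<in> S - {r} \<and> x \<in> D z. ?g z)))"
  proof (intro sum_mono mult_left_mono)
    fix x assume x: "x \<in> S"
    have "(f x - f r)\<^sup>2 \<le> real (N x) * (\<Sum>z | z \<in> S - {r} \<and> x \<in> D z. ?g z)"
      by (rule path_telescope[of r G N D, OF r G N D_refl D_back x])
    also have "\<dots> \<le> real m * (\<Sum>z | z \<in> S - {r} \<and> x \<in> D z. ?g z)"
      using N_le[OF x] by (intro mult_right_mono sum_nonneg) auto
    finally show "(f x - f r)\<^sup>2 \<le> real m * (\<Sum>z | z \<in> S - {r} \<and> x \<in> D z. ?g z)" .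
  qed (auto intro: less_imp_le[OF \<pi>_pos])
  also have "\<dots> = (\<Sum>x\<in>S. \<Sum>z\<in>S - {r}. if x \<in> D z then real m * (\<pi> x * ?g z) else 0)"
    using finite_states
    by (intro sum.cong refl) (auto simp: sum_distrib_left sum.inter_filter[symmetric] mult_ac intro!: sum.cong)
  also have "\<dots> = (\<Sum>z\<in>S - {r}. \<Sum>x\<in>S. if x \<in> D z then real m * (\<pi> x * ?g z) else 0)"
    by (rule sum.swap)
  also have "\<dots> = (\<Sum>z\<in>S - {r}. real m * ?g z * sum \<pi> (S \<inter> D z))"
    using finite_states
    by (intro sum.cong refl) (auto simp: sum_distrib_left sum.inter_restrict mult_ac intro!: sum.cong)
  also have "\<dots> \<le> (\<Sum>z\<in>S - {r}. real m * ?g z * (M * (\<pi> z * (P z (G z) / s))))"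
  proof (intro sum_mono mult_left_mono)
    fix z assume z: "z \<in> S - {r}"
    have "sum \<pi> (S \<inter> D z) \<le> M * (\<pi> z * 1)" using D_mass[of z] z by simp
    also have "\<dots> \<le> M * (\<pi> z * (P z (G z) / s))"
      using z rate[of z] s M \<pi>_pos[of z] by (intro mult_left_mono) (auto simp: field_simps)
    finally show "sum \<pi> (S \<inter> D z) \<le> M * (\<pi> z * (P z (G z) / s))" .
  qed auto
  also have "\<dots> = real m * M / s * (\<Sum>z\<in>S - {r}. \<pi> z * P z (G z) * ?g z)"
    by (simp add: sum_distrib_left mult_ac)
  also have "\<dots> \<le> real m * M / s * dirichlet f"
    using s M by (intro mult_left_mono dirichlet_ge_path_sum[of r G N, OF G N]) auto
  finally show ?thesis .
qed

text \<open>The summand \<open>1\<close> on the right-hand side pays for rounding up to an integer time.\<close>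

lemma mixing_time_lazy_le:
  assumes poincare: "\<And>f. var f \<le> \<kappa> * dirichlet f" and \<kappa>: "\<kappa> \<ge> 1 / 2"
    and \<epsilon>: "0 < \<epsilon>" and min: "\<And>x. x \<in> S \<Longrightarrow> exp (- H) \<le> \<pi> x" and H: "0 \<le> H / 2 + ln (1 / \<epsilon>)"
  shows "ereal_of_enat (mixing_time S (lazy P) \<pi> \<epsilon>) \<le> ereal (4 * \<kappa> * (H / 2 + ln (1 / \<epsilon>)) + 1)"
proof -
  define t0 where "t0 = nat \<lceil>4 * \<kappa> * (H / 2 + ln (1 / \<epsilon>))\<rceil>"
  have t0: "4 * \<kappa> * (H / 2 + ln (1 / \<epsilon>)) \<le> real t0"
    unfolding t0_def by linarith
  have t0': "real t0 \<le> 4 * \<kappa> * (H / 2 + ln (1 / \<epsilon>)) + 1"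
    unfolding t0_def using H \<kappa> by (simp add: of_nat_nat ceiling_correct)
  have "S \<noteq> {}" using \<pi>_sum by auto
  have "mixing_time S (lazy P) \<pi> \<epsilon> \<le> enat t0"
  proof (rule mixing_time_le[OF finite_states \<open>S \<noteq> {}\<close>])
    fix x t assume x: "x \<in> S" and t: "t0 \<le> t"
    have "4 * \<kappa> * (H / 2 + ln (1 / \<epsilon>)) \<le> real t" using t t0 by linarith
    then have t': "H / 2 + ln (1 / \<epsilon>) \<le> real t / (4 * \<kappa>)"
      using \<kappa> by (simp add: field_simps)
    have "exp (- (H / 2)) = sqrt (exp (- H))"
      by (rule real_sqrt_unique[symmetric]) (auto simp: exp_double[symmetric])
    also have "\<dots> \<le> sqrt (\<pi> x)" using min[OF x] by simp
    finally have s: "exp (- (H / 2)) \<le> sqrt (\<pi> x)" .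
    have "tv_dist S (kernel_power S (lazy P) t x) \<pi> \<le> exp (- real t / (4 * \<kappa>)) / sqrt (\<pi> x)"
      by (rule tv_dist_lazy_power_le[OF poincare \<kappa> x])
    also have "\<dots> \<le> exp (- (H / 2 + ln (1 / \<epsilon>))) / exp (- (H / 2))"
      using t' s by (intro frac_le) auto
    also have "\<dots> = exp (ln \<epsilon>)"
      using \<epsilon> by (simp add: exp_diff[symmetric] ln_div)
    finally show "tv_dist S (kernel_power S (lazy P) t x) \<pi> \<le> \<epsilon>"
      using \<epsilon> by simp
  qed
  then have "ereal_of_enat (mixing_time S (lazy P) \<pi> \<epsilon>) \<le> ereal_of_enat (enat t0)"
    by (simp only: ereal_of_enat_le_iff)
  also have "\<dots> = ereal (real t0)" by simp
  also have "\<dots> \<le> ereal (4 * \<kappa> * (H / 2 + ln (1 / \<epsilon>)) + 1)" using t0' by simp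
  finally show ?thesis .
qed

end

section \<open>Metropolis-Hastings kernels\<close>

text \<open>The stationary flow along an edge is symmetric, which is both the detailed balance
and the source of the lower bound on the acceptance.\<close>

lemma mh_flow:
  fixes S :: "'s set"
  assumes "0 < \<pi> x" "0 \<le> \<pi> y" "0 \<le> Q x y" "0 \<le> Q y x" "y \<noteq> x"
  shows "\<pi> x * mh_kernel S Q \<pi> x y = min (\<pi> x * Q x y) (\<pi> y * Q y x)"
proof (cases "Q x y = 0")
  case True
  then show ?thesis using assms by (simp add: mh_kernel_def min_def)
next
  case False
  then have pos: "0 < \<pi> x * Q x y" using assms by simp
  have "\<pi> x * mh_kernel S Q \<pi> x y = (\<pi> x * Q x y) * min 1 (\<pi> y * Q y x / (\<pi> x * Q x y))"
    using assms(5) by (simp add: mh_kernel_def Let_def)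
  also have "\<dots> = min ((\<pi> x * Q x y) * 1) ((\<pi> x * Q x y) * (\<pi> y * Q y x / (\<pi> x * Q x y)))"
    using pos by (simp only: min_mult_distrib_left) simp
  also have "\<dots> = min (\<pi> x * Q x y) (\<pi> y * Q y x)" using pos False assms(1) by simp
  finally show ?thesis .
qed

lemma mh_kernel_ge:
  fixes S :: "'s set"
  assumes "0 < \<pi> x" "\<pi> x \<le> \<pi> y" "0 \<le> s" "s \<le> Q x y" "s \<le> Q y x" "y \<noteq> x"
  shows "s \<le> mh_kernel S Q \<pi> x y"
proof -
  have "\<pi> x * s \<le> min (\<pi> x * Q x y) (\<pi> y * Q y x)"
    using assms by (auto intro: mult_mono)
  also have "\<dots> = \<pi> x * mh_kernel S Q \<pi> x y"
    using assms by (intro mh_flow[symmetric]) auto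
  finally show ?thesis using assms(1) by simp
qed

lemma mh_reversible_chain:
  fixes S :: "'s set"
  assumes S: "finite S" and \<pi>: "\<And>x. x \<in> S \<Longrightarrow> 0 < \<pi> x" "(\<Sum>x\<in>S. \<pi> x) = 1"
    and Q: "\<And>x y. x \<in> S \<Longrightarrow> y \<in> S \<Longrightarrow> 0 \<le> Q x y" "\<And>x. x \<in> S \<Longrightarrow> (\<Sum>y\<in>S. Q x y) \<le> 1"
  shows "reversible_chain S (mh_kernel S Q \<pi>) \<pi>"
proof -
  let ?K = "mh_kernel S Q \<pi>" and ?move = "\<lambda>x y. Q x y * min 1 (\<pi> y * Q y x / (\<pi> x * Q x y))"
  have off: "?K x y = ?move x y" if "y \<noteq> x" for x y
    using that by (simp add: mh_kernel_def)
  have diag: "?K x x = 1 - (\<Sum>y\<in>S - {x}. ?move x y)" for x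
    by (simp add: mh_kernel_def)
  have ratio: "0 \<le> \<pi> y * Q y x / (\<pi> x * Q x y)" if "x \<in> S" "y \<in> S" for x y
    using that \<pi>(1)[of x] \<pi>(1)[of y] Q(1)[of x y] Q(1)[of y x] by (auto intro!: divide_nonneg_nonneg)
  have move0: "0 \<le> ?move x y" if "x \<in> S" "y \<in> S" for x y
    using that Q(1)[of x y] ratio[of x y] by (intro mult_nonneg_nonneg) auto
  have move_le: "?move x y \<le> Q x y" if "x \<in> S" "y \<in> S" for x y
    using that Q(1)[of x y] by (intro mult_left_le) auto
  show ?thesis
  proof
    show "finite S" "(\<Sum>x\<in>S. \<pi> x) = 1" by (fact S, fact \<pi>(2))
    show "0 < \<pi> x" if "x \<in> S" for x by (rule \<pi>(1)[OF that])
    show "0 \<le> ?K x y" if xy: "x \<in> S" "y \<in> S" for x y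
    proof (cases "y = x")
      case True
      have "(\<Sum>y\<in>S - {x}. ?move x y) \<le> (\<Sum>y\<in>S - {x}. Q x y)"
        using xy by (intro sum_mono move_le) auto
      also have "\<dots> \<le> (\<Sum>y\<in>S. Q x y)" using S xy Q(1) by (intro sum_mono2) auto
      also have "\<dots> \<le> 1" by (rule Q(2)[OF xy(1)])
      finally show ?thesis unfolding True diag by linarith
    qed (use off move0[OF xy] in simp)
    show "(\<Sum>y\<in>S. ?K x y) = 1" if x: "x \<in> S" for x
    proof -
      have "(\<Sum>y\<in>S. ?K x y) = ?K x x + (\<Sum>y\<in>S - {x}. ?K x y)" by (rule sum.remove[OF S x])
      also have "(\<Sum>y\<in>S - {x}. ?K x y) = (\<Sum>y\<in>S - {x}. ?move x y)"
        by (rule sum.cong) (simp_all add: off)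
      finally show ?thesis unfolding diag by simp
    qed
    show "\<pi> x * ?K x y = \<pi> y * ?K y x" if xy: "x \<in> S" "y \<in> S" for x y
    proof (cases "y = x")
      case False
      have "\<pi> x * ?K x y = min (\<pi> x * Q x y) (\<pi> y * Q y x)"
        using xy False \<pi>(1) Q(1) by (intro mh_flow) (auto intro: less_imp_le)
      moreover have "\<pi> y * ?K y x = min (\<pi> y * Q y x) (\<pi> x * Q x y)"
        using xy False \<pi>(1) Q(1) by (intro mh_flow) (auto intro: less_imp_le)
      ultimately show ?thesis by (simp add: min.commute)
    qed simp
  qed
qed

lemma nodes_cases:
  assumes "v \<in> nodes L" "v \<noteq> (-1, 0)"
  obtains l k where "v = (int l, k)" "l < L" "k < 2 ^ l"
proof -
  obtain j k where v: "v = (j, k)" by (cases v)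
  have j: "0 \<le> j" "j < int L" "k < 2 ^ nat j" using assms by (auto simp: v nodes_def)
  then show ?thesis by (intro that[of "nat j" k]) (auto simp: v)
qed

section \<open>Trees\<close>

lemma root_in_nodes: "(-1, 0) \<in> nodes L"
  by (simp add: nodes_def)

lemma int_level_in_nodes_iff: "(int l, k) \<in> nodes L \<longleftrightarrow> l < L \<and> k < 2 ^ l"
  by (auto simp: nodes_def)

lemma nodes_Suc: "nodes (Suc L) = nodes L \<union> {int L} \<times> {..<2 ^ L}"
proof
  show "nodes (Suc L) \<subseteq> nodes L \<union> {int L} \<times> {..<2 ^ L}"
  proof
    fix v assume v: "v \<in> nodes (Suc L)"
    show "v \<in> nodes L \<union> {int L} \<times> {..<2 ^ L}"
    proof (cases "v = (-1, 0)")
      case False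
      then show ?thesis using nodes_cases[OF v False]
        by (metis Un_iff int_level_in_nodes_iff lessThan_iff less_Suc_eq mem_Sigma_iff singletonI)
    qed (simp add: root_in_nodes)
  qed
qed (auto simp: nodes_def)

lemma finite_nodes: "finite (nodes L)" and card_nodes: "card (nodes L) = 2 ^ L"
proof (induction L)
  case 0
  have "nodes 0 = {(-1, 0)}" by (auto simp: nodes_def)
  then show "finite (nodes 0)" "card (nodes 0) = 2 ^ 0" by auto
next
  case (Suc L)
  have "nodes L \<inter> {int L} \<times> {..<2 ^ L} = {}" by (auto simp: nodes_def)
  then show "finite (nodes (Suc L))" "card (nodes (Suc L)) = 2 ^ Suc L"
    using Suc by (simp_all add: nodes_Suc card_Un_disjoint card_cartesian_product)
qed

lemma parent_in_nodes:
  assumes "v \<in> nodes L" "v \<noteq> (-1, 0)"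
  shows "parent v \<in> nodes L"
proof -
  obtain l k where v: "v = (int l, k)" "l < L" "k < 2 ^ l" using assms by (rule nodes_cases)
  show ?thesis
  proof (cases l)
    case (Suc m)
    then have "parent v = (int m, k div 2)" by (simp add: v)
    moreover have "k div 2 < 2 ^ m" using v(3) Suc by (simp add: less_mult_imp_div_less)
    moreover have "m < L" using v(2) Suc by simp
    ultimately show ?thesis by (simp only: int_level_in_nodes_iff)
  qed (use v in \<open>simp add: root_in_nodes\<close>)
qed

text \<open>The parent of \<open>(0, 0)\<close> is the root, so the level condition in the definition of trees may be
replaced by \<open>v \<noteq> (-1, 0)\<close>.\<close>

lemma trees_iff:
  "T \<in> trees L \<longleftrightarrow> T \<subseteq> nodes L \<and> (-1, 0) \<in> T \<and> (\<forall>v\<in>T. v \<noteq> (-1, 0) \<longrightarrow> parent v \<in> T)"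
proof -
  have *: "(fst v \<ge> 1 \<longrightarrow> parent v \<in> T) \<longleftrightarrow> (v \<noteq> (-1, 0) \<longrightarrow> parent v \<in> T)"
    if T: "T \<subseteq> nodes L" "(-1, 0) \<in> T" "v \<in> T" for v
  proof (cases "v = (-1, 0)")
    case False
    have "v \<in> nodes L" using T by auto
    then obtain l k where v: "v = (int l, k)" "k < 2 ^ l" using False by (rule nodes_cases)
    show ?thesis
    proof (cases l)
      case 0
      then have "parent v = (-1, 0)" using v by simp
      then show ?thesis using T by simp
    qed (use v in auto)
  qed auto
  show ?thesis
    unfolding trees_def mem_Collect_eq by (intro conj_cong ball_cong refl *)
qed

lemma treesI:
  assumes "T \<subseteq> nodes L" "(-1, 0) \<in> T" "\<And>v. v \<in> T \<Longrightarrow> v \<noteq> (-1, 0) \<Longrightarrow> parent v \<in> T"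
  shows "T \<in> trees L"
  unfolding trees_iff using assms by blast

lemma treesD:
  assumes "T \<in> trees L"
  shows "T \<subseteq> nodes L" "(-1, 0) \<in> T" "\<And>v. v \<in> T \<Longrightarrow> v \<noteq> (-1, 0) \<Longrightarrow> parent v \<in> T"
  using assms by (auto simp: trees_iff)

lemma tree_finite: "T \<in> trees L \<Longrightarrow> finite T"
  by (rule finite_subset[OF treesD(1) finite_nodes])

lemma finite_trees: "finite (trees L)"
proof (rule finite_subset)
  show "trees L \<subseteq> Pow (nodes L)" by (auto simp: trees_def)
qed (simp add: finite_nodes)

lemma nodes_in_trees: "nodes L \<in> trees L"
  by (auto simp: trees_iff root_in_nodes parent_in_nodes)

lemma trees_Un: "T \<in> trees L \<Longrightarrow> T' \<in> trees L \<Longrightarrow> T \<union> T' \<in> trees L"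
  unfolding trees_iff by auto

lemma least_tree:
  assumes "B \<subseteq> nodes L"
  shows "least_tree L B \<in> trees L" "B \<subseteq> least_tree L B"
    "\<And>T. T \<in> trees L \<Longrightarrow> B \<subseteq> T \<Longrightarrow> least_tree L B \<subseteq> T"
proof -
  let ?I = "\<Inter>{T \<in> trees L. B \<subseteq> T}"
  have "nodes L \<in> {T \<in> trees L. B \<subseteq> T}" using assms nodes_in_trees by simp
  then have sub: "?I \<subseteq> nodes L" by (rule Inter_lower)
  have root: "(-1, 0) \<in> ?I" by (rule InterI) (auto dest: treesD(2))
  have "parent v \<in> ?I" if v: "v \<in> ?I" "v \<noteq> (-1, 0)" for v
  proof (rule InterI)
    fix T assume T: "T \<in> {T \<in> trees L. B \<subseteq> T}"
    then have "v \<in> T" "T \<in> trees L" using InterD[OF v(1) T] by simp_all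
    then show "parent v \<in> T" using v(2) treesD(3)[of T L v] by blast
  qed
  with sub root have I: "?I \<in> trees L" by (rule treesI)
  have BI: "B \<subseteq> ?I" by (rule Inter_greatest) simp
  have low: "?I \<subseteq> T" if "T \<in> trees L" "B \<subseteq> T" for T by (rule Inter_lower) (simp add: that)
  have "least_tree L B = ?I"
    unfolding least_tree_def using I BI low by (intro Least_equality) simp_all
  then show "least_tree L B \<in> trees L" "B \<subseteq> least_tree L B"
    "\<And>T. T \<in> trees L \<Longrightarrow> B \<subseteq> T \<Longrightarrow> least_tree L B \<subseteq> T"
    using I BI low by simp_all
qed

text \<open>The right-hand side mentions \<open>nodes (Suc L)\<close> because the children of a node of level \<open>L - 1\<close>
are external nodes below the last layer.\<close>

lemma children_iff:
  assumes "u \<in> nodes L"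
  shows "v \<in> children u \<longleftrightarrow> v \<in> nodes (Suc L) \<and> v \<noteq> (-1, 0) \<and> parent v = u"
proof
  assume v: "v \<in> children u"
  show "v \<in> nodes (Suc L) \<and> v \<noteq> (-1, 0) \<and> parent v = u"
  proof (cases "u = (-1, 0)")
    case True
    then show ?thesis using v by (auto simp: nodes_def)
  next
    case False
    then obtain l k where u: "u = (int l, k)" "l < L" "k < 2 ^ l" using assms nodes_cases by blast
    then have "v = (int (Suc l), 2 * k) \<or> v = (int (Suc l), 2 * k + 1)" using v by auto
    moreover have "2 * k < 2 ^ Suc l" "2 * k + 1 < 2 ^ Suc l" using u(3) by auto
    ultimately have "v \<in> nodes (Suc L)" using u(2) by (auto simp only: int_level_in_nodes_iff)
    moreover have "v \<noteq> (-1, 0)" "parent v = u"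
      using \<open>v = (int (Suc l), 2 * k) \<or> v = (int (Suc l), 2 * k + 1)\<close> by (auto simp: u)
    ultimately show ?thesis by blast
  qed
next
  assume v: "v \<in> nodes (Suc L) \<and> v \<noteq> (-1, 0) \<and> parent v = u"
  then obtain l k where lk: "v = (int l, k)" "k < 2 ^ l" using nodes_cases by blast
  show "v \<in> children u"
  proof (cases l)
    case 0
    then show ?thesis using v lk by auto
  next
    case (Suc m)
    have "u = (int m, k div 2)" using v lk Suc by auto
    moreover have "k = 2 * (k div 2) \<or> k = 2 * (k div 2) + 1" by presburger
    ultimately show ?thesis using lk Suc by (cases "even k") auto
  qed
qed

lemma card_children: "v \<in> nodes L \<Longrightarrow> card (children v) = (if v = (-1, 0) then 1 else 2)"
  by (cases "v = (-1, 0)") (auto elim!: nodes_cases)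

text \<open>The root has one child and every other node two, and all nodes but the root are children of a
node of the tree: \<open>1 + 2 * (card T - 1) - (card T - 1) = card T\<close>.\<close>

lemma card_ext_nodes:
  assumes T: "T \<in> trees L"
  shows "card (ext_nodes T) = card T"
proof -
  have fin: "finite T" using tree_finite[OF T] .
  have sub: "T \<subseteq> nodes L" and root: "(-1, 0) \<in> T" using treesD[OF T] by auto
  have disj: "children u \<inter> children v = {}" if "u \<in> T" "v \<in> T" "u \<noteq> v" for u v
  proof -
    have "u \<in> nodes L" "v \<in> nodes L" using that sub by auto
    then show ?thesis using \<open>u \<noteq> v\<close> by (simp only: disjoint_iff children_iff) simp
  qed
  have finc: "finite (children v)" for v by (cases v) auto
  have "card (\<Union>v\<in>T. children v) = (\<Sum>v\<in>T. card (children v))"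
    using fin finc disj by (intro card_UN_disjoint) auto
  also have "\<dots> = card (children (-1, 0)) + (\<Sum>v\<in>T - {(-1, 0)}. card (children v))"
    by (rule sum.remove[OF fin root])
  also have "(\<Sum>v\<in>T - {(-1, 0)}. card (children v)) = (\<Sum>v\<in>T - {(-1, 0)}. 2)"
  proof (rule sum.cong[OF refl])
    fix v assume v: "v \<in> T - {(-1, 0)}"
    then have "v \<in> nodes L" using sub by blast
    then show "card (children v) = 2" using v card_children[of v L] by simp
  qed
  finally have u: "card (\<Union>v\<in>T. children v) = 1 + 2 * (card T - 1)"
    using fin root by simp
  have "v \<in> (\<Union>v\<in>T. children v)" if "v \<in> T - {(-1, 0)}" for v
  proof -
    have p: "parent v \<in> T" using that treesD(3)[OF T, of v] by simp
    then have "parent v \<in> nodes L" "v \<in> nodes (Suc L)" using that sub by (auto simp: nodes_Suc)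
    then have "v \<in> children (parent v)" using that by (simp only: children_iff) simp
    then show ?thesis using p by (rule UN_I[rotated])
  qed
  moreover have "(-1, 0) \<notin> (\<Union>v\<in>T. children v)"
  proof
    assume "(-1, 0) \<in> (\<Union>v\<in>T. children v)"
    then obtain u where "u \<in> T" "(-1, 0) \<in> children u" by (rule UN_E)
    then show False using children_iff[of u L "(-1, 0)"] sub by auto
  qed
  ultimately have "(\<Union>v\<in>T. children v) \<inter> T = T - {(-1, 0)}"
    by (intro equalityI subsetI) (blast, simp)
  then have "card (ext_nodes T) = 1 + 2 * (card T - 1) - card (T - {(-1, 0)})"
    unfolding ext_nodes_def using u fin finc by (subst card_Diff_subset_Int) auto
  moreover have "card T > 0" using fin root by (auto simp: card_gt_0_iff)
  ultimately show ?thesis using fin root by simp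
qed

section \<open>Ancestors and twigs\<close>

lemma anc_eq_refl: "anc_eq v v"
  unfolding anc_eq_def by (rule exI[of _ 0]) simp

lemma parent_power: "(parent ^^ j) (l, k) = (l - int j, k div 2 ^ j)"
  by (induction j) (auto simp: div_mult2_eq[symmetric] mult.commute)

lemma parent_power_root_notin_nodes: "j > 0 \<Longrightarrow> (parent ^^ j) (-1, 0) \<notin> nodes L"
  by (auto simp: parent_power nodes_def)

lemma tree_anc_closed:
  assumes T: "T \<in> trees L" shows "v \<in> T \<Longrightarrow> u \<in> nodes L \<Longrightarrow> anc_eq u v \<Longrightarrow> u \<in> T"
proof -
  have "v \<in> T \<Longrightarrow> (parent ^^ j) v \<in> nodes L \<Longrightarrow> (parent ^^ j) v \<in> T" for j
  proof (induction j arbitrary: v)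
    case (Suc j)
    have "v \<noteq> (-1, 0)" using parent_power_root_notin_nodes Suc.prems by blast
    then have "parent v \<in> T" using treesD(3)[OF T] Suc.prems by auto
    then show ?case using Suc.IH[of "parent v"] Suc.prems by (simp add: funpow_swap1)
  qed auto
  then show "v \<in> T \<Longrightarrow> u \<in> nodes L \<Longrightarrow> anc_eq u v \<Longrightarrow> u \<in> T"
    by (auto simp: anc_eq_def)
qed

lemma anc_between_in_nodes:
  assumes u: "u \<in> nodes L" and v: "v \<in> nodes L" and uw: "anc_eq u w" and wv: "anc_eq w v"
  shows "w \<in> nodes L"
proof -
  obtain j where j: "w = (parent ^^ j) v" using wv by (auto simp: anc_eq_def)
  have "fst u \<le> fst w" using uw by (cases w) (auto simp: anc_eq_def parent_power)
  moreover have "fst u \<ge> -1" using u by (auto simp: nodes_def)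
  ultimately have w: "fst w \<ge> -1" by simp
  have "v \<in> nodes L \<Longrightarrow> fst ((parent ^^ j) v) \<ge> -1 \<Longrightarrow> (parent ^^ j) v \<in> nodes L"
  proof (induction j arbitrary: v)
    case (Suc j)
    have "v \<noteq> (-1, 0)" using Suc.prems(2) by (auto simp: parent_power simp del: funpow.simps)
    then have "parent v \<in> nodes L" using Suc.prems parent_in_nodes by blast
    then show ?case using Suc.IH[of "parent v"] Suc.prems by (simp add: funpow_swap1)
  qed auto
  then show ?thesis using w j v by auto
qed

text \<open>Restricted to \<open>nodes L\<close>, since iterating \<open>parent\<close> beyond the root leaves the tree.\<close>

definition ancestors :: "nat \<Rightarrow> node \<Rightarrow> node set" where
  "ancestors L v = {u \<in> nodes L. anc_eq u v}"

lemma ancestors_subset_tree: "T \<in> trees L \<Longrightarrow> v \<in> T \<Longrightarrow> ancestors L v \<subseteq> T"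
  unfolding ancestors_def using tree_anc_closed by blast

lemma self_in_ancestors: "v \<in> nodes L \<Longrightarrow> v \<in> ancestors L v"
  by (simp add: ancestors_def anc_eq_refl)

lemma Un_ancestors_in_trees:
  assumes T: "T \<in> trees L" and v: "v \<in> nodes L"
  shows "T \<union> ancestors L v \<in> trees L"
proof -
  have "parent u \<in> ancestors L v" if u: "u \<in> ancestors L v" "u \<noteq> (-1, 0)" for u
  proof -
    obtain j where "u = (parent ^^ j) v" using u by (auto simp: ancestors_def anc_eq_def)
    then have "parent u = (parent ^^ Suc j) v" by simp
    then have "anc_eq (parent u) v" unfolding anc_eq_def by blast
    then show ?thesis using u parent_in_nodes by (auto simp: ancestors_def)
  qed
  then show ?thesis using T by (auto simp: trees_iff ancestors_def)
qed

lemma anc_eq_comparable: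
  assumes "anc_eq u v" "anc_eq w v"
  shows "anc_eq u w \<or> (\<exists>j. w = (parent ^^ Suc j) u)"
proof -
  obtain a b where a: "u = (parent ^^ a) v" and b: "w = (parent ^^ b) v"
    using assms by (auto simp: anc_eq_def)
  show ?thesis
  proof (cases "b \<le> a")
    case True
    then have "a = (a - b) + b" by simp
    then have "u = (parent ^^ (a - b)) w" unfolding a b by (metis comp_apply funpow_add)
    then show ?thesis by (auto simp: anc_eq_def)
  next
    case False
    then have "b = Suc (b - a - 1) + a" by simp
    then have "w = (parent ^^ Suc (b - a - 1)) u" unfolding a b by (metis comp_apply funpow_add)
    then show ?thesis by blast
  qed
qed

context
  fixes L T v
  assumes T: "T \<in> trees L" and v: "v \<in> nodes L" "v \<notin> T"
begin

text \<open>Walking up from \<open>v\<close>, the last node before the walk enters \<open>T\<close> is external. A second external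
ancestor would lie above it, hence above its parent, and so belong to \<open>T\<close>.\<close>

lemma unique_ext_ancestor: "\<exists>!u. u \<in> ext_nodes T \<and> anc_eq u v"
proof -
  have root: "(-1, 0) \<in> T" by (rule treesD(2)[OF T])
  then have "v \<noteq> (-1, 0)" using v by auto
  with v obtain l k where lk: "v = (int l, k)" "k < 2 ^ l" using nodes_cases[of v L] by blast
  have "k < 2 ^ Suc l" using lk(2) by simp
  then have "k div 2 ^ Suc l = 0" by (rule div_less)
  then have "(parent ^^ Suc l) v = (-1, 0)" unfolding lk parent_power by simp
  then have ex: "\<exists>j. (parent ^^ j) v \<in> T" using root by metis
  define j where "j = (LEAST j. (parent ^^ j) v \<in> T)"
  have jT: "(parent ^^ j) v \<in> T" unfolding j_def using ex by (rule LeastI_ex)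
  have j0: "j \<noteq> 0" using jT v by (cases j) auto
  then obtain i where i: "j = Suc i" by (cases j) auto
  let ?u = "(parent ^^ i) v"
  have uT: "?u \<notin> T" using not_less_Least[of i "\<lambda>j. (parent ^^ j) v \<in> T"] i by (auto simp: j_def)
  have pu: "parent ?u \<in> T" using jT i by simp
  have unodes: "?u \<in> nodes L"
    using treesD(1)[OF T] pu v by (intro anc_between_in_nodes[of "parent ?u" L v ?u])
      (auto simp: anc_eq_def intro: exI[of _ 1] exI[of _ i])
  have "?u \<noteq> (-1, 0)" using uT root by auto
  then have "?u \<in> children (parent ?u)"
    using children_iff[of "parent ?u" L ?u] unodes nodes_Suc[of L] treesD(1)[OF T] pu by auto
  then have u: "?u \<in> ext_nodes T \<and> anc_eq ?u v"
    unfolding ext_nodes_def using pu uT by (auto simp: anc_eq_def)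
  have ext: "x \<in> nodes L \<and> parent x \<in> T \<and> x \<notin> T" if x: "x \<in> ext_nodes T" "anc_eq x v" for x
  proof -
    obtain y where y: "y \<in> T" "x \<in> children y" "x \<notin> T" using x by (auto simp: ext_nodes_def)
    have "y \<in> nodes L" using y treesD(1)[OF T] by auto
    then have p: "parent x = y" using y children_iff by blast
    then have "x \<in> nodes L"
      using x v \<open>y \<in> nodes L\<close> by (intro anc_between_in_nodes[of y L v x])
        (auto simp: anc_eq_def intro: exI[of _ 1])
    then show ?thesis using p y by auto
  qed
  have no: False if x: "x \<in> ext_nodes T" "anc_eq x v" and y: "y \<in> ext_nodes T" "anc_eq y v"
    and xy: "y = (parent ^^ Suc m) x" for x y m
  proof -
    have "anc_eq y (parent x)" unfolding anc_eq_def xy by (auto simp: funpow_swap1)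
    then have "y \<in> T" using tree_anc_closed[OF T, of "parent x" y] ext[OF x] ext[OF y] by auto
    then show False using ext[OF y] by auto
  qed
  show ?thesis
  proof (rule ex1I[where a = ?u])
    show "?u \<in> ext_nodes T \<and> anc_eq ?u v" by (rule u)
    fix x assume x: "x \<in> ext_nodes T \<and> anc_eq x v"
    show "x = ?u"
    proof (rule ccontr)
      assume ne: "x \<noteq> ?u"
      from anc_eq_comparable[of x v ?u] x u consider "anc_eq x ?u" | m where "?u = (parent ^^ Suc m) x"
        by blast
      then show False
      proof cases
        case 1
        then obtain m where m: "x = (parent ^^ m) ?u" by (auto simp: anc_eq_def)
        with ne obtain m' where "m = Suc m'" by (cases m) auto
        then show False using no[of ?u x m'] m x u by blast
      next
        case 2
        then show False using no[of x ?u m] x u by blast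
      qed
    qed
  qed
qed

definition ext_anc :: node where
  "ext_anc = (THE u. u \<in> ext_nodes T \<and> anc_eq u v)"

lemma ext_anc: "ext_anc \<in> ext_nodes T" "anc_eq ext_anc v"
  using theI'[OF unique_ext_ancestor] by (auto simp: ext_anc_def)

lemma ext_anc_facts: "ext_anc \<in> nodes L" "ext_anc \<notin> T" "parent ext_anc \<in> T" "ext_anc \<noteq> (-1, 0)"
proof -
  obtain y where y: "y \<in> T" "ext_anc \<in> children y" "ext_anc \<notin> T"
    using ext_anc by (auto simp: ext_nodes_def)
  have yn: "y \<in> nodes L" using y treesD(1)[OF T] by auto
  then have p: "parent ext_anc = y" "ext_anc \<noteq> (-1, 0)" using y children_iff by blast+
  show "ext_anc \<in> nodes L"
    using ext_anc v yn p by (intro anc_between_in_nodes[of y L v ext_anc])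
      (auto simp: anc_eq_def intro: exI[of _ 1])
  show "ext_anc \<notin> T" "parent ext_anc \<in> T" "ext_anc \<noteq> (-1, 0)" using p y by auto
qed

lemma twig_disjoint: "twig ext_anc v \<inter> T = {}"
  unfolding twig_def using tree_anc_closed[OF T] ext_anc_facts by blast

lemma grow_eq_Un_twig: "grow T v = T \<union> twig ext_anc v"
  by (simp add: grow_def ext_anc_def)

text \<open>The ancestors of \<open>v\<close> above the external node are in \<open>T\<close> already, so growing the twig and adding
all ancestors is the same. In particular the external node disappears from the description.\<close>

lemma grow_eq: "grow T v = T \<union> ancestors L v"
proof -
  have "twig ext_anc v \<subseteq> ancestors L v"
    unfolding twig_def ancestors_def
    using anc_between_in_nodes[OF ext_anc_facts(1) v(1)] by auto
  moreover have "w \<in> twig ext_anc v" if w: "w \<in> ancestors L v" "w \<notin> T" for w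
  proof -
    have wv: "anc_eq w v" "w \<in> nodes L" using w by (auto simp: ancestors_def)
    have False if "w = (parent ^^ Suc m) ext_anc" for m
    proof -
      have "anc_eq w (parent ext_anc)" unfolding anc_eq_def that by (auto simp: funpow_swap1)
      then show False using tree_anc_closed[OF T] ext_anc_facts wv w by blast
    qed
    then have "anc_eq ext_anc w" using anc_eq_comparable[OF ext_anc(2) wv(1)] by blast
    then show ?thesis using wv by (auto simp: twig_def)
  qed
  ultimately show ?thesis unfolding grow_eq_Un_twig by blast
qed

lemma descendants_grow: "descendants (grow T v) ext_anc = twig ext_anc v"
proof -
  have "\<not> anc_eq ext_anc w" if "w \<in> T" for w
    using tree_anc_closed[OF T that] ext_anc_facts by blast
  then show ?thesis
    unfolding descendants_def grow_eq_Un_twig by (auto simp: twig_def)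
qed

text \<open>Growing a twig can be undone by a single pruning move.\<close>

lemma grow_minus_descendants: "grow T v - descendants (grow T v) ext_anc = T"
  unfolding descendants_grow using twig_disjoint by (auto simp: grow_eq_Un_twig)

lemma ext_anc_prunable: "ext_anc \<in> prunable (grow T v)"
proof -
  have "ext_anc \<in> grow T v"
    using ext_anc by (auto simp: grow_eq_Un_twig twig_def anc_eq_refl)
  moreover have "fst ext_anc \<ge> 0"
    using ext_anc_facts by (auto simp: nodes_def)
  ultimately show ?thesis
    unfolding prunable_def using ext_anc descendants_grow by blast
qed

end

section \<open>Lower bounds for the proposal\<close>

lemma finite_open_layers: "finite (open_layers L T)"
  by (rule finite_subset[of _ "{0..<int L}"]) (auto simp: open_layers_def)

lemma finite_open_positions: "finite (open_positions T l)"
  by (rule finite_subset[of _ "{..<2 ^ nat l}"]) (auto simp: open_positions_def)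

lemma layer_prob_nonneg: "D > 1 \<Longrightarrow> 0 \<le> layer_prob D L T l"
  unfolding layer_prob_def by (intro divide_nonneg_nonneg sum_nonneg) auto

lemma sum_layer_prob_le: "(\<Sum>l\<in>open_layers L T. layer_prob D L T l) \<le> 1"
  unfolding layer_prob_def sum_divide_distrib[symmetric] by (simp add: divide_self_if)

lemma sum_grow_prob_le:
  assumes D: "D > 1" and S: "finite S"
  shows "(\<Sum>T'\<in>S. grow_prob D L T T') \<le> 1"
proof -
  let ?c = "\<lambda>l. layer_prob D L T l / real (card (open_positions T l))"
  have c: "0 \<le> ?c l" for l using layer_prob_nonneg[OF D] by simp
  have "(\<Sum>T'\<in>S. grow_prob D L T T') =
      (\<Sum>l\<in>open_layers L T. \<Sum>k\<in>open_positions T l. \<Sum>T'\<in>S. if grow T (l, k) = T' then ?c l else 0)"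
    unfolding grow_prob_def by (subst sum.swap, rule sum.cong[OF refl], subst sum.swap, rule refl)
  also have "\<dots> \<le> (\<Sum>l\<in>open_layers L T. \<Sum>k\<in>open_positions T l. ?c l)"
    using c S by (intro sum_mono) (simp add: sum.delta')
  also have "\<dots> \<le> (\<Sum>l\<in>open_layers L T. layer_prob D L T l)"
    using layer_prob_nonneg[OF D] by (intro sum_mono) simp
  also have "\<dots> \<le> 1" by (rule sum_layer_prob_le)
  finally show ?thesis .
qed

lemma grow_prob_nonneg: "D > 1 \<Longrightarrow> 0 \<le> grow_prob D L T T'"
  unfolding grow_prob_def using layer_prob_nonneg by (intro sum_nonneg) simp

lemma prune_prob_nonneg: "0 \<le> prune_prob T T'"
  unfolding prune_prob_def by (intro sum_nonneg) simp

lemma sum_prune_prob_le: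
  assumes S: "finite S" shows "(\<Sum>T'\<in>S. prune_prob T T') \<le> 1"
proof -
  let ?c = "1 / real (card (prunable T))"
  have "(\<Sum>T'\<in>S. prune_prob T T') = (\<Sum>u\<in>prunable T. \<Sum>T'\<in>S. if T - descendants T u = T' then ?c else 0)"
    unfolding prune_prob_def by (rule sum.swap)
  also have "\<dots> \<le> (\<Sum>u\<in>prunable T. ?c)"
    using S by (intro sum_mono) (simp add: sum.delta')
  also have "\<dots> \<le> 1" by simp
  finally show ?thesis .
qed

lemma proposal_nonneg: "D > 1 \<Longrightarrow> 0 \<le> proposal D L T T'"
  unfolding proposal_def using grow_prob_nonneg prune_prob_nonneg by simp

lemma sum_proposal_le:
  assumes D: "D > 1" and S: "finite S" shows "(\<Sum>T'\<in>S. proposal D L T T') \<le> 1"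
proof -
  note le = sum_grow_prob_le[OF D S, of L T] sum_prune_prob_le[OF S, of T]
  consider "T = null_tree" | "T \<noteq> null_tree" "T = nodes L" | "T \<noteq> null_tree" "T \<noteq> nodes L" by blast
  then show ?thesis
    by cases (use le in \<open>simp_all add: proposal_def sum.distrib sum_divide_distrib[symmetric]\<close>)
qed

definition level_ratio :: "real \<Rightarrow> nat \<Rightarrow> real" where
  "level_ratio D L = (D - 1) / (D ^ L - 1)"

lemma level_ratio_eq: "D > 1 \<Longrightarrow> level_ratio D L = 1 / (\<Sum>i<L. D ^ i)"
  using geometric_sum[of D L] by (simp add: level_ratio_def)

text \<open>The least likely layer is the last one, and it is least likely when all layers are open; then its
probability is the reciprocal of a geometric sum.\<close>

lemma layer_prob_ge:
  assumes D: "D > 1" and l: "l \<in> open_layers L T"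
  shows "level_ratio D L \<le> layer_prob D L T l"
proof -
  have l': "0 \<le> l" "l < int L" using l by (auto simp: open_layers_def)
  have pos: "0 < D powi (- i)" for i using D by simp
  let ?s = "\<Sum>l'\<in>open_layers L T. D powi (- l')"
  have spos: "?s > 0" using l pos by (intro sum_pos finite_open_layers) auto
  have "?s / D powi (- l) = (\<Sum>l'\<in>open_layers L T. D powi (l - l'))"
    unfolding sum_divide_distrib
    by (rule sum.cong[OF refl]) (use D in \<open>simp add: power_int_diff power_int_minus field_simps\<close>)
  also have "\<dots> \<le> (\<Sum>l'\<in>open_layers L T. D powi (int L - 1 - l'))"
    using l' D by (intro sum_mono power_int_increasing) auto
  also have "\<dots> \<le> (\<Sum>l'\<in>{0..<int L}. D powi (int L - 1 - l'))"
    using D by (intro sum_mono2) (auto simp: open_layers_def)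
  also have "\<dots> = (\<Sum>i<L. D ^ i)"
    by (rule sum.reindex_bij_witness[of _ "\<lambda>i. int L - 1 - int i" "\<lambda>l'. nat (int L - 1 - l')"])
      (auto simp: power_int_def)
  finally have "?s / D powi (- l) \<le> (\<Sum>i<L. D ^ i)" .
  moreover have "0 < ?s / D powi (- l)" using spos pos by simp
  ultimately have "1 / (\<Sum>i<L. D ^ i) \<le> 1 / (?s / D powi (- l))"
    by (intro divide_left_mono mult_pos_pos) auto
  then show ?thesis
    by (simp add: level_ratio_eq[OF D] layer_prob_def)
qed

text \<open>A growing move has probability at least \<open>level_ratio D L / 2 ^ L\<close>. This is reduced by the
factor \<open>(2 ^ L - 1) / 2 ^ L\<close> so that the path length \<open>2 ^ L - 1\<close> cancels in the Poincare constant.\<close>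

definition min_rate :: "real \<Rightarrow> nat \<Rightarrow> real" where
  "min_rate D L = (2 ^ L - 1) / 2 ^ (2 * L) * level_ratio D L"

lemma level_ratio_le: "D > 1 \<Longrightarrow> L \<ge> 2 \<Longrightarrow> level_ratio D L \<le> 1 / 2"
proof -
  assume D: "D > 1" and L: "L \<ge> 2"
  have "(2::real) \<le> (\<Sum>i<2. D ^ i)" using D by (simp add: numeral_2_eq_2)
  also have "\<dots> \<le> (\<Sum>i<L. D ^ i)" using L D by (intro sum_mono2) auto
  finally have s: "2 \<le> (\<Sum>i<L. D ^ i)" .
  show ?thesis unfolding level_ratio_eq[OF D] by (rule divide_left_mono) (use s in auto)
qed

lemma level_ratio_pos: "D > 1 \<Longrightarrow> L \<ge> 1 \<Longrightarrow> 0 < level_ratio D L"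
proof -
  assume D: "D > 1" and L: "L \<ge> 1"
  have "0 < (\<Sum>i<L. D ^ i)" using D L by (intro sum_pos) (auto simp: lessThan_empty_iff)
  then show ?thesis unfolding level_ratio_eq[OF D] by simp
qed

lemma proposal_grow_ge:
  assumes D: "D > 1" and T: "T \<in> trees L" and v: "v \<in> nodes L" "v \<notin> T"
  shows "min_rate D L \<le> proposal D L T (grow T v)"
proof -
  have "v \<noteq> (-1, 0)" using treesD(2)[OF T] v by auto
  then obtain l k where lk: "v = (int l, k)" "l < L" "k < 2 ^ l" using nodes_cases[OF v(1)] by blast
  have pos: "k \<in> open_positions T (int l)" using lk v by (simp add: open_positions_def)
  have lay: "int l \<in> open_layers L T" using lk v by (auto simp: open_layers_def)
  let ?c = "\<lambda>l. layer_prob D L T l / real (card (open_positions T l))"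
  let ?g = "\<lambda>l k. if grow T (l, k) = grow T v then ?c l else 0"
  have nn: "0 \<le> ?g l k" for l k using layer_prob_nonneg[OF D] by simp
  have "card (open_positions T (int l)) \<le> card {..<(2::nat) ^ l}"
    by (intro card_mono) (auto simp: open_positions_def)
  then have c1: "card (open_positions T (int l)) \<le> 2 ^ l" by simp
  have "(2::nat) ^ l \<le> 2 ^ (L - 1)" using lk(2) by (intro power_increasing) auto
  with c1 have "card (open_positions T (int l)) \<le> 2 ^ (L - 1)" by (rule order_trans)
  then have c2: "real (card (open_positions T (int l))) \<le> 2 ^ (L - 1)"
    by (metis of_nat_le_iff of_nat_numeral of_nat_power)
  have c0: "0 < card (open_positions T (int l))" using pos finite_open_positions by (auto simp: card_gt_0_iff)
  have L: "L \<ge> 1" using lk(2) by simp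
  have "level_ratio D L / 2 ^ (L - 1) \<le> ?c (int l)"
    using layer_prob_ge[OF D lay] c2 c0 layer_prob_nonneg[OF D] by (intro frac_le) auto
  also have "\<dots> = ?g (int l) k" by (simp add: lk)
  also have "\<dots> \<le> (\<Sum>k\<in>open_positions T (int l). ?g (int l) k)"
    by (rule member_le_sum[OF pos nn finite_open_positions])
  also have "\<dots> \<le> grow_prob D L T (grow T v)"
    unfolding grow_prob_def by (rule member_le_sum[OF lay sum_nonneg finite_open_layers]) (rule nn)
  finally have g: "level_ratio D L / 2 ^ (L - 1) \<le> grow_prob D L T (grow T v)" .
  have "grow_prob D L T (grow T v) / 2 \<le> proposal D L T (grow T v)"
  proof -
    have "T \<noteq> nodes L" using v by blast
    then show ?thesis
      using grow_prob_nonneg[OF D, of L T "grow T v"] prune_prob_nonneg[of T "grow T v"]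
      unfolding proposal_def by (cases "T = null_tree") simp_all
  qed
  moreover have "level_ratio D L / 2 ^ (L - 1) / 2 \<le> grow_prob D L T (grow T v) / 2"
    using g by (rule divide_right_mono) simp
  ultimately have g': "level_ratio D L / 2 ^ (L - 1) / 2 \<le> proposal D L T (grow T v)"
    by (rule order_trans[rotated])
  have "min_rate D L \<le> 2 ^ L / 2 ^ (2 * L) * level_ratio D L"
    unfolding min_rate_def using level_ratio_pos[OF D L]
    by (intro mult_right_mono divide_right_mono) auto
  also have "(2::real) ^ L / 2 ^ (2 * L) * level_ratio D L = level_ratio D L / 2 ^ (L - 1) / 2"
    using L by (cases L) (auto simp: power_mult power2_eq_square field_simps)
  finally show ?thesis using g' by linarith
qed

lemma min_rate_le:
  assumes D: "D > 1" and L: "L \<ge> 1" shows "min_rate D L \<le> 1 / (2 * (2 ^ L - 1))"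
proof -
  define N where "N = (2::real) ^ L"
  have N2: "N \<ge> 2" unfolding N_def using power_increasing[OF L, of "2::real"] by simp
  have NN: "2 ^ (2 * L) = N * N" by (simp add: N_def power_mult power2_eq_square power_mult_distrib[symmetric])
  have "(N - 1) * (N - 1) * 2 * level_ratio D L \<le> N * N"
  proof (cases "L = 1")
    case True
    then show ?thesis using D by (simp add: N_def level_ratio_def)
  next
    case False
    then have "level_ratio D L \<le> 1 / 2" using level_ratio_le[OF D] L by simp
    then have "(N - 1) * (N - 1) * 2 * level_ratio D L \<le> (N - 1) * (N - 1) * 2 * (1 / 2)"
      using N2 by (intro mult_left_mono) auto
    also have "\<dots> \<le> N * N" using N2 by (simp add: algebra_simps)
    finally show ?thesis .
  qed
  then show ?thesis
    unfolding min_rate_def NN N_def[symmetric] using N2 by (simp add: divide_simps mult_ac)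
qed

lemma proposal_prune_ge:
  assumes D: "D > 1" and T: "T \<in> trees L" and v: "v \<in> nodes L" "v \<notin> T"
  shows "min_rate D L \<le> proposal D L (grow T v) T"
proof -
  let ?T = "grow T v" and ?u = "ext_anc T v"
  have vT: "v \<in> ?T" unfolding grow_eq[OF T v] using self_in_ancestors[OF v(1)] by simp
  have root: "(-1, 0) \<in> T" by (rule treesD(2)[OF T])
  have T': "?T \<in> trees L" unfolding grow_eq[OF T v] by (rule Un_ancestors_in_trees[OF T v(1)])
  have ne: "?T \<noteq> null_tree"
  proof
    assume "?T = null_tree"
    then have "v = (-1, 0)" using vT by (simp add: null_tree_def)
    then show False using v(2) root by simp
  qed
  have "v \<noteq> (-1, 0)" using root v by auto
  then obtain l where "l < L" using nodes_cases[OF v(1)] by blast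
  then have L: "L \<ge> 1" by simp
  have sub: "prunable ?T \<subseteq> nodes L - {(-1, 0)}"
  proof
    fix w assume "w \<in> prunable ?T"
    then have "w \<in> ?T" "fst w \<ge> 0" by (simp_all add: prunable_def)
    then show "w \<in> nodes L - {(-1, 0)}" using treesD(1)[OF T'] by auto
  qed
  have fin: "finite (prunable ?T)" by (rule finite_subset[OF sub]) (simp add: finite_nodes)
  have "card (prunable ?T) \<le> card (nodes L - {(-1, 0)})"
    using sub finite_nodes by (intro card_mono) auto
  then have "card (prunable ?T) \<le> 2 ^ L - 1" by (simp add: card_nodes root_in_nodes finite_nodes)
  then have "real (card (prunable ?T)) \<le> real (2 ^ L - 1)" by (simp only: of_nat_le_iff)
  then have card: "real (card (prunable ?T)) \<le> 2 ^ L - 1" by (simp add: of_nat_diff)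
  have u: "?u \<in> prunable ?T" by (rule ext_anc_prunable[OF T v])
  then have pos: "0 < card (prunable ?T)" using fin by (auto simp: card_gt_0_iff)
  have "1 / (2 ^ L - 1) \<le> 1 / real (card (prunable ?T))"
    using card pos by (intro divide_left_mono) auto
  also have "\<dots> = (if ?T - descendants ?T ?u = T then 1 / real (card (prunable ?T)) else 0)"
    by (simp add: grow_minus_descendants[OF T v])
  also have "\<dots> \<le> prune_prob ?T T"
    unfolding prune_prob_def
    by (rule member_le_sum[OF u _ fin, where f = "\<lambda>u. if ?T - descendants ?T u = T then 1 / real (card (prunable ?T)) else 0"]) simp
  finally have p: "1 / (2 ^ L - 1) \<le> prune_prob ?T T" .
  have "prune_prob ?T T / 2 \<le> proposal D L ?T T"
    using grow_prob_nonneg[OF D, of L ?T T] prune_prob_nonneg[of ?T T] ne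
    unfolding proposal_def by (cases "?T = nodes L") simp_all
  moreover have "min_rate D L \<le> 1 / (2 ^ L - 1) / 2"
    using min_rate_le[OF D L] by (simp only: divide_divide_eq_left mult.commute)
  moreover have "1 / (2 ^ L - 1) / 2 \<le> prune_prob ?T T / 2"
    using p by (rule divide_right_mono) simp
  ultimately show ?thesis by linarith
qed

section \<open>Gaussian integrals\<close>

lemma std_normal_prob_space: "prob_space std_normal"
  unfolding std_normal_def by (rule prob_space_normal_density) simp

lemma sets_std_normal [simp, measurable_cong]: "sets std_normal = sets borel"
  by (simp add: std_normal_def)

text \<open>Completing the square turns the integrand into a multiple of a normal density with variance
\<open>1 / (1 + a)\<close>. With \<open>a = n\<close> this integrates out a coefficient of the model, with \<open>a = 0\<close> it is
the moment generating function used for the tail bound.\<close>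

lemma gaussian_exp_quadratic:
  assumes a: "a \<ge> 0"
  shows "has_bochner_integral std_normal (\<lambda>x. exp (b * x - a * x\<^sup>2 / 2))
    (exp (b\<^sup>2 / (2 * (1 + a))) / sqrt (1 + a))"
proof -
  let ?s = "1 / sqrt (1 + a)" and ?m = "b / (1 + a)"
  let ?C = "exp (b\<^sup>2 / (2 * (1 + a))) / sqrt (1 + a)"
  have s: "?s > 0" using a by simp
  have s2: "?s\<^sup>2 = 1 / (1 + a)" using a by (simp add: power_divide)
  have "has_bochner_integral lborel (\<lambda>x. ?C * normal_density ?m ?s x) (?C * 1)"
    by (intro has_bochner_integral_mult_right)
      (use s in \<open>simp add: has_bochner_integral_iff integral_normal_density integrable_normal_density\<close>)
  moreover have "std_normal_density x *\<^sub>R exp (b * x - a * x\<^sup>2 / 2) = ?C * normal_density ?m ?s x" for x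
  proof -
    have e: "- (x - ?m)\<^sup>2 / (2 * ?s\<^sup>2) = - x\<^sup>2 / 2 + (b * x - a * x\<^sup>2 / 2) - b\<^sup>2 / (2 * (1 + a))"
      unfolding s2 using a by (simp add: power2_eq_square divide_simps) (simp add: algebra_simps)
    have r: "sqrt (2 * pi * ?s\<^sup>2) = sqrt (2 * pi) / sqrt (1 + a)"
      using a by (simp add: s2 real_sqrt_divide)
    have "normal_density ?m ?s x = sqrt (1 + a) / sqrt (2 * pi) *
        (exp (- x\<^sup>2 / 2) * exp (b * x - a * x\<^sup>2 / 2) / exp (b\<^sup>2 / (2 * (1 + a))))"
    proof -
      have "exp (- (x - ?m)\<^sup>2 / (2 * ?s\<^sup>2)) =
          exp (- x\<^sup>2 / 2) * exp (b * x - a * x\<^sup>2 / 2) / exp (b\<^sup>2 / (2 * (1 + a)))"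
        unfolding e by (subst exp_diff, subst exp_add, rule refl)
      then show ?thesis unfolding normal_density_def r by (simp only: divide_divide_eq_right mult_1 times_divide_eq_left)
    qed
    note nd = this
    have "sqrt (1 + a) \<noteq> 0" using a by simp
    then show ?thesis
      unfolding nd std_normal_density_def by (simp add: divide_simps)
  qed
  ultimately have "has_bochner_integral lborel (\<lambda>x. std_normal_density x *\<^sub>R exp (b * x - a * x\<^sup>2 / 2)) ?C"
    by simp
  then show ?thesis
    unfolding std_normal_def
    by (subst has_bochner_integral_density) (auto intro: normal_density_nonneg)
qed

lemma gaussian_prod_exp_quadratic:
  assumes "finite I" and a: "\<And>i. i \<in> I \<Longrightarrow> a i \<ge> 0"
  shows "has_bochner_integral (Pi\<^sub>M I (\<lambda>_. std_normal)) (\<lambda>x. \<Prod>i\<in>I. exp (b i * x i - a i * (x i)\<^sup>2 / 2))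
    (\<Prod>i\<in>I. exp ((b i)\<^sup>2 / (2 * (1 + a i))) / sqrt (1 + a i))"
proof -
  interpret std: prob_space std_normal by (rule std_normal_prob_space)
  interpret product_sigma_finite "\<lambda>_. std_normal" by standard
  have "integrable (Pi\<^sub>M I (\<lambda>_. std_normal)) (\<lambda>x. \<Prod>i\<in>I. exp (b i * x i - a i * (x i)\<^sup>2 / 2))"
    using gaussian_exp_quadratic[OF a] assms(1)
    by (intro product_integrable_prod) (auto simp: has_bochner_integral_iff)
  moreover have "(LINT x|Pi\<^sub>M I (\<lambda>_. std_normal). (\<Prod>i\<in>I. exp (b i * x i - a i * (x i)\<^sup>2 / 2)))
      = (\<Prod>i\<in>I. exp ((b i)\<^sup>2 / (2 * (1 + a i))) / sqrt (1 + a i))"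
    using gaussian_exp_quadratic[OF a] assms(1)
    by (subst product_integral_prod) (auto simp: has_bochner_integral_iff intro!: prod.cong)
  ultimately show ?thesis by (simp add: has_bochner_integral_iff)
qed

text \<open>Chernoff's bound with exponent \<open>t / sqrt V\<close>.\<close>

lemma gaussian_linear_tail:
  fixes a :: "'i \<Rightarrow> real"
  assumes I: "finite I" and a: "(\<Sum>i\<in>I. (a i)\<^sup>2) = V" and V: "V > 0" and t: "t \<ge> 0"
  shows "measure (Pi\<^sub>M I (\<lambda>_. std_normal)) {e \<in> space (Pi\<^sub>M I (\<lambda>_. std_normal)). t * sqrt V \<le> (\<Sum>i\<in>I. a i * e i)}
    \<le> exp (- t\<^sup>2 / 2)"
proof -
  let ?M = "Pi\<^sub>M I (\<lambda>_. std_normal)"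
  interpret M: prob_space ?M by (rule prob_space_PiM) (rule std_normal_prob_space)
  let ?l = "t / sqrt V"
  have m: "has_bochner_integral ?M (\<lambda>e. exp (?l * (\<Sum>i\<in>I. a i * e i))) (exp (t\<^sup>2 / 2))"
  proof -
    have "has_bochner_integral ?M (\<lambda>e. \<Prod>i\<in>I. exp (?l * a i * e i - 0 * (e i)\<^sup>2 / 2))
      (\<Prod>i\<in>I. exp ((?l * a i)\<^sup>2 / (2 * (1 + 0))) / sqrt (1 + 0))"
      by (rule gaussian_prod_exp_quadratic) (use I in auto)
    moreover have "(\<Prod>i\<in>I. exp ((?l * a i)\<^sup>2 / (2 * (1 + 0))) / sqrt (1 + 0)) = exp (t\<^sup>2 / 2)"
    proof -
      have "(\<Prod>i\<in>I. exp ((?l * a i)\<^sup>2 / (2 * (1 + 0))) / sqrt (1 + 0)) = exp (\<Sum>i\<in>I. ?l\<^sup>2 / 2 * (a i)\<^sup>2)"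
        using I by (simp add: exp_sum power_mult_distrib power_divide)
      also have "(\<Sum>i\<in>I. ?l\<^sup>2 / 2 * (a i)\<^sup>2) = ?l\<^sup>2 / 2 * V"
        unfolding sum_distrib_left[symmetric] a by simp
      also have "\<dots> = t\<^sup>2 / 2" using V by (simp add: power_divide)
      finally show ?thesis .
    qed
    moreover have "(\<Prod>i\<in>I. exp (?l * a i * e i - 0 * (e i)\<^sup>2 / 2)) = exp (?l * (\<Sum>i\<in>I. a i * e i))" for e
      proof -
      have "(\<Prod>i\<in>I. exp (?l * a i * e i - 0 * (e i)\<^sup>2 / 2)) = exp (\<Sum>i\<in>I. ?l * (a i * e i))"
        unfolding exp_sum[OF I] by (rule prod.cong) (simp_all add: mult.assoc)
      then show ?thesis by (simp only: sum_distrib_left)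
    qed
    ultimately show ?thesis by simp
  qed
  have "{e \<in> space ?M. t * sqrt V \<le> (\<Sum>i\<in>I. a i * e i)} \<subseteq> {e \<in> space ?M. exp (t\<^sup>2) \<le> exp (?l * (\<Sum>i\<in>I. a i * e i))}"
  proof clarsimp
    fix e assume "t * sqrt V \<le> (\<Sum>i\<in>I. a i * e i)"
    then have "?l * (t * sqrt V) \<le> ?l * (\<Sum>i\<in>I. a i * e i)"
      using t V by (intro mult_left_mono) auto
    then show "t\<^sup>2 \<le> t * (\<Sum>i\<in>I. a i * e i) / sqrt V"
      using V by (simp add: power2_eq_square)
  qed
  then have "measure ?M {e \<in> space ?M. t * sqrt V \<le> (\<Sum>i\<in>I. a i * e i)}
      \<le> measure ?M {e \<in> space ?M. exp (t\<^sup>2) \<le> exp (?l * (\<Sum>i\<in>I. a i * e i))}"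
    by (intro M.finite_measure_mono) measurable
  also have "\<dots> \<le> exp (t\<^sup>2 / 2) / exp (t\<^sup>2)"
    using integral_Markov_inequality_measure[of ?M "\<lambda>e. exp (?l * (\<Sum>i\<in>I. a i * e i))" "{}" "exp (t\<^sup>2)"] m
    unfolding has_bochner_integral_iff by simp
  also have "\<dots> = exp (- t\<^sup>2 / 2)"
    by (simp add: exp_diff[symmetric])
  finally show ?thesis .
qed

lemma le_abs_iff_disj: "u \<le> \<bar>v\<bar> \<longleftrightarrow> u \<le> v \<or> u \<le> - v" for u v :: real
  by linarith

lemma gaussian_linear_abs_tail:
  fixes a :: "'i \<Rightarrow> real"
  assumes I: "finite I" and a: "(\<Sum>i\<in>I. (a i)\<^sup>2) = V" and V: "V > 0" and t: "t \<ge> 0"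
  shows "measure (Pi\<^sub>M I (\<lambda>_. std_normal)) {e \<in> space (Pi\<^sub>M I (\<lambda>_. std_normal)). t * sqrt V \<le> \<bar>\<Sum>i\<in>I. a i * e i\<bar>}
    \<le> 2 * exp (- t\<^sup>2 / 2)"
proof -
  let ?M = "Pi\<^sub>M I (\<lambda>_. std_normal)"
  interpret M: prob_space ?M by (rule prob_space_PiM) (rule std_normal_prob_space)
  define E where "E = (\<lambda>a. {e \<in> space ?M. t * sqrt V \<le> (\<Sum>i\<in>I. a i * e i)})"
  have meas: "E b \<in> sets ?M" for b unfolding E_def by measurable
  have tail: "measure ?M (E b) \<le> exp (- t\<^sup>2 / 2)" if "(\<Sum>i\<in>I. (b i)\<^sup>2) = V" for b
    unfolding E_def by (rule gaussian_linear_tail[OF I that V t])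
  have neg: "(\<Sum>i\<in>I. (- a i)\<^sup>2) = V" using a by simp
  have "{e \<in> space ?M. t * sqrt V \<le> \<bar>\<Sum>i\<in>I. a i * e i\<bar>} = E a \<union> E (\<lambda>i. - a i)"
    by (simp only: E_def mult_minus_left sum_negf le_abs_iff_disj conj_disj_distribL Collect_disj_eq)
  also have "measure ?M \<dots> \<le> measure ?M (E a) + measure ?M (E (\<lambda>i. - a i))"
    using meas[of a] meas[of "\<lambda>i. - a i"] by (rule measure_Un_le)
  finally show ?thesis
    using tail[OF a] tail[OF neg] by linarith
qed

section \<open>Orthogonality of the Haar functions on the design\<close>

lemma mem_block_iff_div:
  fixes i a h :: nat
  assumes "h > 0" "i > 0"
  shows "i \<in> {a * h<..a * h + h} \<longleftrightarrow> (i - 1) div h = a"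
proof -
  have "(i - 1) div h = a \<longleftrightarrow> a * h \<le> i - 1 \<and> i - 1 < Suc a * h"
    using assms(1) by (metis div_nat_eqI dividend_less_times_div less_mult_imp_div_less
        div_times_less_eq_dividend mult.commute mult_Suc)
  also have "\<dots> \<longleftrightarrow> i \<in> {a * h<..a * h + h}"
    using assms by auto
  finally show ?thesis by simp
qed

text \<open>At the design points a Haar function of level \<open>l\<close> is constant on blocks of \<open>h\<close> consecutive indices,
and its support consists of the blocks number \<open>2 * k\<close> and \<open>2 * k + 1\<close>.\<close>

lemma haar_at_design:
  assumes n: "n = 2 ^ (Lmax + 1)" and l: "l \<le> Lmax" and h: "h = 2 ^ (Lmax - l)"
  shows "haar (int l, k) (real i / real n) = 2 powr (real l / 2) *
    (of_bool (i \<in> {(2 * k) * h<..(2 * k) * h + h}) - of_bool (i \<in> {(2 * k + 1) * h<..(2 * k + 1) * h + h}))"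
proof -
  have nh: "n = 2 ^ l * (2 * h)"
    using l by (simp add: n h power_add[symmetric])
  have h0: "real h > 0" by (simp add: h)
  have x: "2 ^ l * (real i / real n) - real k = (real i - 2 * h * k) / (2 * h)"
    using h0 by (simp add: nh field_simps)
  have "2 ^ l * (real i / real n) - real k \<in> {0<..1/2} \<longleftrightarrow> i \<in> {(2 * k) * h<..(2 * k) * h + h}"
  proof -
    have "2 ^ l * (real i / real n) - real k \<in> {0<..1/2} \<longleftrightarrow> real (2 * k * h) < real i \<and> real i \<le> real (2 * k * h + h)"
      using h0 unfolding x by (auto simp: field_simps)
    then show ?thesis by (simp only: of_nat_less_iff of_nat_le_iff greaterThanAtMost_iff)
  qed
  moreover have "2 ^ l * (real i / real n) - real k \<in> {1/2<..1} \<longleftrightarrow>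
      i \<in> {(2 * k + 1) * h<..(2 * k + 1) * h + h}"
  proof -
    have "2 ^ l * (real i / real n) - real k \<in> {1/2<..1} \<longleftrightarrow>
        real ((2 * k + 1) * h) < real i \<and> real i \<le> real ((2 * k + 1) * h + h)"
      using h0 unfolding x by (auto simp: field_simps)
    then show ?thesis by (simp only: of_nat_less_iff of_nat_le_iff greaterThanAtMost_iff)
  qed
  ultimately show ?thesis
    by (simp add: haar_mother_def indicator_def)
qed

lemma sum_times_haar:
  assumes n: "n = 2 ^ (Lmax + 1)" and l: "l \<le> Lmax" and h: "h = 2 ^ (Lmax - l)" and k: "k < 2 ^ l"
  shows "(\<Sum>i=1..n. c i * haar (int l, k) (real i / real n)) = 2 powr (real l / 2) *
    ((\<Sum>i\<in>{(2 * k) * h<..(2 * k) * h + h}. c i) - (\<Sum>i\<in>{(2 * k + 1) * h<..(2 * k + 1) * h + h}. c i))"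
    (is "_ = _ * (sum c ?I - sum c ?J)")
proof -
  have nh: "n = 2 ^ l * (2 * h)"
    using l by (simp add: n h power_add[symmetric])
  have "(k + 1) * (2 * h) \<le> 2 ^ l * (2 * h)" using k by (intro mult_right_mono) auto
  then have sub: "?I \<subseteq> {1..n}" "?J \<subseteq> {1..n}" unfolding nh by (auto simp: algebra_simps)
  have "(\<Sum>i=1..n. c i * haar (int l, k) (real i / real n)) =
      (\<Sum>i=1..n. 2 powr (real l / 2) * ((if i \<in> ?I then c i else 0) - (if i \<in> ?J then c i else 0)))"
    by (rule sum.cong) (auto simp: haar_at_design[OF n l h] simp del: haar.simps)
  also have "\<dots> = 2 powr (real l / 2) * (sum c ?I - sum c ?J)"
    unfolding sum_distrib_left[symmetric] sum_subtractf
    by (simp only: sum.inter_restrict[OF finite_atLeastAtMost, symmetric] Int_absorb1[OF sub(1)] Int_absorb1[OF sub(2)])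
  finally show ?thesis .
qed

text \<open>The two halves of the support contain equally many design points. For \<open>c\<close> a coarser
Haar function this gives orthogonality between levels.\<close>

lemma sum_const_times_haar:
  assumes n: "n = 2 ^ (Lmax + 1)" and l: "l \<le> Lmax" and h: "h = 2 ^ (Lmax - l)" and k: "k < 2 ^ l"
    and c: "\<And>i. i > 0 \<Longrightarrow> (i - 1) div (2 * h) = k \<Longrightarrow> c i = d"
  shows "(\<Sum>i=1..n. c i * haar (int l, k) (real i / real n)) = 0"
proof -
  have h0: "h > 0" by (simp add: h)
  have "c i = d" if "i \<in> {(2 * k) * h<..(2 * k) * h + h} \<union> {(2 * k + 1) * h<..(2 * k + 1) * h + h}" for i
  proof -
    have i: "i > 0" using that by auto
    have "i \<in> {k * (2 * h)<..k * (2 * h) + 2 * h}" using that by (auto simp: algebra_simps)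
    then have "(i - 1) div (2 * h) = k" using mem_block_iff_div[of "2 * h" i k] h0 i by simp
    then show ?thesis using c i by blast
  qed
  then show ?thesis
    by (subst sum_times_haar[OF n l h k]) (simp del: mult_Suc)
qed

lemma haar_orthogonal:
  assumes n: "n = 2 ^ (Lmax + 1)" and L: "L \<le> Lmax" and u: "u \<in> nodes L" and v: "v \<in> nodes L"
  shows "(\<Sum>i=1..n. haar u (real i / real n) * haar v (real i / real n)) = (if u = v then real n else 0)"
proof -
  have n0: "n > 0" by (simp add: n)
  have root: "haar (-1, 0) (real i / real n) = 1" if "i \<in> {1..n}" for i
    using that n0 by (auto simp: indicator_def)
  have root_other: "(\<Sum>i=1..n. haar (-1, 0) (real i / real n) * haar v (real i / real n)) = 0"
    if v: "v \<in> nodes L" "v \<noteq> (-1, 0)" for v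
  proof -
    obtain l k where lk: "v = (int l, k)" "l < L" "k < 2 ^ l"
      using v by (rule nodes_cases)
    have "(\<Sum>i=1..n. haar (-1, 0) (real i / real n) * haar v (real i / real n)) = (\<Sum>i=1..n. 1 * haar v (real i / real n))"
      by (rule sum.cong) (use root in auto)
    also have "\<dots> = 0"
      unfolding lk(1) using lk L by (intro sum_const_times_haar[OF n _ refl lk(3)]) auto
    finally show ?thesis .
  qed
  have less: "(\<Sum>i=1..n. haar (int l, k) (real i / real n) * haar (int l', k') (real i / real n)) = 0"
    if l: "l < l'" "l' < L" and k': "k' < 2 ^ l'" for l l' k k'
  proof (rule sum_const_times_haar[OF n _ refl k'])
    define h where "h = (2::nat) ^ (Lmax - l)"
    define h' where "h' = (2::nat) ^ (Lmax - l')"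
    (* half of the coarse support consists of q supports of functions of level l' *)
    define q where "q = (2::nat) ^ (l' - l - 1)"
    have h: "h = 2 * h' * q"
    proof -
      have "Lmax - l = 1 + (Lmax - l') + (l' - l - 1)" using l L by simp
      then show ?thesis unfolding h_def h'_def q_def by (simp only: power_add power_one_right)
    qed
    fix i :: nat assume i: "i > 0" and ik: "(i - 1) div (2 * 2 ^ (Lmax - l')) = k'"
    have "(i - 1) div h = ((i - 1) div (2 * h')) div q"
      unfolding h by (rule div_mult2_eq)
    then have "(i - 1) div h = k' div q"
      by (simp only: h'_def ik)
    moreover have "h > 0" by (simp add: h_def)
    ultimately have block: "i \<in> {a * h<..a * h + h} \<longleftrightarrow> k' div q = a" for a
      using mem_block_iff_div[of h i a] i by simp
    have "l \<le> Lmax" using l L by simp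
    from haar_at_design[OF n this h_def, of k i] show "haar (int l, k) (real i / real n) = 2 powr (real l / 2) *
        (of_bool (k' div q = 2 * k) - of_bool (k' div q = 2 * k + 1))"
      by (simp only: block)
  qed (use l L in auto)
  have same: "(\<Sum>i=1..n. haar (int l, k) (real i / real n) * haar (int l, k') (real i / real n)) =
      (if k = k' then real n else 0)" if l: "l < L" and k: "k' < 2 ^ l" for l k k'
  proof -
    define h where "h = (2::nat) ^ (Lmax - l)"
    have lm: "l \<le> Lmax" using l L by simp
    have h0: "h > 0" by (simp add: h_def)
    have nh: "n = 2 ^ l * (2 * h)"
      using lm by (simp add: n h_def power_add[symmetric])
    have c: "haar (int l, k) (real i / real n) = 2 powr (real l / 2) * (of_bool (a = 2 * k) - of_bool (a = 2 * k + 1))"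
      if "i \<in> {a * h<..a * h + h}" for i a
    proof -
      have i: "i > 0" using that by auto
      have block: "i \<in> {b * h<..b * h + h} \<longleftrightarrow> a = b" for b
        using mem_block_iff_div[OF h0 i, of a] mem_block_iff_div[OF h0 i, of b] that by simp
      show ?thesis unfolding haar_at_design[OF n lm h_def] block ..
    qed
    have "(\<Sum>i=1..n. haar (int l, k) (real i / real n) * haar (int l, k') (real i / real n)) =
       2 powr (real l / 2) * (\<Sum>i\<in>{(2 * k') * h<..(2 * k') * h + h}. haar (int l, k) (real i / real n))
       - 2 powr (real l / 2) * (\<Sum>i\<in>{(2 * k' + 1) * h<..(2 * k' + 1) * h + h}. haar (int l, k) (real i / real n))"
      by (simp only: sum_times_haar[OF n lm h_def k] right_diff_distrib)
    also have "(\<Sum>i\<in>{(2 * k') * h<..(2 * k') * h + h}. haar (int l, k) (real i / real n)) =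
        (\<Sum>i\<in>{(2 * k') * h<..(2 * k') * h + h}. 2 powr (real l / 2) * of_bool (k = k'))"
      by (rule sum.cong[OF refl], subst c, assumption) auto
    also have "(\<Sum>i\<in>{(2 * k' + 1) * h<..(2 * k' + 1) * h + h}. haar (int l, k) (real i / real n)) =
        (\<Sum>i\<in>{(2 * k' + 1) * h<..(2 * k' + 1) * h + h}. - (2 powr (real l / 2) * of_bool (k = k')))"
    proof (rule sum.cong[OF refl], subst c, assumption)
      have "2 * k' + 1 \<noteq> 2 * k" by presburger
      moreover have "2 * k' + 1 = 2 * k + 1 \<longleftrightarrow> k = k'" by auto
      ultimately show "2 powr (real l / 2) * (of_bool (2 * k' + 1 = 2 * k) - of_bool (2 * k' + 1 = 2 * k + 1)) =
          - (2 powr (real l / 2) * of_bool (k = k'))" by (simp only:) simp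
    qed
    also have "2 powr (real l / 2) * (\<Sum>i\<in>{(2 * k') * h<..(2 * k') * h + h}. 2 powr (real l / 2) * of_bool (k = k'))
       - 2 powr (real l / 2) * (\<Sum>i\<in>{(2 * k' + 1) * h<..(2 * k' + 1) * h + h}. - (2 powr (real l / 2) * of_bool (k = k')))
       = (2 powr (real l / 2) * 2 powr (real l / 2)) * (2 * real h) * of_bool (k = k')"
      by (simp add: algebra_simps)
    also have "2 powr (real l / 2) * 2 powr (real l / 2) = (2 ^ l :: real)"
      by (simp add: powr_add[symmetric] powr_realpow)
    finally show ?thesis by (simp add: nh)
  qed
  show ?thesis
  proof (cases "u = (-1, 0)")
    case True
    show ?thesis
    proof (cases "v = (-1, 0)")
      case T: True
      have "(\<Sum>i=1..n. haar u (real i / real n) * haar v (real i / real n)) = (\<Sum>i=1..n. 1)"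
        by (rule sum.cong[OF refl]) (simp only: True T root)
      then show ?thesis using True T by simp
    qed (use True root_other[OF v] in auto)
  next
    case False
    obtain l k where lk: "u = (int l, k)" "l < L" "k < 2 ^ l"
      using u False by (rule nodes_cases)
    show ?thesis
    proof (cases "v = (-1, 0)")
      case True
      then show ?thesis using root_other[OF u False] False by (simp only: mult.commute) auto
    next
      case nr: False
      obtain l' k' where lk': "v = (int l', k')" "l' < L" "k' < 2 ^ l'"
        using v nr by (rule nodes_cases)
      show ?thesis
        using less[of l l' k' k] less[of l' l k k'] same[of l k' k] lk lk'
        by (cases l l' rule: linorder_cases) (auto simp: mult.commute simp del: haar.simps)
    qed
  qed
qed

section \<open>The posterior\<close>

definition haar_coeff :: "nat \<Rightarrow> (nat \<Rightarrow> real) \<Rightarrow> node \<Rightarrow> real" where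
  "haar_coeff n Y v = (\<Sum>i=1..n. haar v (real i / real n) * Y i)"

definition node_weight :: "real \<Rightarrow> nat \<Rightarrow> (nat \<Rightarrow> real) \<Rightarrow> node \<Rightarrow> real" where
  "node_weight q n Y v = q * (1 - q) * (exp ((haar_coeff n Y v)\<^sup>2 / (2 * (1 + real n))) / sqrt (1 + real n))"

text \<open>This is \<open>X' X = n I\<close> as a quadratic form.\<close>

lemma haar_energy:
  assumes n: "n = 2 ^ (Lmax + 1)" and L: "L \<le> Lmax" and T: "T \<subseteq> nodes L"
  shows "(\<Sum>i=1..n. (\<Sum>v\<in>T. haar v (real i / real n) * \<beta> v)\<^sup>2) = real n * (\<Sum>v\<in>T. (\<beta> v)\<^sup>2)"
proof -
  have fin: "finite T" using T finite_nodes finite_subset by blast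
  let ?h = "\<lambda>v i. haar v (real i / real n)"
  have "(\<Sum>i=1..n. (\<Sum>v\<in>T. ?h v i * \<beta> v)\<^sup>2) = (\<Sum>i=1..n. \<Sum>u\<in>T. \<Sum>v\<in>T. \<beta> u * \<beta> v * (?h u i * ?h v i))"
    by (simp add: power2_eq_square sum_product mult_ac del: haar.simps)
  also have "\<dots> = (\<Sum>u\<in>T. \<Sum>v\<in>T. \<beta> u * \<beta> v * (\<Sum>i=1..n. ?h u i * ?h v i))"
    unfolding sum_distrib_left by (subst sum.swap, rule sum.cong[OF refl], rule sum.swap)
  also have "\<dots> = (\<Sum>u\<in>T. \<Sum>v\<in>T. if u = v then \<beta> u * \<beta> v * real n else 0)"
  proof (intro sum.cong refl)
    fix u v assume "u \<in> T" "v \<in> T"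
    then have "(\<Sum>i=1..n. ?h u i * ?h v i) = (if u = v then real n else 0)"
      using T by (intro haar_orthogonal[OF n L]) auto
    then show "\<beta> u * \<beta> v * (\<Sum>i=1..n. ?h u i * ?h v i) = (if u = v then \<beta> u * \<beta> v * real n else 0)"
      by simp
  qed
  also have "\<dots> = real n * (\<Sum>v\<in>T. (\<beta> v)\<^sup>2)"
    using fin by (simp add: sum.delta' sum_distrib_left power2_eq_square mult_ac)
  finally show ?thesis .
qed

text \<open>Expanding the square in the Gaussian likelihood, the cross terms between different coefficients
vanish by orthogonality, and the integral over the coefficients factorises.\<close>

lemma marginal_likelihood_eq:
  assumes n: "n = 2 ^ (Lmax + 1)" and L: "L \<le> Lmax" and T: "T \<subseteq> nodes L"
  shows "marginal_likelihood n Y T = (\<Prod>i=1..n. std_normal_density (Y i)) *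
    (\<Prod>v\<in>T. exp ((haar_coeff n Y v)\<^sup>2 / (2 * (1 + real n))) / sqrt (1 + real n))"
proof -
  have fin: "finite T" using T finite_nodes finite_subset by blast
  let ?m = "\<lambda>\<beta> i. (\<Sum>v\<in>T. haar v (real i / real n) * \<beta> v)"
  let ?C = "\<Prod>i=1..n. std_normal_density (Y i)"
  have "(\<Prod>i=1..n. normal_density (?m \<beta> i) 1 (Y i)) =
      ?C * (\<Prod>v\<in>T. exp (haar_coeff n Y v * \<beta> v - real n * (\<beta> v)\<^sup>2 / 2))" for \<beta>
  proof -
    have "normal_density (?m \<beta> i) 1 (Y i) = std_normal_density (Y i) * exp (?m \<beta> i * Y i - (?m \<beta> i)\<^sup>2 / 2)" for i
    proof -
      have "- (Y i - ?m \<beta> i)\<^sup>2 / 2 = - (Y i)\<^sup>2 / 2 + (?m \<beta> i * Y i - (?m \<beta> i)\<^sup>2 / 2)"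
        by (simp add: power2_eq_square algebra_simps diff_divide_distrib add_divide_distrib)
      then show ?thesis
        unfolding normal_density_def by (simp add: exp_add[symmetric] del: haar.simps)
    qed
    then have "(\<Prod>i=1..n. normal_density (?m \<beta> i) 1 (Y i)) =
        ?C * exp (\<Sum>i=1..n. ?m \<beta> i * Y i - (?m \<beta> i)\<^sup>2 / 2)"
      by (simp only: prod.distrib exp_sum[OF finite_atLeastAtMost])
    also have "(\<Sum>i=1..n. ?m \<beta> i * Y i - (?m \<beta> i)\<^sup>2 / 2) =
        (\<Sum>v\<in>T. haar_coeff n Y v * \<beta> v) - (\<Sum>i=1..n. (?m \<beta> i)\<^sup>2) / 2"
    proof -
      have "(\<Sum>i=1..n. ?m \<beta> i * Y i) = (\<Sum>i=1..n. \<Sum>v\<in>T. haar v (real i / real n) * Y i * \<beta> v)"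
        unfolding sum_distrib_right by (intro sum.cong refl) (simp del: haar.simps)
      also have "\<dots> = (\<Sum>v\<in>T. haar_coeff n Y v * \<beta> v)"
        unfolding haar_coeff_def sum_distrib_right by (rule sum.swap)
      finally show ?thesis by (simp only: sum_subtractf sum_divide_distrib)
    qed
    also have "\<dots> = (\<Sum>v\<in>T. haar_coeff n Y v * \<beta> v - real n * (\<beta> v)\<^sup>2 / 2)"
      unfolding haar_energy[OF n L T] by (simp add: sum_subtractf sum_divide_distrib sum_distrib_left)
    finally show ?thesis by (simp only: exp_sum[OF fin])
  qed
  then have "marginal_likelihood n Y T =
      (\<integral>\<beta>. ?C * (\<Prod>v\<in>T. exp (haar_coeff n Y v * \<beta> v - real n * (\<beta> v)\<^sup>2 / 2)) \<partial>(Pi\<^sub>M T (\<lambda>_. std_normal)))"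
    unfolding marginal_likelihood_def by (simp only:)
  also have "\<dots> = ?C * (\<integral>\<beta>. (\<Prod>v\<in>T. exp (haar_coeff n Y v * \<beta> v - real n * (\<beta> v)\<^sup>2 / 2)) \<partial>(Pi\<^sub>M T (\<lambda>_. std_normal)))"
    by (rule integral_mult_right_zero)
  also have "(\<integral>\<beta>. (\<Prod>v\<in>T. exp (haar_coeff n Y v * \<beta> v - real n * (\<beta> v)\<^sup>2 / 2)) \<partial>(Pi\<^sub>M T (\<lambda>_. std_normal)))
      = (\<Prod>v\<in>T. exp ((haar_coeff n Y v)\<^sup>2 / (2 * (1 + real n))) / sqrt (1 + real n))"
    by (rule has_bochner_integral_integral_eq[OF gaussian_prod_exp_quadratic[OF fin]]) simp
  finally show ?thesis .
qed

text \<open>The normalising constants of the prior and of the likelihood are common to all trees and cancel.\<close>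

lemma posterior_eq:
  assumes n: "n = 2 ^ (Lmax + 1)" and L: "L \<le> Lmax" and q: "0 < q" "q < 1" and T: "T \<in> trees L"
  shows "posterior (\<lambda>_. q) L n Y T =
    (\<Prod>v\<in>T. node_weight q n Y v) / (\<Sum>T'\<in>trees L. \<Prod>v\<in>T'. node_weight q n Y v)"
proof -
  define Z where "Z = (\<Sum>T'\<in>trees L. prior_weight (\<lambda>_. q) T')"
  define C where "C = (\<Prod>i=1..n. std_normal_density (Y i))"
  have pw: "prior_weight (\<lambda>_. q) T' = (q * (1 - q)) ^ card T'" if "T' \<in> trees L" for T'
    using card_ext_nodes[OF that] by (simp add: prior_weight_def power_mult_distrib)
  have "0 < Z"
    unfolding Z_def using q nodes_in_trees
    by (intro sum_pos finite_trees) (auto simp: pw)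
  have "0 < C" unfolding C_def by (intro prod_pos) (simp add: normal_density_pos)
  have e: "tree_prior (\<lambda>_. q) L T' * marginal_likelihood n Y T' = C / Z * (\<Prod>v\<in>T'. node_weight q n Y v)"
    if T': "T' \<in> trees L" for T'
    unfolding tree_prior_def Z_def[symmetric] marginal_likelihood_eq[OF n L treesD(1)[OF T']] C_def[symmetric] pw[OF T']
    by (simp add: node_weight_def prod.distrib prod_dividef power_mult_distrib power_divide)
  have "(\<Sum>T'\<in>trees L. tree_prior (\<lambda>_. q) L T' * marginal_likelihood n Y T')
      = C / Z * (\<Sum>T'\<in>trees L. \<Prod>v\<in>T'. node_weight q n Y v)"
    unfolding sum_distrib_left by (rule sum.cong[OF refl e])
  then show ?thesis
    unfolding posterior_def e[OF T] using \<open>0 < Z\<close> \<open>0 < C\<close> by simp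
qed

lemma node_weight_pos: "0 < q \<Longrightarrow> q < 1 \<Longrightarrow> 0 < node_weight q n Y v"
  unfolding node_weight_def by (intro mult_pos_pos divide_pos_pos) auto

section \<open>The canonical path to the signal tree\<close>

lemma sum_prod_Pow:
  fixes w :: "'a \<Rightarrow> 'b::comm_semiring_1"
  assumes "finite A" shows "(\<Sum>F\<in>Pow A. prod w F) = (\<Prod>a\<in>A. 1 + w a)"
  using assms
proof (induction A)
  case (insert x A)
  have "(\<Sum>F\<in>Pow (insert x A). prod w F) = (\<Sum>F\<in>Pow A. prod w F) + (\<Sum>F\<in>insert x ` Pow A. prod w F)"
    unfolding Pow_insert using insert.hyps by (intro sum.union_disjoint) auto
  also have "(\<Sum>F\<in>insert x ` Pow A. prod w F) = (\<Sum>F\<in>Pow A. prod w (insert x F))"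
    using insert.hyps by (subst sum.reindex) (auto simp: inj_on_def)
  also have "\<dots> = (\<Sum>F\<in>Pow A. w x * prod w F)"
  proof (rule sum.cong[OF refl])
    fix F assume "F \<in> Pow A"
    then have "finite F" "x \<notin> F" using insert.hyps finite_subset[of F A] by auto
    then show "prod w (insert x F) = w x * prod w F" by simp
  qed
  finally show ?case
    using insert by (simp add: sum_distrib_left[symmetric] algebra_simps)
qed simp

lemma exp_half_le: "exp (1 / 2 :: real) \<le> 1.75"
proof -
  (* the linear lower bound for exp is sharp enough at - 1 / 8, but not at - 1 / 2 *)
  have "(7 / 8 :: real) ^ 4 \<le> exp (- (1 / 8)) ^ 4"
    using exp_ge_add_one_self[of "- (1 / 8 :: real)"] by (intro power_mono) auto
  also have "\<dots> = exp (- (1 / 2 :: real))" by (simp add: exp_of_nat_mult[symmetric])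
  finally have "(7 / 8 :: real) ^ 4 \<le> 1 / exp (1 / 2)" by (simp add: exp_minus inverse_eq_divide)
  then have "exp (1 / 2 :: real) * (7 / 8) ^ 4 \<le> 1" by (simp add: field_simps)
  moreover have "(7 / 8 :: real) ^ 4 \<ge> 1 / 1.75" by (simp add: power_numeral_reduce)
  ultimately show ?thesis by (simp add: power_numeral_reduce)
qed

text \<open>What the mixing argument needs to know about the data. The constant \<open>\<eta>\<close> is the inverse of the
least gain of a growing move towards a signal node; the set \<open>U\<close> is the twig that is added, about
which only its end point is known. Note that \<open>least_tree L B\<close> may contain nodes without signal.\<close>

locale signal_weights =
  fixes L :: nat and B :: "node set" and w :: "node \<Rightarrow> real" and \<eta> :: real
  assumes B: "B \<subseteq> nodes L"
    and w_pos: "\<And>v. v \<in> nodes L \<Longrightarrow> 0 < w v"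
    and noise: "(\<Sum>v\<in>nodes L - least_tree L B. w v) \<le> 1 / 2"
    and signal: "\<And>v U. v \<in> B \<Longrightarrow> v \<noteq> (-1, 0) \<Longrightarrow> U \<subseteq> ancestors L v \<Longrightarrow> v \<in> U \<Longrightarrow> 1 \<le> \<eta> * prod w U"
    and \<eta>: "0 < \<eta>" "2 ^ card (least_tree L B) * \<eta> \<le> 1 / 10"
begin

abbreviation "R \<equiv> least_tree L B"

definition weight :: "node set \<Rightarrow> real" where "weight T = prod w T"

definition total :: real where "total = sum weight (trees L)"

text \<open>The size of the symmetric difference, which bounds the number of moves to \<open>R\<close>.\<close>

definition dist_to_R :: "node set \<Rightarrow> nat" where "dist_to_R T = card (T - R) + card (R - T)"

lemma R: "R \<in> trees L" "B \<subseteq> R" "\<And>T. T \<in> trees L \<Longrightarrow> B \<subseteq> T \<Longrightarrow> R \<subseteq> T"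
  using least_tree[OF B] by blast+

lemma finite_R: "finite R" by (rule tree_finite[OF R(1)])

lemma \<eta>_le: "\<eta> \<le> 1"
proof -
  have "1 * \<eta> \<le> 2 ^ card R * \<eta>" using \<eta>(1) by (intro mult_right_mono) auto
  then show ?thesis using \<eta>(2) by simp
qed

lemma weight_pos_nodes: "T \<subseteq> nodes L \<Longrightarrow> 0 < weight T"
  unfolding weight_def by (intro prod_pos) (auto intro: w_pos)

lemma weight_pos: "T \<in> trees L \<Longrightarrow> 0 < weight T"
  by (rule weight_pos_nodes) (rule treesD(1))

lemma total_pos: "0 < total"
  unfolding total_def using nodes_in_trees by (intro sum_pos finite_trees weight_pos) auto

lemma dist_to_R_le:
  assumes T: "T \<in> trees L" shows "dist_to_R T \<le> 2 ^ L - 1"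
proof -
  have "dist_to_R T = card ((T - R) \<union> (R - T))"
    unfolding dist_to_R_def using tree_finite[OF T] finite_R by (intro card_Un_disjoint[symmetric]) auto
  also have "\<dots> \<le> card (nodes L - {(-1, 0)})"
    using treesD(1,2)[OF T] treesD(1,2)[OF R(1)] finite_nodes by (intro card_mono) auto
  finally show ?thesis by (simp add: card_nodes root_in_nodes finite_nodes)
qed

text \<open>A node of maximal level outside \<open>R\<close> has no child in \<open>T\<close>: such a child could not be in \<open>R\<close> either,
since \<open>R\<close> contains the parents of its nodes.\<close>

lemma removable_leaf:
  assumes T: "T \<in> trees L" and "R \<subseteq> T" "T \<noteq> R"
  obtains v where "v \<in> T" "v \<notin> R" "T - {v} \<in> trees L"
proof -
  let ?E = "T - R"
  have fin: "finite (fst ` ?E)" and ne: "fst ` ?E \<noteq> {}" using tree_finite[OF T] assms by auto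
  obtain v where v: "v \<in> ?E" "fst v = Max (fst ` ?E)" using Max_in[OF fin ne] by auto
  have top: "fst u \<le> fst v" if "u \<in> ?E" for u using v(2) fin that by simp
  have root: "(-1, 0) \<in> R" by (rule treesD(2)[OF R(1)])
  have "T - {v} \<in> trees L"
  proof (rule treesI)
    show "T - {v} \<subseteq> nodes L" using treesD(1)[OF T] by blast
    show "(-1, 0) \<in> T - {v}" using root v assms(2) by blast
    fix u assume u: "u \<in> T - {v}" "u \<noteq> (-1, 0)"
    have "parent u \<noteq> v"
    proof
      assume p: "parent u = v"
      then have lev: "fst u = fst v + 1" by (cases u) auto
      have "u \<notin> R" using treesD(3)[OF R(1), of u] u(2) p v(1) by blast
      then have "u \<in> ?E" using u by blast
      from top[OF this] lev show False by simp
    qed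
    then show "parent u \<in> T - {v}" using treesD(3)[OF T, of u] u by blast
  qed
  then show ?thesis using that v by blast
qed

text \<open>The first alternative is a growing move with its gain \<open>1 / \<eta>\<close>, the second a removal after all
  signals have been found.\<close>

definition towards :: "node set \<Rightarrow> node set \<Rightarrow> bool" where
  "towards x y \<longleftrightarrow> \<not> B \<subseteq> x \<and> x \<subseteq> y \<and> y \<subseteq> x \<union> R \<and> weight x \<le> \<eta> * weight y
     \<or> R \<subseteq> y \<and> y \<subseteq> x \<and> weight x \<le> weight y"

text \<open>If some signal is missing, a twig is grown to it; otherwise a leaf outside \<open>R\<close> is removed. Both
kinds of move exchange two trees of which one is obtained from the other by \<open>grow\<close>.\<close>

lemma canonical_step:
  assumes D: "D > 1" and T: "T \<in> trees L" "T \<noteq> R"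
  obtains T' where "T' \<in> trees L" "dist_to_R T' < dist_to_R T" "towards T T'"
    "min_rate D L \<le> proposal D L T T'" "min_rate D L \<le> proposal D L T' T" "weight T \<le> weight T'"
proof (cases "B \<subseteq> T")
  case True
  have RT: "R \<subseteq> T" by (rule R(3)[OF T(1) True])
  obtain v where v: "v \<in> T" "v \<notin> R" and T': "T - {v} \<in> trees L"
    using removable_leaf[OF T(1) RT T(2)] by blast
  have vn: "v \<in> nodes L" using treesD(1)[OF T(1)] v by blast
  have vT: "v \<notin> T - {v}" by simp
  have regrow: "grow (T - {v}) v = T"
    unfolding grow_eq[OF T' vn vT]
    using ancestors_subset_tree[OF T(1) v(1)] self_in_ancestors[OF vn] v by blast
  have "w v \<le> (\<Sum>v\<in>nodes L - R. w v)"
    using vn v w_pos finite_nodes by (intro member_le_sum) (auto intro: less_imp_le)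
  then have wv: "w v \<le> 1" using noise by linarith
  have "weight T = w v * weight (T - {v})"
    unfolding weight_def by (rule prod.remove[OF tree_finite[OF T(1)] v(1)])
  also have "\<dots> \<le> 1 * weight (T - {v})"
    using wv weight_pos[OF T'] by (intro mult_right_mono) auto
  finally have W: "weight T \<le> weight (T - {v})" by simp
  have "card (T - {v} - R) < card (T - R)"
    using v tree_finite[OF T(1)] by (intro psubset_card_mono) auto
  moreover have "R - (T - {v}) = R - T" using v by blast
  ultimately have "dist_to_R (T - {v}) < dist_to_R T" unfolding dist_to_R_def by simp
  moreover have "towards T (T - {v})" unfolding towards_def using RT v W by blast
  ultimately show ?thesis
    using that[OF T'] W proposal_grow_ge[OF D T' vn vT] proposal_prune_ge[OF D T' vn vT]
    unfolding regrow by blast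
next
  case False
  then obtain v where v: "v \<in> B" "v \<notin> T" by blast
  have vn: "v \<in> nodes L" using B v by blast
  have vr: "v \<noteq> (-1, 0)" using treesD(2)[OF T(1)] v by blast
  define U where "U = ancestors L v - T"
  have g: "grow T v = T \<union> ancestors L v" by (rule grow_eq[OF T(1) vn v(2)])
  have gU: "grow T v = T \<union> U" unfolding g U_def by blast
  have AR: "ancestors L v \<subseteq> R" using v R by (intro ancestors_subset_tree[OF R(1)]) blast
  have T': "grow T v \<in> trees L" unfolding g by (rule Un_ancestors_in_trees[OF T(1) vn])
  have fU: "finite U" unfolding U_def using AR finite_R finite_subset[of "ancestors L v" R] by simp
  have vU: "v \<in> U" unfolding U_def using self_in_ancestors[OF vn] v by blast
  have "weight (grow T v) = weight T * prod w U"
    unfolding weight_def gU using tree_finite[OF T(1)] fU by (intro prod.union_disjoint) (auto simp: U_def)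
  moreover have "1 \<le> \<eta> * prod w U"
    by (rule signal[OF v(1) vr _ vU]) (auto simp: U_def)
  then have "weight T * 1 \<le> weight T * (\<eta> * prod w U)"
    using weight_pos[OF T(1)] by (intro mult_left_mono) auto
  ultimately have W: "weight T \<le> \<eta> * weight (grow T v)" by (simp add: mult_ac)
  also have "\<dots> \<le> 1 * weight (grow T v)"
    using \<eta>_le weight_pos[OF T'] by (intro mult_right_mono) auto
  finally have W1: "weight T \<le> weight (grow T v)" by simp
  have "grow T v - R = T - R" using AR unfolding g by blast
  moreover have "card (R - grow T v) < card (R - T)"
    using AR vU v finite_R unfolding gU by (intro psubset_card_mono) (auto simp: U_def)
  ultimately have "dist_to_R (grow T v) < dist_to_R T" unfolding dist_to_R_def by simp
  moreover have "towards T (grow T v)" unfolding towards_def using False W AR g by blast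
  ultimately show ?thesis
    using that[OF T'] W1 proposal_grow_ge[OF D T(1) vn v(2)] proposal_prune_ge[OF D T(1) vn v(2)] by blast
qed

section \<open>Trees whose canonical path meets a given tree\<close>

text \<open>An explicit superset of the set of trees whose canonical path meets \<open>z\<close>. A tree \<open>z\<close> that lacks a
signal is reached only by growing, from trees that agree with \<open>z\<close> outside \<open>R\<close>. If \<open>z\<close> contains
all signals, the path of \<open>x\<close> has completed \<open>x\<close> to \<open>x \<union> R\<close> and is removing nodes; the weight lost by
the missing nodes is remembered, but not which twigs were grown.\<close>

definition upstream :: "node set \<Rightarrow> node set set" where
  "upstream z = (if B \<subseteq> z then {x. z \<subseteq> x \<union> R \<and> (R \<subseteq> x \<or> weight x \<le> \<eta> * weight (x \<union> R))}
     else {x. x = z \<or> x \<subseteq> z \<and> z \<subseteq> x \<union> R \<and> weight x \<le> \<eta> * weight z})"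

lemma self_upstream: "z \<in> trees L \<Longrightarrow> z \<in> upstream z"
  using R(3)[of z] by (auto simp: upstream_def)

lemma upstream_back:
  assumes x: "x \<in> trees L" and y: "y \<in> trees L" and z: "z \<in> trees L"
    and xy: "towards x y" and yz: "y \<in> upstream z"
  shows "x \<in> upstream z"
proof (cases "B \<subseteq> z")
  case False
  have yz': "y \<subseteq> z" "z \<subseteq> y \<union> R" and Wyz: "weight y \<le> weight z"
  proof -
    show "y \<subseteq> z" "z \<subseteq> y \<union> R" using yz False by (auto simp: upstream_def)
    have "\<eta> * weight z \<le> 1 * weight z"
      using \<eta>_le weight_pos[OF z] by (intro mult_right_mono) auto
    then show "weight y \<le> weight z" using yz False by (auto simp: upstream_def)
  qed
  have "\<not> R \<subseteq> y" using yz' False R(2) by blast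
  then have g: "x \<subseteq> y" "y \<subseteq> x \<union> R" "weight x \<le> \<eta> * weight y" using xy by (auto simp: towards_def)
  have "weight x \<le> \<eta> * weight z"
    using g(3) mult_left_mono[OF Wyz, of \<eta>] \<eta>(1) by linarith
  moreover have "x \<subseteq> z" "z \<subseteq> x \<union> R" using g yz' by blast+
  ultimately show ?thesis using False by (simp add: upstream_def)
next
  case True
  have yz': "z \<subseteq> y \<union> R" and Wy: "R \<subseteq> y \<or> weight y \<le> \<eta> * weight (y \<union> R)"
    using yz True by (auto simp: upstream_def)
  from xy consider (up) "x \<subseteq> y" "y \<subseteq> x \<union> R" "weight x \<le> \<eta> * weight y" | (down) "R \<subseteq> y" "y \<subseteq> x"
    unfolding towards_def by blast
  then show ?thesis
  proof cases
    case up
    have eq: "y \<union> R = x \<union> R" using up by blast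
    have "\<eta> * weight (y \<union> R) \<le> 1 * weight (y \<union> R)"
      using \<eta>_le weight_pos[OF trees_Un[OF y R(1)]] by (intro mult_right_mono) auto
    then have "weight y \<le> weight (y \<union> R)" using Wy by (auto simp: Un_absorb2)
    then have "weight x \<le> \<eta> * weight (x \<union> R)"
      using up(3) mult_left_mono[of "weight y" "weight (y \<union> R)" \<eta>] \<eta>(1) unfolding eq by linarith
    then show ?thesis using True yz' eq by (simp add: upstream_def)
  next
    case down
    then show ?thesis using True yz' by (auto simp: upstream_def)
  qed
qed

lemma inj_on_split_R: "inj_on (\<lambda>x. (x \<union> R, x \<inter> R)) A"
proof (rule inj_onI)
  fix x y assume "(x \<union> R, x \<inter> R) = (y \<union> R, y \<inter> R)"
  then show "x = y" by blast
qed

text \<open>Summing over all sets of additional nodes, whether or not they yield a tree, gives a product.\<close>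

lemma supersets_mass:
  assumes z: "z \<in> trees L" "R \<subseteq> z"
  shows "(\<Sum>U | z \<subseteq> U \<and> U \<subseteq> nodes L. weight U) \<le> 1.75 * weight z"
proof -
  have zn: "z \<subseteq> nodes L" by (rule treesD(1)[OF z(1)])
  let ?N = "nodes L - z"
  have "(\<Sum>U | z \<subseteq> U \<and> U \<subseteq> nodes L. weight U) = (\<Sum>F\<in>Pow ?N. weight z * prod w F)"
  proof (rule sum.reindex_bij_witness[of _ "\<lambda>F. z \<union> F" "\<lambda>U. U - z"])
    fix U assume U: "U \<in> {U. z \<subseteq> U \<and> U \<subseteq> nodes L}"
    then show "z \<union> (U - z) = U" "U - z \<in> Pow ?N" by blast+
    have "finite U" using U finite_nodes finite_subset by blast
    then show "weight z * prod w (U - z) = weight U"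
      unfolding weight_def using U by (simp add: prod.subset_diff[of z U] mult.commute)
  qed (use zn in blast)+
  also have "\<dots> = weight z * (\<Prod>a\<in>?N. 1 + w a)"
    using finite_nodes by (simp add: sum_distrib_left[symmetric] sum_prod_Pow)
  also have "(\<Prod>a\<in>?N. 1 + w a) \<le> exp (\<Sum>a\<in>?N. w a)"
    using w_pos by (intro prod_le_exp_sum) (auto intro: less_imp_le)
  also have "(\<Sum>a\<in>?N. w a) \<le> (\<Sum>a\<in>nodes L - R. w a)"
    using z w_pos finite_nodes by (intro sum_mono2) (auto intro: less_imp_le)
  also have "\<dots> \<le> 1 / 2" by (rule noise)
  also have "exp (1 / 2 :: real) \<le> 1.75" by (rule exp_half_le)
  finally show ?thesis using weight_pos[OF z(1)] by (simp add: mult_left_mono mult.commute)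
qed

text \<open>A tree \<open>x\<close> is determined by \<open>x \<union> R\<close> and \<open>x \<inter> R\<close>. If \<open>z\<close> contains all signals, the sum over the
first component is \<open>supersets_mass\<close>, and all choices of the second component but \<open>R\<close> itself carry a
factor \<open>\<eta>\<close>, which outweighs their number; \<open>1.75 * 1.1 \<le> 2\<close>. Otherwise \<open>x \<inter> R\<close> alone varies.\<close>

lemma upstream_mass:
  assumes z: "z \<in> trees L"
  shows "sum weight (trees L \<inter> upstream z) \<le> 2 * weight z"
proof (cases "B \<subseteq> z")
  case True
  have Rz: "R \<subseteq> z" by (rule R(3)[OF z True])
  let ?c = "\<lambda>s. if s = R then 1 else \<eta>" and ?Us = "{U. z \<subseteq> U \<and> U \<subseteq> nodes L}"
  let ?f = "\<lambda>x. (x \<union> R, x \<inter> R)"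
  have fUs: "finite ?Us" by (rule finite_subset[of _ "Pow (nodes L)"]) (auto simp: finite_nodes)
  have "sum weight (trees L \<inter> upstream z) \<le> (\<Sum>x\<in>trees L \<inter> upstream z. weight (x \<union> R) * ?c (x \<inter> R))"
  proof (rule sum_mono)
    fix x assume x: "x \<in> trees L \<inter> upstream z"
    show "weight x \<le> weight (x \<union> R) * ?c (x \<inter> R)"
    proof (cases "R \<subseteq> x")
      case True
      then show ?thesis by (simp add: Un_absorb2 Int_absorb1)
    next
      case False
      then have "x \<inter> R \<noteq> R" by blast
      then show ?thesis using x False True by (simp add: upstream_def mult.commute)
    qed
  qed
  also have "\<dots> = (\<Sum>(U, s)\<in>?f ` (trees L \<inter> upstream z). weight U * ?c s)"
    by (subst sum.reindex[OF inj_on_split_R]) simp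
  also have "\<dots> \<le> (\<Sum>(U, s)\<in>?Us \<times> Pow R. weight U * ?c s)"
  proof (rule sum_mono2)
    show "finite (?Us \<times> Pow R)" using fUs finite_R by simp
    show "?f ` (trees L \<inter> upstream z) \<subseteq> ?Us \<times> Pow R"
    proof (rule image_subsetI)
      fix x assume x: "x \<in> trees L \<inter> upstream z"
      then have "x \<subseteq> nodes L" "z \<subseteq> x \<union> R" using treesD(1)[of x L] True by (auto simp: upstream_def)
      then show "?f x \<in> ?Us \<times> Pow R" using treesD(1)[OF R(1)] by simp
    qed
    fix p assume "p \<in> (?Us \<times> Pow R) - ?f ` (trees L \<inter> upstream z)"
    then have "fst p \<subseteq> nodes L" by auto
    then show "0 \<le> (case p of (U, s) \<Rightarrow> weight U * ?c s)"
      using weight_pos_nodes[of "fst p"] \<eta>(1) by (simp add: case_prod_beta)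
  qed
  also have "\<dots> = (\<Sum>U\<in>?Us. weight U) * (\<Sum>s\<in>Pow R. ?c s)"
    by (simp add: sum.cartesian_product[symmetric] sum_product)
  also have "\<dots> \<le> (1.75 * weight z) * 1.1"
  proof (rule mult_mono[OF supersets_mass[OF z Rz]])
    have "(\<Sum>s\<in>Pow R. ?c s) = 1 + (\<Sum>s\<in>Pow R - {R}. ?c s)"
      using finite_R by (subst sum.remove[of _ R]) auto
    also have "(\<Sum>s\<in>Pow R - {R}. ?c s) = real (card (Pow R - {R})) * \<eta>" by simp
    also have "\<dots> \<le> real (card (Pow R)) * \<eta>"
      using \<eta>(1) finite_R by (intro mult_right_mono) (auto intro!: card_mono)
    also have "\<dots> \<le> 1 / 10" using \<eta>(2) finite_R by (simp add: card_Pow)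
    finally show "(\<Sum>s\<in>Pow R. ?c s) \<le> 1.1" by simp
    show "0 \<le> 1.75 * weight z" using weight_pos[OF z] by simp
    show "0 \<le> (\<Sum>s\<in>Pow R. ?c s)" using \<eta>(1) by (intro sum_nonneg) auto
  qed
  also have "\<dots> \<le> 2 * weight z" using weight_pos[OF z] by simp
  finally show ?thesis .
next
  case False
  let ?X = "{x. x \<subseteq> z \<and> z \<subseteq> x \<union> R}"
  have fz: "finite z" by (rule tree_finite[OF z])
  have fX: "finite ?X" by (rule finite_subset[of _ "Pow z"]) (auto simp: fz)
  have "card ?X = card ((\<lambda>x. x \<inter> R) ` ?X)"
    by (rule card_image[symmetric]) (rule inj_onI, blast)
  also have "\<dots> \<le> card (Pow R)" using finite_R by (intro card_mono) auto
  finally have "real (card ?X) \<le> 2 ^ card R"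
    using finite_R by (simp add: card_Pow)
  then have "real (card ?X) * \<eta> \<le> 2 ^ card R * \<eta>" using \<eta>(1) by (intro mult_right_mono) auto
  then have cX: "real (card ?X) * \<eta> \<le> 1" using \<eta>(2) by linarith
  define A where "A = trees L \<inter> upstream z - {z}"
  have fA: "finite A" unfolding A_def using finite_trees by simp
  have A: "x \<in> ?X \<and> weight x \<le> \<eta> * weight z" if "x \<in> A" for x
    using that False by (auto simp: A_def upstream_def)
  have "sum weight (trees L \<inter> upstream z) = weight z + sum weight A"
    unfolding A_def using z self_upstream[OF z] finite_trees by (intro sum.remove) auto
  also have "sum weight A \<le> (\<Sum>x\<in>A. \<eta> * weight z)" using A by (intro sum_mono) blast
  also have "\<dots> = (real (card A) * \<eta>) * weight z" by simp
  also have "\<dots> \<le> (real (card ?X) * \<eta>) * weight z"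
  proof -
    have "card A \<le> card ?X" using A fX by (intro card_mono) blast+
    then show ?thesis using \<eta>(1) weight_pos[OF z] by (intro mult_right_mono) auto
  qed
  also have "\<dots> \<le> 1 * weight z" using cX weight_pos[OF z] by (intro mult_right_mono) auto
  finally show ?thesis by simp
qed

text \<open>Every canonical path ends in \<open>R\<close>; by \<open>upstream_mass\<close> at least half of the total weight is at \<open>R\<close>.\<close>

lemma upstream_R:
  assumes "x \<in> trees L" shows "x \<in> upstream R"
  using assms
proof (induction "dist_to_R x" arbitrary: x rule: less_induct)
  case less
  show ?case
  proof (cases "x = R")
    case True
    then show ?thesis using self_upstream[OF R(1)] by simp
  next
    case False
    (* the moves of the path are the same for every D *)
    have "(2 :: real) > 1" by simp
    from canonical_step[OF this less.prems False]
    obtain y where y: "y \<in> trees L" "dist_to_R y < dist_to_R x" "towards x y" by blast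
    show ?thesis
      by (rule upstream_back[OF less.prems y(1) R(1) y(3) less.hyps[OF y(2) y(1)]])
  qed
qed

lemma total_le: "total \<le> 2 * weight R"
proof -
  have "trees L \<inter> upstream R = trees L" using upstream_R by blast
  then show ?thesis unfolding total_def using upstream_mass[OF R(1)] by simp
qed

definition target :: "node set \<Rightarrow> real" where "target T = weight T / total"

lemma twiggy_reversible:
  assumes D: "D > 1"
  shows "reversible_chain (trees L) (mh_kernel (trees L) (proposal D L) target) target"
proof (rule mh_reversible_chain[OF finite_trees])
  show "0 < target T" if "T \<in> trees L" for T
    using weight_pos[OF that] total_pos by (simp add: target_def)
  show "(\<Sum>T\<in>trees L. target T) = 1"
    using total_pos by (simp add: target_def sum_divide_distrib[symmetric] total_def)
  show "0 \<le> proposal D L T T'" for T T' by (rule proposal_nonneg[OF D])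
  show "(\<Sum>T'\<in>trees L. proposal D L T T') \<le> 1" for T by (rule sum_proposal_le[OF D finite_trees])
qed

lemma min_rate_pos: "D > 1 \<Longrightarrow> L \<ge> 1 \<Longrightarrow> 0 < min_rate D L"
  unfolding min_rate_def using level_ratio_pos[of D L] by simp

lemma twiggy_poincare:
  assumes D: "D > 1" and L: "L \<ge> 1"
  defines "K \<equiv> mh_kernel (trees L) (proposal D L) target"
  shows "reversible_chain.var (trees L) target f
    \<le> real (2 ^ L - 1) * 2 / min_rate D L * reversible_chain.dirichlet (trees L) K target f"
proof -
  interpret reversible_chain "trees L" K target
    unfolding K_def by (rule twiggy_reversible[OF D])
  have "\<exists>y. x \<in> trees L \<and> x \<noteq> R \<longrightarrow> y \<in> trees L \<and> dist_to_R y < dist_to_R x \<and> towards x y \<and>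
      min_rate D L \<le> proposal D L x y \<and> min_rate D L \<le> proposal D L y x \<and> weight x \<le> weight y" for x
    using canonical_step[OF D, of x] by metis
  then obtain G where G: "\<And>x. x \<in> trees L \<Longrightarrow> x \<noteq> R \<Longrightarrow> G x \<in> trees L \<and> dist_to_R (G x) < dist_to_R x \<and>
      towards x (G x) \<and> min_rate D L \<le> proposal D L x (G x) \<and> min_rate D L \<le> proposal D L (G x) x \<and>
      weight x \<le> weight (G x)" by metis
  show ?thesis
  proof (rule canonical_path_poincare[of R G dist_to_R _ upstream])
    show "R \<in> trees L" by (rule R(1))
    show "0 < min_rate D L" by (rule min_rate_pos[OF D L])
    show "x \<in> upstream z"
      if "x \<in> trees L" "x \<noteq> R" "z \<in> trees L" "z \<noteq> R" "G x \<in> upstream z" for x z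
      using upstream_back[of x "G x" z] G[of x] that by blast
    show "sum target (trees L \<inter> upstream z) \<le> 2 * target z" if "z \<in> trees L" "z \<noteq> R" for z
      using upstream_mass[OF that(1)] total_pos
      by (simp add: target_def sum_divide_distrib[symmetric] divide_right_mono)
    show "min_rate D L \<le> K x (G x)" if x: "x \<in> trees L" "x \<noteq> R" for x
      unfolding K_def
    proof (rule mh_kernel_ge)
      show "0 < target x" by (rule \<pi>_pos[OF x(1)])
      show "target x \<le> target (G x)"
        using G[OF x] total_pos by (simp add: target_def divide_right_mono)
      show "0 \<le> min_rate D L" using min_rate_pos[OF D L] by simp
    qed (use G[OF x] in auto)
  qed (use G dist_to_R_le self_upstream in auto)
qed

text \<open>The path length \<open>2 ^ L - 1\<close>, the factor \<open>2\<close> of \<open>upstream_mass\<close> and the rate \<open>min_rate D L\<close>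
give the Poincare constant \<open>2 ^ (2 * L + 1) / level_ratio D L\<close>. Since the total variation bound contains
the square root of the least mass, only half of \<open>a + b + ln 2\<close> is needed; the rest absorbs the rounding.\<close>

lemma twiggy_mixing:
  assumes D: "D > 1" and L: "L \<ge> 1" and \<epsilon>: "0 < \<epsilon>" "\<epsilon> < 1"
    and low: "\<And>T. T \<in> trees L \<Longrightarrow> exp (- a) \<le> weight T" and high: "weight R \<le> exp b" and ab: "0 \<le> a + b"
  shows "ereal_of_enat (mixing_time (trees L) (lazy (mh_kernel (trees L) (proposal D L) target)) target \<epsilon>)
    \<le> ereal ((D ^ L - 1) / (D - 1) * 2 ^ (2 * L + 3) * (a + b + ln (2 / \<epsilon>)))"
proof -
  define K where "K = mh_kernel (trees L) (proposal D L) target"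
  interpret reversible_chain "trees L" K target
    unfolding K_def by (rule twiggy_reversible[OF D])
  define \<kappa> where "\<kappa> = real (2 ^ L - 1) * 2 / min_rate D L"
  have N1: "(1::real) < 2 ^ L" using L by simp
  have lr: "0 < level_ratio D L" by (rule level_ratio_pos[OF D L])
  have "real (2 ^ L - 1) = 2 ^ L - 1" by (simp add: of_nat_diff)
  then have \<kappa>_eq: "\<kappa> = 2 ^ (2 * L + 1) / level_ratio D L"
  proof -
    have "y * 2 / (y / x * z) = 2 * x / z" if "y \<noteq> 0" for x y z :: real using that by simp
    from this[of "2 ^ L - 1" "2 ^ (2 * L)" "level_ratio D L"] N1
    show ?thesis unfolding \<kappa>_def min_rate_def \<open>real (2 ^ L - 1) = 2 ^ L - 1\<close> by simp
  qed
  define C where "C = (D ^ L - 1) / (D - 1) * 2 ^ (2 * L + 3)"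
  have C_eq: "4 * \<kappa> = C"
    unfolding C_def \<kappa>_eq level_ratio_def by (simp add: power_add)
  have "(1::real) = (\<Sum>i<1. D ^ i)" by simp
  also have "\<dots> \<le> (\<Sum>i<L. D ^ i)" using L D by (intro sum_mono2) auto
  also have "\<dots> = (D ^ L - 1) / (D - 1)" using D by (simp add: geometric_sum)
  finally have r1: "1 \<le> (D ^ L - 1) / (D - 1)" .
  have "(1::real) * 2 ^ 3 \<le> (D ^ L - 1) / (D - 1) * 2 ^ (2 * L + 3)"
    by (rule mult_mono[OF r1 power_increasing]) (use r1 in auto)
  then have C8: "8 \<le> C" unfolding C_def by simp
  (* ln 2 is the price for the trees other than R in the normalising constant *)
  define H where "H = a + b + ln 2"
  have ln\<epsilon>: "0 < ln (1 / \<epsilon>)" using \<epsilon> by (simp add: ln_div)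
  have ln2: "(1 / 2 :: real) \<le> ln 2" using ln_2_less_1 ln2_ge_two_thirds by simp
  have "ereal_of_enat (mixing_time (trees L) (lazy K) target \<epsilon>) \<le> ereal (4 * \<kappa> * (H / 2 + ln (1 / \<epsilon>)) + 1)"
  proof (rule mixing_time_lazy_le)
    show "var f \<le> \<kappa> * dirichlet f" for f
      unfolding \<kappa>_def K_def by (rule twiggy_poincare[OF D L])
    show "1 / 2 \<le> \<kappa>" using C_eq C8 by linarith
    show "0 < \<epsilon>" by (rule \<epsilon>(1))
    have "0 \<le> H" unfolding H_def using ab by simp
    then show "0 \<le> H / 2 + ln (1 / \<epsilon>)" using ln\<epsilon> by simp
    show "exp (- H) \<le> target T" if T: "T \<in> trees L" for T
    proof -
      have "total \<le> 2 * exp b" using total_le high by linarith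
      then have "exp (- a) / (2 * exp b) \<le> target T"
        unfolding target_def using low[OF T] total_pos weight_pos[OF T] by (intro frac_le) auto
      moreover have "exp (- H) = exp (- a) / (2 * exp b)"
      proof -
        have "exp (- H) = exp (- a) / (exp b * exp (ln 2))"
          unfolding H_def exp_add[symmetric] exp_diff[symmetric] by (rule arg_cong[where f = exp]) simp
        then show ?thesis by simp
      qed
      ultimately show ?thesis by simp
    qed
  qed
  also have "4 * \<kappa> * (H / 2 + ln (1 / \<epsilon>)) + 1 \<le> C * (a + b + ln (2 / \<epsilon>))"
  proof -
    have "ln (2 / \<epsilon>) = ln 2 + ln (1 / \<epsilon>)" using \<epsilon> by (simp add: ln_div)
    then have "C * (a + b + ln (2 / \<epsilon>)) = C * (H / 2 + ln (1 / \<epsilon>)) + C * (H / 2)"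
      unfolding H_def by (simp add: algebra_simps add_divide_distrib)
    moreover have "8 * (1 / 4) \<le> C * (H / 2)"
      using C8 ab ln2 unfolding H_def by (intro mult_mono) auto
    ultimately show ?thesis unfolding C_eq by linarith
  qed
  finally show ?thesis unfolding K_def C_def by simp
qed

end

section \<open>Mixing on typical data\<close>

lemma kernel_power_cong:
  assumes P: "\<And>x y. x \<in> S \<Longrightarrow> y \<in> S \<Longrightarrow> P x y = P' x y"
  shows "x \<in> S \<Longrightarrow> y \<in> S \<Longrightarrow> kernel_power S P t x y = kernel_power S P' t x y"
proof (induction t arbitrary: y)
  case (Suc t)
  then show ?case using P by (auto intro!: sum.cong)
qed simp

text \<open>The posterior of a set that is not a tree is a junk value, so it can be replaced by
\<open>target\<close> only on trees.\<close>

lemma mixing_time_cong: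
  assumes P: "\<And>x y. x \<in> S \<Longrightarrow> y \<in> S \<Longrightarrow> P x y = P' x y" and \<pi>: "\<And>x. x \<in> S \<Longrightarrow> \<pi> x = \<pi>' x"
  shows "mixing_time S P \<pi> \<epsilon> = mixing_time S P' \<pi>' \<epsilon>"
proof -
  have tv: "tv_dist S (kernel_power S P t x) \<pi> = tv_dist S (kernel_power S P' t x) \<pi>'" if x: "x \<in> S" for t x
  proof -
    have "sum (kernel_power S P t x) A = sum (kernel_power S P' t x) A \<and> sum \<pi> A = sum \<pi>' A" if "A \<in> Pow S" for A
      using that x \<pi> kernel_power_cong[of S P P', OF P] by (auto intro!: sum.cong)
    then show ?thesis
      unfolding tv_dist_def by (intro arg_cong[where f = Max] image_cong) auto
  qed
  show ?thesis
    unfolding mixing_time_def by (intro arg_cong[where f = Max] image_cong refl) (simp add: tv)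
qed

lemma mh_kernel_cong:
  assumes "\<And>x. x \<in> S \<Longrightarrow> \<pi> x = \<pi>' x" "x \<in> S" "y \<in> S"
  shows "mh_kernel S Q \<pi> x y = mh_kernel S Q \<pi>' x y"
proof -
  have "(\<Sum>z\<in>S - {x}. Q x z * min 1 (\<pi> z * Q z x / (\<pi> x * Q x z))) =
      (\<Sum>z\<in>S - {x}. Q x z * min 1 (\<pi>' z * Q z x / (\<pi>' x * Q x z)))"
    by (rule sum.cong) (use assms in auto)
  then show ?thesis using assms by (simp add: mh_kernel_def)
qed

lemma abs_le_imp_square_le: "\<bar>x\<bar> \<le> y \<Longrightarrow> x\<^sup>2 \<le> y\<^sup>2" for x y :: real
  using power_mono[of "\<bar>x\<bar>" y 2] by simp

lemma card_ancestors_le: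
  assumes v: "v \<in> nodes L" "v \<noteq> (-1, 0)"
  shows "card (ancestors L v) \<le> L + 1"
proof -
  obtain l k where lk: "v = (int l, k)" "l < L" using nodes_cases[OF v] by blast
  have "ancestors L v \<subseteq> (\<lambda>j. (parent ^^ j) v) ` {..L}"
  proof
    fix u assume u: "u \<in> ancestors L v"
    then obtain j where j: "u = (parent ^^ j) v" by (auto simp: ancestors_def anc_eq_def)
    have "fst u \<ge> -1" using u by (auto simp: ancestors_def nodes_def)
    then have "int j \<le> int l + 1" by (simp add: j lk parent_power)
    then show "u \<in> (\<lambda>j. (parent ^^ j) v) ` {..L}" using j lk(2) by auto
  qed
  then have "card (ancestors L v) \<le> card ((\<lambda>j. (parent ^^ j) v) ` {..L})"
    by (intro card_mono) auto
  also have "\<dots> \<le> card {..L}" by (rule card_image_le) simp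
  finally show ?thesis by simp
qed

text \<open>Chosen such that \<open>(A - 2)\<^sup>2 / 4 \<ge> 4 * c + K + 13\<close>. Of this, \<open>4 * c + 4\<close> pays for the nodes of a twig,
\<open>K\<close> for the number of subsets of the least tree, and the remaining \<open>9\<close> gives the factor \<open>1 / 10\<close>
required of \<open>\<eta>\<close>.\<close>

definition signal_constant :: "real \<Rightarrow> real \<Rightarrow> real" where
  "signal_constant c K = 2 + 2 * (4 * c + K + 13)"

text \<open>The empirical coefficients are not normalised: the noise has variance \<open>n\<close>.\<close>

definition typical :: "nat \<Rightarrow> nat \<Rightarrow> (node \<Rightarrow> real) \<Rightarrow> (nat \<Rightarrow> real) \<Rightarrow> bool" where
  "typical L n \<beta> Y \<longleftrightarrow> (\<forall>v\<in>nodes L. \<bar>haar_coeff n Y v - real n * \<beta> v\<bar> \<le> 2 * sqrt (ln (real n)) * sqrt (real n))"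

locale typical_data =
  fixes A C c K :: real and L Lmax n :: nat and B :: "node set" and \<beta> :: "node \<Rightarrow> real" and Y :: "nat \<Rightarrow> real"
  assumes c: "c > 5 / 2" and K: "K > 0" and A: "A \<ge> signal_constant c K"
    and L: "1 \<le> L" "L \<le> Lmax" and n: "n = 2 ^ (Lmax + 1)"
    and B: "B \<subseteq> nodes L"
    and \<beta>: "\<And>v. v \<in> B \<Longrightarrow> A * ln (real n) / sqrt (real n) < \<bar>\<beta> v\<bar>" "\<And>v. \<bar>\<beta> v\<bar> \<le> C"
      "\<And>v. v \<notin> B \<Longrightarrow> \<beta> v = 0"
    and card_R: "real (card (least_tree L B)) \<le> K * (ln (real n))\<^sup>2"
    and typY: "typical L n \<beta> Y"
begin

abbreviation "q \<equiv> real n powr (- c)"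
abbreviation "w \<equiv> node_weight q n Y"
abbreviation "lg \<equiv> ln (real n)"

lemma n4: "4 \<le> real n"
proof -
  have "(2::real) ^ 2 \<le> 2 ^ (Lmax + 1)" using L by (intro power_increasing) auto
  then show ?thesis by (simp add: n)
qed

lemma two_pow_L: "2 * 2 ^ L \<le> real n"
proof -
  have "(2::real) ^ (L + 1) \<le> 2 ^ (Lmax + 1)" using L by (intro power_increasing) auto
  then show ?thesis by (simp add: n)
qed

lemma lg1: "1 \<le> lg"
proof -
  have "1 \<le> 2 * ln (2::real)" using ln2_ge_two_thirds by simp
  also have "\<dots> = ln (2 ^ 2)" by (subst ln_realpow) simp_all
  also have "\<dots> \<le> lg" using n4 by simp
  finally show ?thesis .
qed

lemma L_le_lg: "real (L + 1) \<le> 2 * lg"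
proof -
  have "real (Lmax + 1) * (1 / 2) \<le> real (Lmax + 1) * ln 2"
    using ln2_ge_two_thirds by (intro mult_left_mono) auto
  also have "\<dots> = ln (2 ^ (Lmax + 1))" by (rule ln_realpow[symmetric])
  also have "\<dots> = lg" by (simp add: n)
  finally show ?thesis using L by simp
qed

lemma q_bounds: "0 < q" "q \<le> 1 / 2" "q < 1"
proof -
  show "0 < q" using n4 by simp
  have "q \<le> real n powr (- 1)" using n4 c by (intro powr_mono) auto
  also have "\<dots> = 1 / real n" using n4 by (simp add: powr_minus_divide)
  also have "\<dots> \<le> 1 / 4" using n4 by (intro divide_left_mono) auto
  finally show "q \<le> 1 / 2" "q < 1" by simp_all
qed

text \<open>The negative logarithm of a lower bound for the prior factor of a node. The summand \<open>1\<close> accounts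
for the probability \<open>1 - n powr - c\<close> of not splitting an external node.\<close>

definition node_cost :: real where "node_cost = (c + 1 / 2) * ln (1 + real n) + 1"

lemma node_cost_nonneg: "0 \<le> node_cost"
  unfolding node_cost_def using c n4 by (intro add_nonneg_nonneg mult_nonneg_nonneg) auto

lemma node_cost_le: "node_cost \<le> (2 * c + 2) * lg"
proof -
  have "4 * real n \<le> real n * real n" using n4 by (intro mult_right_mono) auto
  then have "1 + real n \<le> real n ^ 2" using n4 unfolding power2_eq_square by linarith
  then have "ln (1 + real n) \<le> ln (real n ^ 2)" using n4 by simp
  also have "\<dots> = 2 * lg" using n4 by (simp add: ln_realpow)
  finally have "(c + 1 / 2) * ln (1 + real n) \<le> (c + 1 / 2) * (2 * lg)" using c by (intro mult_left_mono) auto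
  then have "node_cost \<le> (c + 1 / 2) * (2 * lg) + lg" unfolding node_cost_def using lg1 by linarith
  also have "\<dots> = (2 * c + 2) * lg" by (simp add: algebra_simps)
  finally show ?thesis .
qed

lemma prior_factor_ge: "exp (- node_cost) \<le> q * (1 - q) / sqrt (1 + real n)"
proof -
  have "exp (- node_cost) = exp (- c * ln (1 + real n)) * exp (- 1) * exp (- (ln (1 + real n) / 2))"
    unfolding node_cost_def exp_add[symmetric] by (rule arg_cong[where f = exp]) (simp add: algebra_simps)
  also have "\<dots> \<le> q * (1 - q) * exp (- (ln (1 + real n) / 2))"
  proof (intro mult_right_mono mult_mono)
    have "c * lg \<le> c * ln (1 + real n)" using c n4 by (intro mult_left_mono) auto
    then show "exp (- c * ln (1 + real n)) \<le> q" using n4 by (simp add: powr_def)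
    have "2 \<le> exp (1::real)" using exp_ge_add_one_self[of 1] by simp
    then have "exp (- 1) \<le> (1 / 2 :: real)" by (simp add: exp_minus field_simps)
    then show "exp (- 1) \<le> 1 - q" using q_bounds by linarith
  qed (use q_bounds in auto)
  also have "exp (- (ln (1 + real n) / 2)) = 1 / sqrt (1 + real n)"
    using n4 by (simp add: exp_minus inverse_eq_divide ln_sqrt[symmetric])
  finally show ?thesis by simp
qed

lemma w_eq: "w v = q * (1 - q) / sqrt (1 + real n) * exp ((haar_coeff n Y v)\<^sup>2 / (2 * (1 + real n)))"
  by (simp add: node_weight_def)

lemma w_ge: "exp (- node_cost) * exp ((haar_coeff n Y v)\<^sup>2 / (2 * (1 + real n))) \<le> w v"
  unfolding w_eq by (intro mult_right_mono prior_factor_ge) simp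

lemma w_ge_cost: "exp (- node_cost) \<le> w v"
proof -
  have "exp (- node_cost) * 1 \<le> exp (- node_cost) * exp ((haar_coeff n Y v)\<^sup>2 / (2 * (1 + real n)))"
    by (intro mult_left_mono) auto
  then show ?thesis using w_ge[of v] by linarith
qed

lemma w_le_exp: "w v \<le> exp ((haar_coeff n Y v)\<^sup>2 / (2 * (1 + real n)))"
proof -
  have "q * (1 - q) / sqrt (1 + real n) \<le> 1 * 1 / 1"
    using q_bounds by (intro frac_le mult_mono) auto
  then have "w v \<le> 1 * exp ((haar_coeff n Y v)\<^sup>2 / (2 * (1 + real n)))"
    unfolding w_eq by (intro mult_right_mono) auto
  then show ?thesis by simp
qed

lemma noise_level: "v \<in> nodes L \<Longrightarrow> \<bar>haar_coeff n Y v - real n * \<beta> v\<bar> \<le> 2 * sqrt lg * sqrt (real n)"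
  using typY unfolding typical_def by blast

lemma noise_level_square: "(2 * sqrt lg * sqrt (real n))\<^sup>2 = 4 * lg * real n"
  using lg1 by (simp add: power_mult_distrib)

text \<open>The exponent is at most \<open>2 * ln n\<close>, so the weight is at most \<open>n powr (2 - c - 1 / 2)\<close>.\<close>

lemma w_noise_le:
  assumes v: "v \<in> nodes L" "v \<notin> B" shows "w v \<le> 1 / real n"
proof -
  have "\<bar>haar_coeff n Y v\<bar> \<le> 2 * sqrt lg * sqrt (real n)"
    using noise_level[OF v(1)] \<beta>(3)[OF v(2)] by simp
  then have "(haar_coeff n Y v)\<^sup>2 \<le> 4 * lg * real n"
    unfolding noise_level_square[symmetric] by (rule abs_le_imp_square_le)
  also have "\<dots> \<le> (2 * lg) * (2 * (1 + real n))" using lg1 by (simp add: algebra_simps)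
  finally have "(haar_coeff n Y v)\<^sup>2 / (2 * (1 + real n)) \<le> 2 * lg" using n4 by (simp add: field_simps)
  then have e: "exp ((haar_coeff n Y v)\<^sup>2 / (2 * (1 + real n))) \<le> real n powr 2"
    using n4 by (simp add: powr_def)
  have "q * (1 - q) / sqrt (1 + real n) \<le> q * 1 / (real n powr (1 / 2))"
    using q_bounds n4 by (intro frac_le mult_left_mono) (auto simp: powr_half_sqrt)
  also have "\<dots> = real n powr (- c - 1 / 2)" by (simp add: powr_diff)
  finally have "w v \<le> real n powr (- c - 1 / 2) * real n powr 2"
    unfolding w_eq using e q_bounds n4 by (intro mult_mono) auto
  also have "\<dots> = real n powr (- c - 1 / 2 + 2)" by (rule powr_add[symmetric])
  also have "\<dots> \<le> real n powr (- 1)" using c n4 by (intro powr_mono) auto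
  also have "\<dots> = 1 / real n" using n4 by (simp add: powr_minus_divide)
  finally show ?thesis .
qed

text \<open>The mean of the coefficient exceeds the noise by at least \<open>(A - 2) * ln n * sqrt n\<close>, because
\<open>sqrt (ln n) \<le> ln n\<close> for \<open>n \<ge> 4\<close>.\<close>

lemma w_signal_ge:
  assumes v: "v \<in> B"
  shows "exp ((A - 2)\<^sup>2 / 4 * lg\<^sup>2 - node_cost) \<le> w v"
proof -
  have A2: "A \<ge> 2" using A c K by (simp add: signal_constant_def)
  have sn: "0 < sqrt (real n)" using n4 by simp
  have "sqrt lg * 1 \<le> sqrt lg * sqrt lg" using lg1 by (intro mult_left_mono) auto
  then have s: "sqrt lg \<le> lg" using lg1 by simp
  have "A * lg * sqrt (real n) = real n * (A * lg / sqrt (real n))"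
    using sn by (simp add: field_simps)
  also have "\<dots> \<le> real n * \<bar>\<beta> v\<bar>" using \<beta>(1)[OF v] by (intro mult_left_mono) auto
  finally have "A * lg * sqrt (real n) \<le> \<bar>real n * \<beta> v\<bar>" by (simp add: abs_mult)
  moreover have "2 * sqrt lg * sqrt (real n) \<le> 2 * lg * sqrt (real n)"
    using s sn by (intro mult_right_mono) auto
  moreover have "\<bar>haar_coeff n Y v - real n * \<beta> v\<bar> \<le> 2 * sqrt lg * sqrt (real n)"
    using B v by (intro noise_level) blast
  ultimately have "(A - 2) * lg * sqrt (real n) \<le> \<bar>haar_coeff n Y v\<bar>"
    by (simp add: algebra_simps)
  then have "((A - 2) * lg * sqrt (real n))\<^sup>2 \<le> \<bar>haar_coeff n Y v\<bar>\<^sup>2"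
    using A2 lg1 by (intro power_mono) auto
  then have b2: "(A - 2)\<^sup>2 * lg\<^sup>2 * real n \<le> (haar_coeff n Y v)\<^sup>2"
    by (simp add: power_mult_distrib)
  have "(A - 2)\<^sup>2 / 4 * lg\<^sup>2 * (2 * (1 + real n)) \<le> (A - 2)\<^sup>2 / 4 * lg\<^sup>2 * (4 * real n)"
    using n4 by (intro mult_left_mono) auto
  also have "\<dots> = (A - 2)\<^sup>2 * lg\<^sup>2 * real n" by simp
  finally have "(A - 2)\<^sup>2 / 4 * lg\<^sup>2 \<le> (haar_coeff n Y v)\<^sup>2 / (2 * (1 + real n))"
    using b2 n4 by (simp add: pos_le_divide_eq)
  then have "exp ((A - 2)\<^sup>2 / 4 * lg\<^sup>2) \<le> exp ((haar_coeff n Y v)\<^sup>2 / (2 * (1 + real n)))" by simp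
  then have "exp (- node_cost) * exp ((A - 2)\<^sup>2 / 4 * lg\<^sup>2) \<le> w v"
    by (intro order_trans[OF mult_left_mono w_ge]) simp_all
  moreover have "exp (- node_cost) * exp ((A - 2)\<^sup>2 / 4 * lg\<^sup>2) = exp ((A - 2)\<^sup>2 / 4 * lg\<^sup>2 - node_cost)"
    unfolding exp_add[symmetric] by (rule arg_cong[where f = exp]) simp
  ultimately show ?thesis by simp
qed

definition eta :: real where "eta = exp (- (((A - 2)\<^sup>2 / 4 - (4 * c + 4)) * lg\<^sup>2))"

lemma prod_w_ge:
  assumes "finite U" shows "exp (- (real (card U) * node_cost)) \<le> prod w U"
proof -
  have "(\<Prod>u\<in>U. exp (- node_cost)) \<le> prod w U"
    by (intro prod_mono) (simp add: w_ge_cost)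
  then show ?thesis by (simp add: exp_of_nat_mult[symmetric])
qed

text \<open>The twig has at most \<open>L + 1 \<le> 2 * ln n\<close> nodes, each of which costs at most \<open>(2 * c + 2) * ln n\<close>.\<close>

lemma signal_twig:
  assumes v: "v \<in> B" "v \<noteq> (-1, 0)" and U: "U \<subseteq> ancestors L v" "v \<in> U"
  shows "1 \<le> eta * prod w U"
proof -
  have vn: "v \<in> nodes L" using v B by blast
  have fA: "finite (ancestors L v)" unfolding ancestors_def using finite_nodes by simp
  have fU: "finite U" by (rule finite_subset[OF U(1) fA])
  have "card U \<le> card (ancestors L v)" by (rule card_mono[OF fA U(1)])
  also have "\<dots> \<le> L + 1" by (rule card_ancestors_le[OF vn v(2)])
  finally have "real (card U) \<le> real (L + 1)" by (simp only: of_nat_le_iff)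
  then have cU: "real (card U) \<le> 2 * lg" using L_le_lg by linarith
  have "real (card U) * node_cost \<le> (2 * lg) * ((2 * c + 2) * lg)"
    using cU node_cost_le node_cost_nonneg lg1 by (intro mult_mono) auto
  also have "\<dots> = (4 * c + 4) * lg\<^sup>2" by (simp add: power2_eq_square algebra_simps)
  finally have cost: "real (card U) * node_cost \<le> (4 * c + 4) * lg\<^sup>2" .
  have cardU: "real (card U) = 1 + real (card (U - {v}))"
    unfolding card_Suc_Diff1[OF fU U(2), symmetric] by (rule of_nat_Suc)
  have "exp ((A - 2)\<^sup>2 / 4 * lg\<^sup>2 - node_cost) * exp (- (real (card (U - {v})) * node_cost)) \<le> w v * prod w (U - {v})"
    using w_signal_ge[OF v(1)] prod_w_ge[of "U - {v}"] fU w_ge_cost[of v]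
    by (intro mult_mono) (auto intro: order_trans[OF exp_ge_zero])
  also have "w v * prod w (U - {v}) = prod w U" by (rule prod.remove[OF fU U(2), symmetric])
  also have "exp ((A - 2)\<^sup>2 / 4 * lg\<^sup>2 - node_cost) * exp (- (real (card (U - {v})) * node_cost))
      = exp ((A - 2)\<^sup>2 / 4 * lg\<^sup>2 - real (card U) * node_cost)"
    unfolding exp_add[symmetric] cardU by (rule arg_cong[where f = exp]) (simp add: algebra_simps)
  finally have "eta * exp ((A - 2)\<^sup>2 / 4 * lg\<^sup>2 - real (card U) * node_cost) \<le> eta * prod w U"
    unfolding eta_def by (intro mult_left_mono) auto
  moreover have "0 \<le> - (((A - 2)\<^sup>2 / 4 - (4 * c + 4)) * lg\<^sup>2) + ((A - 2)\<^sup>2 / 4 * lg\<^sup>2 - real (card U) * node_cost)"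
    using cost by (simp add: algebra_simps)
  then have "1 \<le> eta * exp ((A - 2)\<^sup>2 / 4 * lg\<^sup>2 - real (card U) * node_cost)"
    unfolding eta_def exp_add[symmetric] by simp
  ultimately show ?thesis by linarith
qed

lemma eta_small: "2 ^ card (least_tree L B) * eta \<le> 1 / 10"
proof -
  let ?G = "4 * c + K + 13"
  have G1: "1 \<le> ?G" using c K by simp
  have "?G * 1 \<le> ?G * ?G" using G1 by (intro mult_left_mono) auto
  also have "\<dots> \<le> ((A - 2) / 2) * ((A - 2) / 2)"
    using A G1 by (intro mult_mono) (auto simp: signal_constant_def)
  also have "\<dots> = (A - 2)\<^sup>2 / 4" by (simp add: power2_eq_square)
  finally have gap: "K + 9 \<le> (A - 2)\<^sup>2 / 4 - (4 * c + 4)" by simp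
  have l2: "1 \<le> lg\<^sup>2" using lg1 by simp
  have "(2::real) \<le> exp 1" using exp_ge_add_one_self[of 1] by simp
  then have "(2::real) ^ card (least_tree L B) \<le> exp 1 ^ card (least_tree L B)" by (intro power_mono) auto
  also have "\<dots> = exp (real (card (least_tree L B)))" by (simp add: exp_of_nat_mult[symmetric])
  also have "\<dots> \<le> exp (K * lg\<^sup>2)" using card_R by simp
  finally have "2 ^ card (least_tree L B) * eta \<le> exp (K * lg\<^sup>2) * eta"
    by (intro mult_right_mono) (auto simp: eta_def)
  also have "\<dots> \<le> exp (- 9)"
  proof -
    have "(K + 9) * lg\<^sup>2 \<le> ((A - 2)\<^sup>2 / 4 - (4 * c + 4)) * lg\<^sup>2"
      using gap by (intro mult_right_mono) auto
    then have "K * lg\<^sup>2 + - (((A - 2)\<^sup>2 / 4 - (4 * c + 4)) * lg\<^sup>2) \<le> - 9"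
      using l2 by (simp add: distrib_right)
    then show ?thesis unfolding eta_def exp_add[symmetric] by simp
  qed
  (* exp 9 is at least 1 + 9 *)
  also have "exp (- 9) \<le> (1 / 10 :: real)"
    using exp_ge_add_one_self[of 9] by (simp add: exp_minus field_simps)
  finally show ?thesis .
qed

lemma signal_weights: "signal_weights L B w eta"
proof
  show "B \<subseteq> nodes L" by (rule B)
  show "0 < w v" for v by (rule node_weight_pos[OF q_bounds(1,3)])
  show "(\<Sum>v\<in>nodes L - least_tree L B. w v) \<le> 1 / 2"
  proof -
    have "(\<Sum>v\<in>nodes L - least_tree L B. w v) \<le> (\<Sum>v\<in>nodes L - least_tree L B. 1 / real n)"
      using least_tree(2)[OF B] by (intro sum_mono w_noise_le) auto
    also have "\<dots> \<le> real (2 ^ L) * (1 / real n)"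
    proof -
      have "card (nodes L - least_tree L B) \<le> 2 ^ L"
        using card_mono[of "nodes L" "nodes L - least_tree L B"] finite_nodes[of L] card_nodes[of L] by simp
      then have "real (card (nodes L - least_tree L B)) \<le> real (2 ^ L)" by (simp only: of_nat_le_iff)
      then have "real (card (nodes L - least_tree L B)) * (1 / real n) \<le> real (2 ^ L) * (1 / real n)"
        by (rule mult_right_mono) simp
      then show ?thesis by simp
    qed
    also have "\<dots> \<le> 1 / 2" using two_pow_L n4 by (simp add: field_simps)
    finally show ?thesis .
  qed
  show "1 \<le> eta * prod w U" if "v \<in> B" "v \<noteq> (-1, 0)" "U \<subseteq> ancestors L v" "v \<in> U" for v U
    using that by (rule signal_twig)
  show "0 < eta" by (simp add: eta_def)
  show "2 ^ card (least_tree L B) * eta \<le> 1 / 10" by (rule eta_small)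
qed

lemma w_le:
  assumes v: "v \<in> nodes L" shows "w v \<le> exp (real n * C\<^sup>2 + 4 * lg)"
proof -
  let ?b = "haar_coeff n Y v" and ?m = "real n * \<beta> v"
  have "(?b - ?m)\<^sup>2 \<le> 4 * lg * real n"
    unfolding noise_level_square[symmetric] by (rule abs_le_imp_square_le[OF noise_level[OF v]])
  moreover have "?m\<^sup>2 \<le> (real n * C\<^sup>2) * real n"
  proof -
    have "\<bar>\<beta> v\<bar>\<^sup>2 \<le> C\<^sup>2" using \<beta>(2)[of v] by (intro power_mono) auto
    then have "(\<beta> v)\<^sup>2 * (real n)\<^sup>2 \<le> C\<^sup>2 * (real n)\<^sup>2" by (intro mult_right_mono) auto
    then show ?thesis by (simp add: power2_eq_square mult_ac)
  qed
  moreover have "?b\<^sup>2 \<le> 2 * (?b - ?m)\<^sup>2 + 2 * ?m\<^sup>2"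
  proof -
    have "0 \<le> (?b - 2 * ?m)\<^sup>2" by simp
    then show ?thesis by (simp add: power2_eq_square algebra_simps)
  qed
  ultimately have "?b\<^sup>2 \<le> (real n * C\<^sup>2 + 4 * lg) * (2 * real n)" by (simp add: algebra_simps)
  also have "\<dots> \<le> (real n * C\<^sup>2 + 4 * lg) * (2 * (1 + real n))"
    using lg1 by (intro mult_left_mono) auto
  finally have "?b\<^sup>2 / (2 * (1 + real n)) \<le> real n * C\<^sup>2 + 4 * lg"
    using n4 by (simp add: pos_divide_le_eq)
  then have "exp (?b\<^sup>2 / (2 * (1 + real n))) \<le> exp (real n * C\<^sup>2 + 4 * lg)" by simp
  with w_le_exp[of v] show ?thesis by (rule order_trans)
qed

lemma typical_mixing:
  fixes D \<epsilon> :: real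
  assumes D: "D > 1" and \<epsilon>: "0 < \<epsilon>" "\<epsilon> < 1"
  shows "ereal_of_enat (twiggy_mixing_time D (\<lambda>_. q) L n Y \<epsilon>)
    \<le> ereal ((D ^ L - 1) / (D - 1) * 2 ^ (2 * L + 3) *
            (real n * ((c + 1 / 2) * ln (1 + real n) + real (card (least_tree L B)) * C\<^sup>2 + 1)
             + 4 * real (card (least_tree L B)) * ln (real n) + ln (2 / \<epsilon>)))"
proof -
  interpret signal_weights L B w eta by (rule signal_weights)
  have post: "posterior (\<lambda>_. q) L n Y T = target T" if "T \<in> trees L" for T
    unfolding posterior_eq[OF n L(2) q_bounds(1,3) that] target_def total_def weight_def by simp
  have same: "twiggy_mixing_time D (\<lambda>_. q) L n Y \<epsilon> =
      mixing_time (trees L) (lazy (mh_kernel (trees L) (proposal D L) target)) target \<epsilon>"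
    unfolding twiggy_mixing_time_def twiggy_chain_def
  proof (rule mixing_time_cong)
    fix x y assume "x \<in> trees L" "y \<in> trees L"
    then have "mh_kernel (trees L) (proposal D L) (posterior (\<lambda>_. q) L n Y) x y =
        mh_kernel (trees L) (proposal D L) target x y"
      by (intro mh_kernel_cong post)
    then show "lazy (mh_kernel (trees L) (proposal D L) (posterior (\<lambda>_. q) L n Y)) x y =
        lazy (mh_kernel (trees L) (proposal D L) target) x y"
      by (simp add: lazy_def)
  qed (rule post)
  (* a tree has at most 2 ^ L nodes, which is less than n *)
  define a where "a = real n * node_cost"
  define b where "b = real (card R) * (real n * C\<^sup>2 + 4 * lg)"
  have low: "exp (- a) \<le> weight T" if T: "T \<in> trees L" for T
  proof -
    have "card T \<le> 2 ^ L" using card_mono[OF finite_nodes treesD(1)[OF T]] by (simp add: card_nodes)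
    then have "real (card T) \<le> 2 ^ L" by simp
    moreover have "0 \<le> (2::real) ^ L" by simp
    ultimately have "real (card T) \<le> real n" using two_pow_L by linarith
    then have "real (card T) * node_cost \<le> a"
      unfolding a_def using node_cost_nonneg by (intro mult_right_mono) auto
    then have "exp (- a) \<le> exp (- (real (card T) * node_cost))" by simp
    also have "\<dots> \<le> weight T" unfolding weight_def by (rule prod_w_ge[OF tree_finite[OF T]])
    finally show ?thesis .
  qed
  have high: "weight R \<le> exp b"
  proof -
    have "weight R \<le> (\<Prod>v\<in>R. exp (real n * C\<^sup>2 + 4 * lg))"
      unfolding weight_def
    proof (rule prod_mono)
      fix v assume "v \<in> R"
      then have "v \<in> nodes L" using treesD(1)[OF R(1)] by blast
      then show "0 \<le> w v \<and> w v \<le> exp (real n * C\<^sup>2 + 4 * lg)" using w_le w_pos[of v] by simp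
    qed
    also have "\<dots> = exp b" by (simp add: b_def exp_of_nat_mult[symmetric])
    finally show ?thesis .
  qed
  have "0 \<le> a + b" unfolding a_def b_def using node_cost_nonneg lg1 by simp
  from twiggy_mixing[OF D L(1) \<epsilon> low high this]
  have "ereal_of_enat (twiggy_mixing_time D (\<lambda>_. q) L n Y \<epsilon>)
    \<le> ereal ((D ^ L - 1) / (D - 1) * 2 ^ (2 * L + 3) * (a + b + ln (2 / \<epsilon>)))"
    unfolding same .
  also have "a + b + ln (2 / \<epsilon>) = real n * ((c + 1 / 2) * ln (1 + real n) + real (card R) * C\<^sup>2 + 1)
             + 4 * real (card R) * ln (real n) + ln (2 / \<epsilon>)"
    by (simp add: a_def b_def node_cost_def algebra_simps)
  finally show ?thesis .
qed

end

section \<open>Measurability of the mixing time\<close>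

lemma ereal_of_enat_INF_le_iff:
  "ereal_of_enat (INF t\<in>X. enat t) \<le> ereal r \<longleftrightarrow> (\<exists>t\<in>X. real t \<le> r)"
proof
  assume le: "ereal_of_enat (INF t\<in>X. enat t) \<le> ereal r"
  show "\<exists>t\<in>X. real t \<le> r"
  proof (cases "X = {}")
    case True
    then show ?thesis using le by (simp add: top_enat_def)
  next
    case False
    define m where "m = (LEAST t. t \<in> X)"
    have m: "m \<in> X" unfolding m_def using False by (metis LeastI ex_in_conv)
    have "enat m \<le> (INF t\<in>X. enat t)"
      by (rule INF_greatest) (simp add: m_def Least_le)
    moreover have "(INF t\<in>X. enat t) \<le> enat m" using m by (rule INF_lower)
    ultimately have "(INF t\<in>X. enat t) = enat m" by simp
    then show ?thesis using le m by auto
  qed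
next
  assume "\<exists>t\<in>X. real t \<le> r"
  then obtain t where t: "t \<in> X" "real t \<le> r" by blast
  have "ereal_of_enat (INF t\<in>X. enat t) \<le> ereal_of_enat (enat t)"
    using t(1) by (simp only: ereal_of_enat_le_iff) (rule INF_lower)
  also have "\<dots> \<le> ereal r" using t(2) by simp
  finally show "ereal_of_enat (INF t\<in>X. enat t) \<le> ereal r" .
qed

text \<open>Written with quantifiers over countable sets, the event that the mixing time is at most \<open>r\<close> is
visibly measurable.\<close>

lemma mixing_time_le_iff:
  assumes S: "finite S" "S \<noteq> {}"
  shows "ereal_of_enat (mixing_time S P \<pi> \<epsilon>) \<le> ereal r \<longleftrightarrow>
    (\<forall>x\<in>S. \<exists>t. real t \<le> r \<and> (\<forall>t'. t \<le> t' \<longrightarrow>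
      (\<forall>A\<in>Pow S. \<bar>(\<Sum>y\<in>A. kernel_power S P t' x y) - (\<Sum>y\<in>A. \<pi> y)\<bar> \<le> \<epsilon>)))"
proof -
  have tv: "tv_dist S \<mu> \<nu> \<le> \<epsilon> \<longleftrightarrow> (\<forall>A\<in>Pow S. \<bar>sum \<mu> A - sum \<nu> A\<bar> \<le> \<epsilon>)" for \<mu> \<nu> :: "'a \<Rightarrow> real"
    unfolding tv_dist_def using S(1) by (subst Max_le_iff) auto
  have mx: "ereal_of_enat (Max X) \<le> ereal r \<longleftrightarrow> (\<forall>x\<in>X. ereal_of_enat x \<le> ereal r)"
    if X: "finite X" "X \<noteq> {}" for X :: "enat set"
  proof
    assume le: "ereal_of_enat (Max X) \<le> ereal r"
    show "\<forall>x\<in>X. ereal_of_enat x \<le> ereal r"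
    proof
      fix x assume "x \<in> X"
      then have "ereal_of_enat x \<le> ereal_of_enat (Max X)" using X by (simp only: ereal_of_enat_le_iff Max_ge)
      then show "ereal_of_enat x \<le> ereal r" using le by (rule order_trans)
    qed
  qed (use Max_in[OF X] in blast)
  show ?thesis
    unfolding mixing_time_def
    using S by (subst mx) (simp_all add: ereal_of_enat_INF_le_iff tv conj_commute)
qed

lemma measurable_kernel_power:
  assumes P: "\<And>x y. x \<in> S \<Longrightarrow> y \<in> S \<Longrightarrow> (\<lambda>\<omega>. P \<omega> x y) \<in> borel_measurable M"
  shows "x \<in> S \<Longrightarrow> y \<in> S \<Longrightarrow> (\<lambda>\<omega>. kernel_power S (P \<omega>) t x y) \<in> borel_measurable M"
proof (induction t arbitrary: y)
  case (Suc t)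
  show ?case
    unfolding kernel_power.simps
    by (intro borel_measurable_sum borel_measurable_times Suc.IH P Suc.prems)
qed simp

lemma measurable_mh_kernel:
  assumes \<pi>: "\<And>x. x \<in> S \<Longrightarrow> (\<lambda>\<omega>. \<pi> \<omega> x) \<in> borel_measurable M" and xy: "x \<in> S" "y \<in> S"
  shows "(\<lambda>\<omega>. mh_kernel S Q (\<pi> \<omega>) x y) \<in> borel_measurable M"
proof -
  have move: "(\<lambda>\<omega>. Q x z * min 1 (\<pi> \<omega> z * Q z x / (\<pi> \<omega> x * Q x z))) \<in> borel_measurable M" if z: "z \<in> S" for z
    using \<pi>[OF z] \<pi>[OF xy(1)] by measurable
  show ?thesis
  proof (cases "y = x")
    case True
    have "(\<lambda>\<omega>. 1 - (\<Sum>z\<in>S - {x}. Q x z * min 1 (\<pi> \<omega> z * Q z x / (\<pi> \<omega> x * Q x z)))) \<in> borel_measurable M"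
      by (intro borel_measurable_diff borel_measurable_sum move borel_measurable_const) auto
    then show ?thesis using True by (simp add: mh_kernel_def)
  next
    case False
    then show ?thesis using move[OF xy(2)] by (simp add: mh_kernel_def)
  qed
qed

lemma measurable_mixing_time_le:
  assumes S: "finite S" "S \<noteq> {}"
    and P: "\<And>x y. x \<in> S \<Longrightarrow> y \<in> S \<Longrightarrow> (\<lambda>\<omega>. P \<omega> x y) \<in> borel_measurable M"
    and \<pi>: "\<And>x. x \<in> S \<Longrightarrow> (\<lambda>\<omega>. \<pi> \<omega> x) \<in> borel_measurable M"
  shows "{\<omega> \<in> space M. ereal_of_enat (mixing_time S (P \<omega>) (\<pi> \<omega>) \<epsilon>) \<le> ereal r} \<in> sets M"
proof -
  have 1: "Measurable.pred M (\<lambda>\<omega>. \<bar>(\<Sum>y\<in>A. kernel_power S (P \<omega>) t x y) - (\<Sum>y\<in>A. \<pi> \<omega> y)\<bar> \<le> \<epsilon>)"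
    if A: "A \<in> Pow S" and x: "x \<in> S" for A t x
  proof -
    have [measurable]: "(\<lambda>\<omega>. \<Sum>y\<in>A. kernel_power S (P \<omega>) t x y) \<in> borel_measurable M"
      using A x by (intro borel_measurable_sum measurable_kernel_power P) auto
    have [measurable]: "(\<lambda>\<omega>. \<Sum>y\<in>A. \<pi> \<omega> y) \<in> borel_measurable M"
      using A by (intro borel_measurable_sum \<pi>) auto
    show ?thesis by measurable
  qed
  have "Measurable.pred M (\<lambda>\<omega>. \<forall>x\<in>S. \<exists>t. real t \<le> r \<and> (\<forall>t'. t \<le> t' \<longrightarrow>
      (\<forall>A\<in>Pow S. \<bar>(\<Sum>y\<in>A. kernel_power S (P \<omega>) t' x y) - (\<Sum>y\<in>A. \<pi> \<omega> y)\<bar> \<le> \<epsilon>)))"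
    using S(1)
    by (intro pred_intros_finite pred_intros_countable pred_intros_logic 1) (auto intro: 1)
  then show ?thesis
    unfolding mixing_time_le_iff[OF S] pred_def .
qed

lemma measurable_haar_coeff: "(\<lambda>Y. haar_coeff n Y v) \<in> borel_measurable (Pi\<^sub>M {1..n} (\<lambda>_. borel))"
  unfolding haar_coeff_def by measurable

lemma measurable_posterior:
  assumes n: "n = 2 ^ (Lmax + 1)" and L: "L \<le> Lmax" and q: "0 < q" "q < 1" and T: "T \<in> trees L"
  shows "(\<lambda>Y. posterior (\<lambda>_. q) L n Y T) \<in> borel_measurable (Pi\<^sub>M {1..n} (\<lambda>_. borel))"
proof -
  note [measurable] = measurable_haar_coeff
  have [measurable]: "(\<lambda>Y. node_weight q n Y v) \<in> borel_measurable (Pi\<^sub>M {1..n} (\<lambda>_. borel))" for v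
    unfolding node_weight_def by measurable
  show ?thesis
    unfolding posterior_eq[OF n L q T] by measurable
qed

lemma measurable_twiggy_mixing_time_le:
  assumes n: "n = 2 ^ (Lmax + 1)" and L: "L \<le> Lmax" and q: "0 < q" "q < 1"
  shows "{Y \<in> space (Pi\<^sub>M {1..n} (\<lambda>_. borel)). ereal_of_enat (twiggy_mixing_time D (\<lambda>_. q) L n Y \<epsilon>) \<le> ereal r}
    \<in> sets (Pi\<^sub>M {1..n} (\<lambda>_. borel))"
  unfolding twiggy_mixing_time_def
proof (rule measurable_mixing_time_le)
  show "finite (trees L)" "trees L \<noteq> {}" using finite_trees nodes_in_trees by blast+
  show "(\<lambda>Y. posterior (\<lambda>_. q) L n Y T) \<in> borel_measurable (Pi\<^sub>M {1..n} (\<lambda>_. borel))" if "T \<in> trees L" for T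
    by (rule measurable_posterior[OF n L q that])
  show "(\<lambda>Y. twiggy_chain D (\<lambda>_. q) L n Y x y) \<in> borel_measurable (Pi\<^sub>M {1..n} (\<lambda>_. borel))"
    if "x \<in> trees L" "y \<in> trees L" for x y
    unfolding twiggy_chain_def lazy_def
    by (intro borel_measurable_add borel_measurable_divide borel_measurable_const measurable_mh_kernel
        measurable_posterior[OF n L q] that)
qed

section \<open>Typical data\<close>

lemma data_law_measure:
  assumes E: "E \<in> sets (Pi\<^sub>M {1..n} (\<lambda>_. borel))"
  shows "measure (data_law n f) E = measure (Pi\<^sub>M {1..n} (\<lambda>_. std_normal))
    {e \<in> space (Pi\<^sub>M {1..n} (\<lambda>_. std_normal)). (\<lambda>i\<in>{1..n}. f (real i / real n) + e i) \<in> E}"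
proof -
  have "(\<lambda>e. \<lambda>i\<in>{1..n}. f (real i / real n) + e i)
      \<in> measurable (Pi\<^sub>M {1..n} (\<lambda>_. std_normal)) (Pi\<^sub>M {1..n} (\<lambda>_. borel))"
    by measurable
  then show ?thesis
    unfolding data_law_def using E
    by (subst measure_distr) (auto intro!: arg_cong[where f = "measure _"])
qed

lemma haar_coeff_data:
  assumes n: "n = 2 ^ (Lmax + 1)" and L: "L \<le> Lmax" and B: "B \<subseteq> nodes L" and v: "v \<in> nodes L"
    and f: "\<And>x. x \<in> {0..1} \<Longrightarrow> f x = (\<Sum>u\<in>B. \<beta> u * haar u x)"
  shows "haar_coeff n (\<lambda>i\<in>{1..n}. f (real i / real n) + e i) v
    = real n * (if v \<in> B then \<beta> v else 0) + (\<Sum>i=1..n. haar v (real i / real n) * e i)"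
proof -
  have fin: "finite B" by (rule finite_subset[OF B finite_nodes])
  have "haar_coeff n (\<lambda>i\<in>{1..n}. f (real i / real n) + e i) v
      = (\<Sum>i=1..n. (\<Sum>u\<in>B. \<beta> u * (haar v (real i / real n) * haar u (real i / real n))) + haar v (real i / real n) * e i)"
    unfolding haar_coeff_def
  proof (rule sum.cong[OF refl])
    fix i assume i: "i \<in> {1..n}"
    have "f (real i / real n) = (\<Sum>u\<in>B. \<beta> u * haar u (real i / real n))"
      using i by (intro f) (simp add: divide_le_eq_1)
    then show "haar v (real i / real n) * (\<lambda>i\<in>{1..n}. f (real i / real n) + e i) i =
        (\<Sum>u\<in>B. \<beta> u * (haar v (real i / real n) * haar u (real i / real n))) + haar v (real i / real n) * e i"
      using i by (simp add: sum_distrib_left distrib_left mult_ac del: haar.simps)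
  qed
  also have "\<dots> = (\<Sum>u\<in>B. \<beta> u * (\<Sum>i=1..n. haar v (real i / real n) * haar u (real i / real n)))
      + (\<Sum>i=1..n. haar v (real i / real n) * e i)"
    unfolding sum.distrib sum_distrib_left by (subst sum.swap) (rule refl)
  also have "(\<Sum>u\<in>B. \<beta> u * (\<Sum>i=1..n. haar v (real i / real n) * haar u (real i / real n)))
      = (\<Sum>u\<in>B. if v = u then real n * \<beta> u else 0)"
  proof (rule sum.cong[OF refl])
    fix u assume "u \<in> B"
    then have "(\<Sum>i=1..n. haar v (real i / real n) * haar u (real i / real n)) = (if v = u then real n else 0)"
      using B by (intro haar_orthogonal[OF n L v]) blast
    then show "\<beta> u * (\<Sum>i=1..n. haar v (real i / real n) * haar u (real i / real n)) = (if v = u then real n * \<beta> u else 0)"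
      by simp
  qed
  also have "\<dots> = real n * (if v \<in> B then \<beta> v else 0)" using fin by (simp add: sum.delta')
  finally show ?thesis .
qed

lemma measurable_typical:
  "{Y \<in> space (Pi\<^sub>M {1..n} (\<lambda>_. borel)). typical L n \<beta> Y} \<in> sets (Pi\<^sub>M {1..n} (\<lambda>_. borel))"
proof -
  note [measurable] = measurable_haar_coeff
  have "Measurable.pred (Pi\<^sub>M {1..n} (\<lambda>_. borel)) (\<lambda>Y. \<forall>v\<in>nodes L.
      \<bar>haar_coeff n Y v - real n * \<beta> v\<bar> \<le> 2 * sqrt (ln (real n)) * sqrt (real n))"
    using finite_nodes by (intro pred_intros_finite) measurable
  then show ?thesis unfolding typical_def pred_def .
qed

lemma prob_space_data_law: "prob_space (data_law n f)"
proof -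
  interpret M: prob_space "Pi\<^sub>M {1..n} (\<lambda>_. std_normal)" by (rule prob_space_PiM) (rule std_normal_prob_space)
  show ?thesis unfolding data_law_def by (rule M.prob_space_distr) measurable
qed

text \<open>A union bound over at most \<open>n / 2\<close> nodes, each with a failure probability of \<open>2 / n\<^sup>2\<close>.\<close>

lemma typical_prob:
  assumes n: "n = 2 ^ (Lmax + 1)" and L: "1 \<le> L" "L \<le> Lmax" and B: "B \<subseteq> nodes L"
    and f: "\<And>x. x \<in> {0..1} \<Longrightarrow> f x = (\<Sum>u\<in>B. \<beta> u * haar u x)"
  shows "1 - 1 / real n \<le> measure (data_law n f)
    {Y \<in> space (Pi\<^sub>M {1..n} (\<lambda>_. borel)). typical L n (\<lambda>v. if v \<in> B then \<beta> v else 0) Y}"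
    (is "_ \<le> measure _ ?E")
proof -
  let ?M = "Pi\<^sub>M {1..n} (\<lambda>_. std_normal)"
  interpret M: prob_space ?M by (rule prob_space_PiM) (rule std_normal_prob_space)
  let ?g = "\<lambda>e. \<lambda>i\<in>{1..n}. f (real i / real n) + e i"
  define t where "t = 2 * sqrt (ln (real n))"
  (* the noise at the node v reaches its bound *)
  define F where "F v = {e \<in> space ?M. t * sqrt (real n) \<le> \<bar>\<Sum>i=1..n. haar v (real i / real n) * e i\<bar>}" for v
  have n2: "2 * 2 ^ L \<le> real n" "2 \<le> real n"
  proof -
    have "(2::real) ^ (L + 1) \<le> 2 ^ (Lmax + 1)" using L by (intro power_increasing) auto
    then show "2 * 2 ^ L \<le> real n" by (simp add: n)
    have "(2::real) ^ 1 \<le> 2 ^ (Lmax + 1)" by (intro power_increasing) auto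
    then show "2 \<le> real n" by (simp add: n)
  qed
  have t: "0 \<le> t" "exp (- t\<^sup>2 / 2) = 1 / (real n)\<^sup>2"
  proof -
    have "- t\<^sup>2 / 2 = - (ln (real n) + ln (real n))" unfolding t_def using n2 by (simp add: power_mult_distrib)
    then have "exp (- t\<^sup>2 / 2) = exp (- (ln (real n) + ln (real n)))" by (simp only:)
    also have "\<dots> = 1 / (real n)\<^sup>2"
      unfolding exp_minus exp_add using n2 by (simp add: power2_eq_square inverse_eq_divide)
    finally show "exp (- t\<^sup>2 / 2) = 1 / (real n)\<^sup>2" .
    show "0 \<le> t" unfolding t_def using n2 by simp
  qed
  have FM: "F v \<in> sets ?M" for v unfolding F_def by measurable
  have FP: "measure ?M (F v) \<le> 2 * (1 / (real n)\<^sup>2)" if v: "v \<in> nodes L" for v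
  proof -
    have "(\<Sum>i=1..n. (haar v (real i / real n))\<^sup>2) = real n"
      using haar_orthogonal[OF n L(2) v v] by (simp add: power2_eq_square del: haar.simps)
    then show ?thesis
      unfolding F_def t(2)[symmetric] using n2 t(1) by (intro gaussian_linear_abs_tail) auto
  qed
  have "measure ?M (\<Union>v\<in>nodes L. F v) \<le> (\<Sum>v\<in>nodes L. measure ?M (F v))"
    using FM finite_nodes by (intro measure_UNION_le) auto
  also have "\<dots> \<le> (\<Sum>v\<in>nodes L. 2 * (1 / (real n)\<^sup>2))" by (intro sum_mono FP)
  also have "\<dots> = (2 * 2 ^ L) / (real n)\<^sup>2" by (simp add: card_nodes)
  also have "\<dots> \<le> real n / (real n)\<^sup>2" using n2 by (intro divide_right_mono) auto
  also have "\<dots> = 1 / real n" using n2 by (simp add: power2_eq_square)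
  finally have bad: "measure ?M (\<Union>v\<in>nodes L. F v) \<le> 1 / real n" .
  have U: "(\<Union>v\<in>nodes L. F v) \<in> sets ?M" using FM finite_nodes by (intro sets.finite_UN) auto
  have "1 - 1 / real n \<le> measure ?M (space ?M - (\<Union>v\<in>nodes L. F v))"
    using bad M.prob_compl[OF U] by simp
  also have "\<dots> \<le> measure ?M {e \<in> space ?M. ?g e \<in> ?E}"
  proof (rule M.finite_measure_mono)
    have g: "?g \<in> measurable ?M (Pi\<^sub>M {1..n} (\<lambda>_. borel))" by measurable
    have "{e \<in> space ?M. ?g e \<in> ?E} = ?g -` ?E \<inter> space ?M" by blast
    then show "{e \<in> space ?M. ?g e \<in> ?E} \<in> sets ?M"
      using measurable_sets[OF g measurable_typical] by simp
    show "space ?M - (\<Union>v\<in>nodes L. F v) \<subseteq> {e \<in> space ?M. ?g e \<in> ?E}"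
    proof
      fix e assume e: "e \<in> space ?M - (\<Union>v\<in>nodes L. F v)"
      have "\<bar>\<Sum>i=1..n. haar v (real i / real n) * e i\<bar> \<le> t * sqrt (real n)" if "v \<in> nodes L" for v
        using e that by (auto simp: F_def simp del: haar.simps)
      then have "typical L n (\<lambda>v. if v \<in> B then \<beta> v else 0) (?g e)"
        unfolding typical_def t_def[symmetric] using haar_coeff_data[OF n L(2) B _ f] by simp
      moreover have "?g e \<in> space (Pi\<^sub>M {1..n} (\<lambda>_. borel))" by (simp add: space_PiM)
      ultimately show "e \<in> {e \<in> space ?M. ?g e \<in> ?E}" using e by simp
    qed
  qed
  also have "\<dots> = measure (data_law n f) ?E" by (rule data_law_measure[OF measurable_typical, symmetric])
  finally show ?thesis .
qed

text \<open>For \<open>L = 0\<close> the bound of the theorem is \<open>0\<close>, without room for rounding, so the one-point chain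
needs its own argument.\<close>

lemma twiggy_mixing_time_depth_0:
  assumes n: "n = 2 ^ (Lmax + 1)" and D: "D > 1" and q: "0 < q" "q < 1" and \<epsilon>: "0 < \<epsilon>"
  shows "twiggy_mixing_time D (\<lambda>_. q) 0 n Y \<epsilon> = 0"
proof -
  let ?r = "{(-1, 0)} :: node set"
  have "nodes 0 = ?r" by (auto simp: nodes_def)
  then have S: "trees 0 = {?r}"
    using treesD(1,2)[of _ 0] nodes_in_trees[of 0] by auto
  have post: "posterior (\<lambda>_. q) 0 n Y ?r = 1"
    using node_weight_pos[OF q, of n Y "(-1, 0)"]
    by (subst posterior_eq[OF n _ q]) (auto simp: S)
  let ?P = "twiggy_chain D (\<lambda>_. q) 0 n Y"
  have P: "?P ?r ?r = 1" by (simp add: twiggy_chain_def lazy_def mh_kernel_def S)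
  have "kernel_power (trees 0) ?P t ?r ?r = 1" for t by (induction t) (simp_all add: S P)
  then have "tv_dist (trees 0) (kernel_power (trees 0) ?P t x) (posterior (\<lambda>_. q) 0 n Y) \<le> \<epsilon>"
    if "x \<in> trees 0" for t x
    using that \<epsilon> by (simp add: tv_dist_def S Pow_insert post)
  then have "twiggy_mixing_time D (\<lambda>_. q) 0 n Y \<epsilon> \<le> enat 0"
    unfolding twiggy_mixing_time_def by (intro mixing_time_le finite_trees) (auto simp: S)
  then show ?thesis by (simp add: zero_enat_def[symmetric])
qed

theorem theorem4:
  fixes D c K :: real
  assumes "D > 1" and "c > 5 / 2 + ln D" and "K > 0"
  shows "\<exists>A\<^sub>0 > 0. \<forall>A \<ge> A\<^sub>0. \<forall>C > 0. \<forall>(Lmax::nat) (L::nat) (n::nat) f\<^sub>0 B \<beta> \<epsilon>.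
    L \<le> Lmax \<longrightarrow>
    n = 2 ^ (Lmax + 1) \<longrightarrow>
    assumption_Fb A C L n f\<^sub>0 B \<beta> \<longrightarrow>
    real (card (least_tree L B)) \<le> K * (ln (real n))\<^sup>2 \<longrightarrow>
    0 < \<epsilon> \<longrightarrow> \<epsilon> < 1 \<longrightarrow>
    \<P>(Y in data_law n f\<^sub>0.
        ereal_of_enat (twiggy_mixing_time D (\<lambda>_. real n powr (- c)) L n Y \<epsilon>)
        \<le> ereal ((D ^ L - 1) / (D - 1) * 2 ^ (2 * L + 3) *
            (real n * ((c + 1 / 2) * ln (1 + real n) + real (card (least_tree L B)) * C\<^sup>2 + 1)
             + 4 * real (card (least_tree L B)) * ln (real n) + ln (2 / \<epsilon>))))
      \<ge> 1 - 4 / real n"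
proof (intro exI[of _ "signal_constant c K"] conjI allI impI)
  have c: "c > 5 / 2"
  proof -
    have "0 < ln D" using assms(1) by simp
    then show ?thesis using assms(2) by linarith
  qed
  then show "signal_constant c K > 0" using assms(3) by (simp add: signal_constant_def)
  fix A C :: real and Lmax L n :: nat and f\<^sub>0 :: "real \<Rightarrow> real" and B and \<beta> and \<epsilon> :: real
  assume A: "signal_constant c K \<le> A" and C: "0 < C" and L: "L \<le> Lmax" and n: "n = 2 ^ (Lmax + 1)"
    and F: "assumption_Fb A C L n f\<^sub>0 B \<beta>" and R: "real (card (least_tree L B)) \<le> K * (ln (real n))\<^sup>2"
    and \<epsilon>: "0 < \<epsilon>" "\<epsilon> < 1"
  let ?q = "real n powr (- c)"
  define r where "r = (D ^ L - 1) / (D - 1) * 2 ^ (2 * L + 3) *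
            (real n * ((c + 1 / 2) * ln (1 + real n) + real (card (least_tree L B)) * C\<^sup>2 + 1)
             + 4 * real (card (least_tree L B)) * ln (real n) + ln (2 / \<epsilon>))"
  have F': "B \<subseteq> nodes L" "\<And>x. x \<in> {0..1} \<Longrightarrow> f\<^sub>0 x = (\<Sum>v\<in>B. \<beta> v * haar v x)"
    "\<And>v. v \<in> B \<Longrightarrow> A * ln (real n) / sqrt (real n) < \<bar>\<beta> v\<bar>" "\<And>v. v \<in> B \<Longrightarrow> \<bar>\<beta> v\<bar> < C"
    using F unfolding assumption_Fb_def assumption_F_def by blast+
  have n2: "2 \<le> real n"
  proof -
    have "(2::real) ^ 1 \<le> 2 ^ (Lmax + 1)" by (intro power_increasing) auto
    then show ?thesis by (simp add: n)
  qed
  have q: "0 < ?q" "?q < 1"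
    using n2 c powr_less_mono[of "- c" 0 "real n"] by simp_all
  interpret data: prob_space "data_law n f\<^sub>0" by (rule prob_space_data_law)
  have space: "space (data_law n f\<^sub>0) = space (Pi\<^sub>M {1..n} (\<lambda>_. borel))"
    and sets: "sets (data_law n f\<^sub>0) = sets (Pi\<^sub>M {1..n} (\<lambda>_. borel))"
    by (simp_all add: data_law_def)
  let ?G = "{Y \<in> space (data_law n f\<^sub>0). ereal_of_enat (twiggy_mixing_time D (\<lambda>_. ?q) L n Y \<epsilon>) \<le> ereal r}"
  have G: "?G \<in> sets (data_law n f\<^sub>0)"
    unfolding space sets by (rule measurable_twiggy_mixing_time_le[OF n L q])
  have "1 - 1 / real n \<le> measure (data_law n f\<^sub>0) ?G"
  proof (cases "L = 0")
    case True
    then have "r = 0" by (simp add: r_def)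
    then have "?G = space (data_law n f\<^sub>0)"
      unfolding True twiggy_mixing_time_depth_0[OF n assms(1) q \<epsilon>(1)] by simp
    then show ?thesis using data.prob_space by simp
  next
    case False
    then have L1: "1 \<le> L" by simp
    let ?E = "{Y \<in> space (Pi\<^sub>M {1..n} (\<lambda>_. borel)). typical L n (\<lambda>v. if v \<in> B then \<beta> v else 0) Y}"
    have "?E \<subseteq> ?G"
    proof
      fix Y assume Y: "Y \<in> ?E"
      interpret typical_data A C c K L Lmax n B "\<lambda>v. if v \<in> B then \<beta> v else 0" Y
        by standard (use c assms(3) A L1 L n F' R Y C in \<open>auto simp: less_imp_le\<close>)
      show "Y \<in> ?G" using typical_mixing[OF assms(1) \<epsilon>] Y unfolding r_def space by simp
    qed
    then have "measure (data_law n f\<^sub>0) ?E \<le> measure (data_law n f\<^sub>0) ?G"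
      using G by (rule data.finite_measure_mono)
    moreover have "1 - 1 / real n \<le> measure (data_law n f\<^sub>0) ?E"
      by (rule typical_prob[OF n L1 L F'(1,2)])
    ultimately show ?thesis by linarith
  qed
  moreover have "1 - 4 / real n \<le> 1 - 1 / real n" using n2 by (simp add: field_simps)
  ultimately show "1 - 4 / real n \<le> \<P>(Y in data_law n f\<^sub>0.
        ereal_of_enat (twiggy_mixing_time D (\<lambda>_. real n powr (- c)) L n Y \<epsilon>)
        \<le> ereal ((D ^ L - 1) / (D - 1) * 2 ^ (2 * L + 3) *
            (real n * ((c + 1 / 2) * ln (1 + real n) + real (card (least_tree L B)) * C\<^sup>2 + 1)
             + 4 * real (card (least_tree L B)) * ln (real n) + ln (2 / \<epsilon>))))"
    unfolding r_def by (rule order_trans[rotated])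
qed

end
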